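(* Let $\mathcal{Q},\mathcal{R},\mathcal{S}$ be noncrossing partitions of $\{1,\dots,n\}$ such that $\mathcal{S}$ is a refinement of $\mathcal{R}$ and $\mathcal{R}$ is a refinement of $\mathcal{Q}$, and let $[T]:\mathcal{R}\to\mathcal{S}$ be a cluster morphism. The linear map $\pi_*:\mathbb{Z}\mathcal{S}\to\mathbb{Z}\mathcal{R}$ induces a bijection $E_T(\mathcal{S},\mathcal{Q})\cong E(\mathcal{R},\mathcal{Q})$. Furthermore, $E,E'$ are compatible edges in $E_T(\mathcal{S},\mathcal{Q})$ if and only if the corresponding elements of $E(\mathcal{R},\mathcal{Q})$ are compatible.
   Context: Noncrossing partitions. Let $V$ be a finite totally ordered set, regarded as a subset of $\mathbb{R}$. A partition $\mathcal{S}$ of $V$ (a set of disjoint nonempty subsets, called parts, with union $V$) is noncrossing if there are no $a<b<c<d$ with $a,c$ in one part and $b,d$ in another. $\mathcal{S}$ is a refinement of $\mathcal{R}$ if every part of $\mathcal{S}$ lies in a part of $\mathcal{R}$. The support of a part $A$ is the closed interval $supp\,A=[\min A,\max A]$. Vertical ordering of parts: $X<Y$ if $supp\,X\subset supp\,Y$. $A$ covers $B$ if $A$ is directly above $B$ in the Hasse diagram of the vertical ordering. Parts $A,B$ with disjoint supports are laterally ordered: $A$ is to the left of $B$ if every element of $A$ is less than every element of $B$. Two distinct parts $A,B$ are parallel if either both are maximal in the vertical ordering, or both are covered by the same part $C$ and no element of $C$ lies between $A$ and $B$. A parallel set is a maximal set of pairwise parallel parts; it is totally ordered laterally. Edges.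 $\mathbb{Z}\mathcal{S}$ is the free abelian group on $\mathcal{S}$. $E(\mathcal{S})\subset\mathbb{Z}\mathcal{S}$ is the set of all $A-B$ (a directed edge from $B$ to $A$) where $A,B$ are parallel parts or $A$ covers $B$. If $\mathcal{S}$ refines $\mathcal{R}$, with induced surjection $\pi:\mathcal{S}\to\mathcal{R}$ (sending each part of $\mathcal{S}$ to the part of $\mathcal{R}$ containing it), then $E(\mathcal{S},\mathcal{R})=\coprod_{W\in\mathcal{R}}E(\pi^{-1}(W))\subseteq E(\mathcal{S})$, where $\pi^{-1}(W)$ is viewed as a noncrossing partition of $W$. $\pi_*:\mathbb{Z}\mathcal{S}\to\mathbb{Z}\mathcal{R}$ is the linear map induced by $\pi$. Trees. A directed forest on a finite set $S$ is a linearly independent set of edges $w-v\in\mathbb{Z}S$ ($v\ne w$); a tree is a forest of maximal size. It gives the partial order $v\le w$ if there is a directed path from $v$ to $w$. A tree is rooted if there is a unique maximal element, the root. If $w-v$ is an edge, $v$ is a child of $w$. A binary tree on a totally ordered set $\{v_1,\dots,v_m\}$ (ordered by index) is a rooted tree $T$ such that, in its partial order: (i) if $v_j-v_i\in T$ then $v_k<v_i$ for all $k$ strictly between $i$ and $j$; (ii) every $v_i$ has at most two children; (iii) if $v_i$ has two children $v_j,v_k$ then $i$ lies between $j$ and $k$. A binary forest on $\mathcal{S}$ is a union of binary trees, one on each parallel set of $\mathcal{S}$ (with the lateral order). The rooted tree generated by a binary forest $F$ on $\mathcal{S}$ is the unique rooted tree $T$ on $\mathcal{S}$ with $F\subseteq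 T\subseteq E(\mathcal{S})$: it is obtained by adding, for each nonmaximal parallel set with root $R$ covered by the part $C$, the edge $C-R$. Cluster morphisms. If $\mathcal{S}$ refines $\mathcal{R}$, a cluster morphism $[T]:\mathcal{R}\to\mathcal{S}$ is given by $T=\coprod_{W\in\mathcal{R}}T_W\subseteq E(\mathcal{S},\mathcal{R})$, where each $T_W$ is the rooted tree generated by a binary forest on $\pi^{-1}(W)$. Two elements of $E(\mathcal{S},\mathcal{R})$ are compatible if some cluster morphism $\mathcal{R}\to\mathcal{S}$ contains both. For $[T]:\mathcal{R}\to\mathcal{S}$ as in the claim, $T\subseteq E(\mathcal{S},\mathcal{R})\subseteq E(\mathcal{S},\mathcal{Q})$, and $E_T(\mathcal{S},\mathcal{Q})$ is the set of all elements of $E(\mathcal{S},\mathcal{Q})$ which are compatible (in $E(\mathcal{S},\mathcal{Q})$) with all elements of $T$ but are not contained in $T$. *)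

theory Defs
  imports Complex_Main "HOL-Library.Poly_Mapping" "HOL-Library.Disjoint_Sets"
begin

section \<open>Noncrossing partitions\<close>

definition noncrossing :: "'a::linorder set set \<Rightarrow> bool" where
  "noncrossing S \<longleftrightarrow>
     \<not> (\<exists>X\<in>S. \<exists>Y\<in>S. X \<noteq> Y \<and>
          (\<exists>a b c d. a < b \<and> b < c \<and> c < d \<and> a \<in> X \<and> c \<in> X \<and> b \<in> Y \<and> d \<in> Y))"

definition noncrossing_partition :: "'a::linorder set \<Rightarrow> 'a set set \<Rightarrow> bool" where
  "noncrossing_partition V S \<longleftrightarrow> finite V \<and> partition_on V S \<and> noncrossing S"

text \<open>
  The support is an interval of the ambient linear order.  Only inclusions between supports matter,
  and these depend only on the endpoints, so the ambient order need not be that of the reals.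
\<close>

definition supp :: "'a::linorder set \<Rightarrow> 'a set" where
  "supp A = {Min A..Max A}"

definition below :: "'a::linorder set \<Rightarrow> 'a set \<Rightarrow> bool" where
  "below X Y \<longleftrightarrow> supp X \<subset> supp Y"

definition vmaximal :: "'a::linorder set set \<Rightarrow> 'a set \<Rightarrow> bool" where
  "vmaximal S A \<longleftrightarrow> A \<in> S \<and> \<not> (\<exists>B\<in>S. below A B)"

definition covers :: "'a::linorder set set \<Rightarrow> 'a set \<Rightarrow> 'a set \<Rightarrow> bool" where
  "covers S A B \<longleftrightarrow>
     A \<in> S \<and> B \<in> S \<and> below B A \<and> \<not> (\<exists>C\<in>S. below B C \<and> below C A)"

definition left_of :: "'a::linorder set \<Rightarrow> 'a set \<Rightarrow> bool" where
  "left_of A B \<longleftrightarrow> (\<forall>a\<in>A. \<forall>b\<in>B. a < b)"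

definition element_between :: "'a::linorder set \<Rightarrow> 'a set \<Rightarrow> 'a \<Rightarrow> bool" where
  "element_between A B c \<longleftrightarrow>
     (\<forall>a\<in>A. \<forall>b\<in>B. a < c \<and> c < b) \<or> (\<forall>a\<in>A. \<forall>b\<in>B. b < c \<and> c < a)"

definition parallel_parts :: "'a::linorder set set \<Rightarrow> 'a set \<Rightarrow> 'a set \<Rightarrow> bool" where
  "parallel_parts S A B \<longleftrightarrow>
     A \<in> S \<and> B \<in> S \<and> A \<noteq> B \<and>
     (vmaximal S A \<and> vmaximal S B \<or>
      (\<exists>C\<in>S. covers S C A \<and> covers S C B \<and> \<not> (\<exists>c\<in>C. element_between A B c)))"

definition parallel_set :: "'a::linorder set set \<Rightarrow> 'a set set \<Rightarrow> bool" where
  "parallel_set S P \<longleftrightarrow>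
     P \<subseteq> S \<and> pairwise (parallel_parts S) P \<and>
     (\<forall>P'\<subseteq>S. pairwise (parallel_parts S) P' \<and> P \<subseteq> P' \<longrightarrow> P' = P)"

section \<open>Edges\<close>

text \<open>
  The free abelian group on \<open>S\<close> consists of the finitely supported integer-valued functions with
  support in \<open>S\<close>.  The difference \<open>arrow w v\<close> is the directed edge from \<open>v\<close> to \<open>w\<close>.
\<close>

definition arrow :: "'b \<Rightarrow> 'b \<Rightarrow> 'b \<Rightarrow>\<^sub>0 int" where
  "arrow w v = frag_of w - frag_of v"

definition edges :: "'a::linorder set set \<Rightarrow> ('a set \<Rightarrow>\<^sub>0 int) set" where
  "edges S = {arrow A B | A B. A \<in> S \<and> B \<in> S \<and> (parallel_parts S A B \<or> covers S A B)}"

definition fiber :: "'a set set \<Rightarrow> 'a set \<Rightarrow> 'a set set" where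
  "fiber S W = {X \<in> S. X \<subseteq> W}"

text \<open>The vertical order, covers and parallel parts are those of \<open>fiber S W\<close>, not those of \<open>S\<close>.\<close>

definition rel_edges :: "'a::linorder set set \<Rightarrow> 'a set set \<Rightarrow> ('a set \<Rightarrow>\<^sub>0 int) set" where
  "rel_edges S R = (\<Union>W\<in>R. edges (fiber S W))"

definition part_containing :: "'a set set \<Rightarrow> 'a set \<Rightarrow> 'a set" where
  "part_containing R X = (THE W. W \<in> R \<and> X \<subseteq> W)"

definition pi_star :: "'a set set \<Rightarrow> ('a set \<Rightarrow>\<^sub>0 int) \<Rightarrow> ('a set \<Rightarrow>\<^sub>0 int)" where
  "pi_star R = frag_extend (\<lambda>X. frag_of (part_containing R X))"

section \<open>Trees\<close>

lemma module_frag_cmul: "module (frag_cmul :: int \<Rightarrow> ('b \<Rightarrow>\<^sub>0 int) \<Rightarrow> ('b \<Rightarrow>\<^sub>0 int))"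
  unfolding module_def
  by (simp add: frag_cmul_distrib frag_cmul_distrib2)

definition directed_forest :: "'b set \<Rightarrow> ('b \<Rightarrow>\<^sub>0 int) set \<Rightarrow> bool" where
  "directed_forest S T \<longleftrightarrow>
     finite S \<and> T \<subseteq> {arrow w v | w v. w \<in> S \<and> v \<in> S \<and> v \<noteq> w} \<and>
     \<not> module.dependent frag_cmul T"

definition directed_tree :: "'b set \<Rightarrow> ('b \<Rightarrow>\<^sub>0 int) set \<Rightarrow> bool" where
  "directed_tree S T \<longleftrightarrow>
     directed_forest S T \<and> (\<forall>F. directed_forest S F \<longrightarrow> card F \<le> card T)"

definition tree_le :: "('b \<Rightarrow>\<^sub>0 int) set \<Rightarrow> 'b \<Rightarrow> 'b \<Rightarrow> bool" where
  "tree_le T v w \<longleftrightarrow> (v, w) \<in> {(x, y). arrow y x \<in> T}\<^sup>*"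

definition tree_less :: "('b \<Rightarrow>\<^sub>0 int) set \<Rightarrow> 'b \<Rightarrow> 'b \<Rightarrow> bool" where
  "tree_less T v w \<longleftrightarrow> tree_le T v w \<and> v \<noteq> w"

definition rooted_tree :: "'b set \<Rightarrow> ('b \<Rightarrow>\<^sub>0 int) set \<Rightarrow> bool" where
  "rooted_tree S T \<longleftrightarrow>
     directed_tree S T \<and> (\<exists>!r. r \<in> S \<and> \<not> (\<exists>w\<in>S. tree_less T r w))"

definition children :: "'b set \<Rightarrow> ('b \<Rightarrow>\<^sub>0 int) set \<Rightarrow> 'b \<Rightarrow> 'b set" where
  "children S T w = {v \<in> S. arrow w v \<in> T}"

definition strictly_between :: "('b \<Rightarrow> 'b \<Rightarrow> bool) \<Rightarrow> 'b \<Rightarrow> 'b \<Rightarrow> 'b \<Rightarrow> bool" where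
  "strictly_between lt x y z \<longleftrightarrow> lt x z \<and> lt z y \<or> lt y z \<and> lt z x"

text \<open>\<open>lt\<close> is the strict total order on the vertex set \<open>P\<close>.\<close>

definition binary_tree ::
    "('b \<Rightarrow> 'b \<Rightarrow> bool) \<Rightarrow> 'b set \<Rightarrow> ('b \<Rightarrow>\<^sub>0 int) set \<Rightarrow> bool" where
  "binary_tree lt P T \<longleftrightarrow>
     rooted_tree P T \<and>
     (\<forall>x\<in>P. \<forall>y\<in>P. arrow y x \<in> T \<longrightarrow>
        (\<forall>z\<in>P. strictly_between lt x y z \<longrightarrow> tree_less T z x)) \<and>
     (\<forall>x\<in>P. card (children P T x) \<le> 2) \<and>
     (\<forall>x\<in>P. \<forall>y\<in>children P T x. \<forall>z\<in>children P T x.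
        y \<noteq> z \<longrightarrow> strictly_between lt y z x)"

definition binary_forest :: "'a::linorder set set \<Rightarrow> ('a set \<Rightarrow>\<^sub>0 int) set \<Rightarrow> bool" where
  "binary_forest S F \<longleftrightarrow>
     (\<exists>B. (\<forall>P. parallel_set S P \<longrightarrow> binary_tree left_of P (B P)) \<and>
          F = (\<Union>P\<in>{P. parallel_set S P}. B P))"

text \<open>
  For a binary forest \<open>F\<close> on a noncrossing partition \<open>S\<close> there is exactly one such \<open>T\<close>.
\<close>

definition generated_tree ::
    "'a::linorder set set \<Rightarrow> ('a set \<Rightarrow>\<^sub>0 int) set \<Rightarrow> ('a set \<Rightarrow>\<^sub>0 int) set \<Rightarrow> bool" where
  "generated_tree S F T \<longleftrightarrow> rooted_tree S T \<and> F \<subseteq> T \<and> T \<subseteq> edges S"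

section \<open>Cluster morphisms\<close>

text \<open>\<open>cluster_morphism R S T\<close>: the set \<open>T\<close> gives a cluster morphism from \<open>R\<close> to its refinement \<open>S\<close>.\<close>

definition cluster_morphism ::
    "'a::linorder set set \<Rightarrow> 'a set set \<Rightarrow> ('a set \<Rightarrow>\<^sub>0 int) set \<Rightarrow> bool" where
  "cluster_morphism R S T \<longleftrightarrow>
     (\<exists>U. (\<forall>W\<in>R. \<exists>F. binary_forest (fiber S W) F \<and> generated_tree (fiber S W) F (U W)) \<and>
          T = (\<Union>W\<in>R. U W))"

definition compatible ::
    "'a::linorder set set \<Rightarrow> 'a set set \<Rightarrow> ('a set \<Rightarrow>\<^sub>0 int) \<Rightarrow> ('a set \<Rightarrow>\<^sub>0 int) \<Rightarrow> bool" where
  "compatible S R e e' \<longleftrightarrow>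
     e \<in> rel_edges S R \<and> e' \<in> rel_edges S R \<and> (\<exists>T. cluster_morphism R S T \<and> e \<in> T \<and> e' \<in> T)"

definition compatible_edges ::
    "'a::linorder set set \<Rightarrow> 'a set set \<Rightarrow> ('a set \<Rightarrow>\<^sub>0 int) set \<Rightarrow> ('a set \<Rightarrow>\<^sub>0 int) set" where
  "compatible_edges S Q T = {e \<in> rel_edges S Q. e \<notin> T \<and> (\<forall>t\<in>T. compatible S Q e t)}"

end

theory Submission
  imports Defs
begin

text \<open>
  On one part of \<open>Q\<close> a cluster morphism is a search tree: its root is a vertically maximal part, which
  cuts the block into intervals, and the children of the root are the roots of search trees on these
  intervals.  The tree is encoded by a preorder \<open>le\<close> on the elements of the block whose classes are the
  parts, such that \<open>le x y\<close> implies \<open>le z y\<close> for all \<open>z\<close> between \<open>x\<close> and \<open>y\<close>, and such that every interval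
  has a largest element with respect to \<open>le\<close>; the edges are the pairs of immediate successors.

  In these terms the trees of \<open>S\<close> that contain \<open>T\<close> correspond to the trees of \<open>R\<close>.  Contracting \<open>T\<close>
  puts \<open>x\<close> below \<open>y\<close> if \<open>x\<close> is below some element of the \<open>R\<close>-block of \<open>y\<close>.  Conversely a tree of \<open>R\<close>
  is refined by putting \<open>x\<close> below \<open>y\<close> if this holds in \<open>R\<close> and if \<open>y\<close> dominates, with respect to \<open>T\<close>,
  all elements of its \<open>R\<close>-block between \<open>x\<close> and \<open>y\<close>.

  It remains to see that pairwise compatible edges lie in a common tree, which is then applied to
  \<open>T\<close> together with one or two edges.  One chooses as root a vertically maximal part that is neither
  the source of a given edge nor crossed by one, and continues in its gaps, where the root is prescribed
  if one of the given edges leads from the gap to the chosen root.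
\<close>

section \<open>Rooted trees and parent functions\<close>

text \<open>Membership in \<open>compatible_edges S Q T\<close> only says that an edge is compatible
  with each element of \<open>T\<close> separately, whereas lifting and contracting need one tree
  that contains all of \<open>T\<close> and the edge. Hence most of the work goes into a flag
  property: lying in a common tree is a condition on pairs. It holds because the relations that one
  edge imposes on the other parts can be read off from the positions of its two ends
  (\<open>forced\<close>), so that an obstruction already appears between two edges.

  Parallel edges and covering edges obey different rules. The preorder on elements removes the
  distinction, since both become immediate successors, and it turns contraction and refinement into
  operations on relations.

  Bijectivity meets a further obstacle: two edges with the same image may come with different trees.
  Comparisons between elements of different blocks are determined by \<open>T\<close> once they are
  known after contraction, so the lift of an edge does not depend on the tree.\<close>

lemma arrow_eq_iff:
  assumes "v \<noteq> w"
  shows "arrow w v = arrow w' v' \<longleftrightarrow> w' = w \<and> v' = v"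
proof
  assume eq: "arrow w v = arrow w' v'"
  have "poly_mapping.lookup (arrow w v) x = poly_mapping.lookup (arrow w' v') x" for x
    by (simp add: eq)
  from this[of w] this[of v] show "w' = w \<and> v' = v"
    using assms by (auto simp: arrow_def lookup_minus when_def split: if_splits)
qed simp

lemma arrow_same [simp]: "arrow v v = 0"
  by (simp add: arrow_def)

lemma arrow_eq_zero_iff: "arrow w v = 0 \<longleftrightarrow> v = w"
  by (auto simp: arrow_def frag_of_eq)

lemma arrow_not_in_independent:
  assumes "\<not> module.dependent frag_cmul T"
  shows "arrow v v \<notin> T"
  using module.dependent_zero[OF module_frag_cmul] assms by auto

lemma tree_less_out_edge:
  assumes "tree_less T x w"
  obtains y where "arrow y x \<in> T"
proof -
  have "(x, w) \<in> {(x, y). arrow y x \<in> T}\<^sup>*" "x \<noteq> w"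
    using assms by (simp_all add: tree_less_def tree_le_def)
  then obtain y where "(x, y) \<in> {(x, y). arrow y x \<in> T}"
    by (metis converse_rtranclE)
  then show ?thesis using that by simp
qed

text \<open>Contracting one edge keeps the others independent and removes a vertex, whence the
  induction. The bound serves twice: it shows that parent edges exhaust a rooted tree, and it
  certifies maximality.\<close>

lemma card_forest_le:
  assumes "directed_forest S F" "S \<noteq> {}"
  shows "finite F \<and> card F \<le> card S - 1"
  using assms
proof (induction "card S" arbitrary: S F)
  case 0
  then show ?case by (auto simp: directed_forest_def)
next
  case (Suc n)
  then have fin: "finite S" and sub: "F \<subseteq> {arrow w v | w v. w \<in> S \<and> v \<in> S \<and> v \<noteq> w}"
    and ind: "\<not> module.dependent frag_cmul F"
    by (auto simp: directed_forest_def)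
  have "F \<subseteq> (\<lambda>(w, v). arrow w v) ` (S \<times> S)"
    using sub by auto
  then have finF: "finite F"
    using fin by (meson finite_SigmaI finite_imageI finite_subset)
  note indD = module.independentD[OF module_frag_cmul ind]
  show ?case
  proof (cases "F = {}")
    case False
    then obtain w v where e: "arrow w v \<in> F" "w \<in> S" "v \<in> S" "v \<noteq> w"
      using sub by blast
    define e where "e = arrow w v"
    \<comment> \<open>\<open>\<phi>\<close> contracts the edge \<open>e\<close>: it is induced by the map that sends \<open>v\<close> to \<open>w\<close> and fixes the other vertices.\<close>
    define \<phi> where "\<phi> g = g + frag_cmul (poly_mapping.lookup g v) e" for g
    define F' where "F' = F - {e}"
    have relation: "\<forall>g\<in>F'. u g = 0" if "(\<Sum>g\<in>F'. frag_cmul (u g) (\<phi> g)) = 0" for u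
    proof -
      define c where "c = (\<Sum>g\<in>F'. u g * poly_mapping.lookup g v)"
      define u' where "u' = u(e := c)"
      have "(\<Sum>g\<in>F'. frag_cmul (u g) (\<phi> g)) =
          (\<Sum>g\<in>F'. frag_cmul (u g) g) + (\<Sum>g\<in>F'. frag_cmul (u g * poly_mapping.lookup g v) e)"
        by (simp add: \<phi>_def frag_cmul_distrib2 sum.distrib)
      also have "(\<Sum>g\<in>F'. frag_cmul (u g * poly_mapping.lookup g v) e) = frag_cmul c e"
        unfolding c_def using module.scale_sum_left[OF module_frag_cmul] by metis
      also have "(\<Sum>g\<in>F'. frag_cmul (u g) g) = (\<Sum>g\<in>F'. frag_cmul (u' g) g)"
        by (rule sum.cong) (auto simp: u'_def F'_def)
      also have "\<dots> + frag_cmul c e = (\<Sum>g\<in>F. frag_cmul (u' g) g)"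
        using e finF by (simp add: F'_def e_def u'_def sum.remove add.commute)
      finally have "(\<Sum>g\<in>F. frag_cmul (u' g) g) = 0"
        using that by simp
      then have "\<forall>g\<in>F. u' g = 0"
        using indD[OF finF order_refl] by blast
      then show ?thesis unfolding F'_def u'_def by (metis DiffE fun_upd_other singletonI)
    qed
    have inj: "inj_on \<phi> F'"
    proof (rule inj_onI)
      fix f g assume fg: "f \<in> F'" "g \<in> F'" "\<phi> f = \<phi> g"
      show "f = g"
      proof (rule ccontr)
        assume neq: "f \<noteq> g"
        define u where "u h = (if h = f then 1 else if h = g then -1 else 0 :: int)" for h
        have "(\<Sum>h\<in>F'. frag_cmul (u h) (\<phi> h)) = (\<Sum>h\<in>{f, g}. frag_cmul (u h) (\<phi> h))"
          using fg finF by (intro sum.mono_neutral_right) (auto simp: u_def F'_def)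
        also have "\<dots> = 0"
          using neq fg by (simp add: u_def)
        finally have "u f = 0" using relation fg by blast
        then show False by (simp add: u_def)
      qed
    qed
    have "directed_forest (S - {v}) (\<phi> ` F')"
      unfolding directed_forest_def
    proof (intro conjI subsetI)
      show "finite (S - {v})" using fin by simp
      show "\<not> module.dependent frag_cmul (\<phi> ` F')"
      proof
        assume "module.dependent frag_cmul (\<phi> ` F')"
        then obtain u where u: "(\<Sum>h\<in>\<phi> ` F'. frag_cmul (u h) h) = 0" "\<exists>h\<in>\<phi> ` F'. u h \<noteq> 0"
          using module.dependent_finite[OF module_frag_cmul, of "\<phi> ` F'"] finF
          by (auto simp: F'_def)
        then have "(\<Sum>g\<in>F'. frag_cmul (u (\<phi> g)) (\<phi> g)) = 0"
          by (simp add: sum.reindex[OF inj])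
        then show False using relation[of "u \<circ> \<phi>"] u(2) by auto
      qed
    next
      fix h assume "h \<in> \<phi> ` F'"
      then obtain b a where ab: "h = \<phi> (arrow b a)" "arrow b a \<in> F" "arrow b a \<noteq> e"
        "b \<in> S" "a \<in> S" "a \<noteq> b"
        using sub unfolding F'_def by blast
      have nrev: "\<not> (a = w \<and> b = v)"
      proof
        assume "a = w \<and> b = v"
        then have g: "arrow v w \<in> F'" using ab by (simp add: F'_def)
        define u where "u h = (if h = arrow v w then 1 else 0 :: int)" for h
        have "\<phi> (arrow v w) = 0"
          using e by (simp add: \<phi>_def e_def arrow_def lookup_minus)
        then have "(\<Sum>h\<in>F'. frag_cmul (u h) (\<phi> h)) = 0"
          by (intro sum.neutral) (auto simp: u_def)
        then have "u (arrow v w) = 0" using relation g by blast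
        then show False by (simp add: u_def)
      qed
      have "\<phi> (arrow b a) = arrow (if b = v then w else b) (if a = v then w else a)"
        using ab(6) e by (auto simp: \<phi>_def e_def arrow_def lookup_minus)
      then show "h \<in> {arrow w' v' |w' v'. w' \<in> S - {v} \<and> v' \<in> S - {v} \<and> v' \<noteq> w'}"
        using ab e nrev unfolding e_def
        by (intro CollectI exI[of _ "if b = v then w else b"] exI[of _ "if a = v then w else a"])
          (auto split: if_splits)
    qed
    moreover have "card (S - {v}) = n" "S - {v} \<noteq> {}"
      using Suc(2) e fin by auto
    ultimately have "card (\<phi> ` F') \<le> n - 1"
      using Suc(1) by blast
    then have "card F - 1 \<le> n - 1"
      using e(1) finF unfolding card_image[OF inj] by (simp add: F'_def e_def)
    moreover have "n > 0"
      using \<open>S - {v} \<noteq> {}\<close> \<open>card (S - {v}) = n\<close> fin by (metis card_gt_0_iff finite_Diff)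
    ultimately show ?thesis using finF \<open>Suc n = card S\<close> by linarith
  qed auto
qed

text \<open>The measure \<open>d\<close> stands for acyclicity. It only has to drop from a vertex to
  its parent, and it drives the inductions below.\<close>

locale parent_tree =
  fixes S :: "'b set" and r :: 'b and p :: "'b \<Rightarrow> 'b" and d :: "'b \<Rightarrow> nat" and T :: "('b \<Rightarrow>\<^sub>0 int) set"
  assumes root: "r \<in> S"
    and parent: "\<And>x. x \<in> S - {r} \<Longrightarrow> p x \<in> S \<and> p x \<noteq> x \<and> d (p x) < d x"
    and tree: "T = (\<lambda>x. arrow (p x) x) ` (S - {r})"

text \<open>Every vertex other than the unique maximal one has an outgoing edge. Choosing one for
  each gives \<open>card S - 1\<close> distinct edges, which by \<open>card_forest_le\<close> is all
  of \<open>T\<close>; hence parents are unique.\<close>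

lemma rooted_treeD:
  fixes S :: "'b set"
  assumes "rooted_tree S T"
  obtains r p d where "parent_tree S r p d T"
proof -
  from assms have forest: "directed_forest S T"
    and ex1: "\<exists>!r. r \<in> S \<and> \<not> (\<exists>w\<in>S. tree_less T r w)"
    by (auto simp: rooted_tree_def directed_tree_def)
  then have fin: "finite S" and sub: "T \<subseteq> {arrow w v | w v. w \<in> S \<and> v \<in> S \<and> v \<noteq> w}"
    and ind: "\<not> module.dependent frag_cmul T"
    by (auto simp: directed_forest_def)
  obtain r where r: "r \<in> S" "\<not> (\<exists>w\<in>S. tree_less T r w)" using ex1 by blast
  have "\<exists>y. arrow y x \<in> T" if x: "x \<in> S - {r}" for x
  proof -
    obtain w where "tree_less T x w" using ex1 r x by blast
    then show ?thesis by (metis tree_less_out_edge)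
  qed
  then obtain p where p: "\<And>x. x \<in> S - {r} \<Longrightarrow> arrow (p x) x \<in> T"
    by metis
  have pS: "p x \<in> S" "p x \<noteq> x" if "x \<in> S - {r}" for x
  proof -
    show "p x \<noteq> x" using p[OF that] arrow_not_in_independent[OF ind] by metis
    have "arrow (p x) x \<in> T" using p that by blast
    then obtain w v where "arrow (p x) x = arrow w v" "w \<in> S" using sub by blast
    then show "p x \<in> S" using \<open>p x \<noteq> x\<close> arrow_eq_iff[of x "p x" w v] by auto
  qed
  have inj: "inj_on (\<lambda>x. arrow (p x) x) (S - {r})"
    using pS(2) by (intro inj_onI) (metis arrow_eq_iff)
  define T' where "T' = (\<lambda>x. arrow (p x) x) ` (S - {r})"
  have "T' \<subseteq> T" using p by (auto simp: T'_def)
  moreover have "card T' = card S - 1"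
    using r fin by (simp add: T'_def card_image[OF inj])
  moreover have "finite T" "card T \<le> card S - 1"
    using card_forest_le[OF forest] r by auto
  ultimately have T: "T = T'"
    using card_seteq[of T T'] by simp
  define A where "A = {(x, p x) | x. x \<in> S - {r}}"
  \<comment> \<open>The vertices from which \<open>r\<close> cannot be reached would carry a forest with as many edges as vertices.\<close>
  have reach: "(x, r) \<in> A\<^sup>*" if "x \<in> S" for x
  proof (rule ccontr)
    assume nx: "(x, r) \<notin> A\<^sup>*"
    define C where "C = {x \<in> S. (x, r) \<notin> A\<^sup>*}"
    have CS: "C \<subseteq> S - {r}" by (auto simp: C_def)
    have pC: "p x \<in> C" if "x \<in> C" for x
    proof -
      have "(x, p x) \<in> A" "x \<in> S - {r}" using that CS by (auto simp: A_def)
      then show ?thesis using that pS(1) converse_rtrancl_into_rtrancl[of x "p x" A r]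
        by (auto simp: C_def)
    qed
    have "directed_forest C ((\<lambda>x. arrow (p x) x) ` C)"
      unfolding directed_forest_def
    proof (intro conjI subsetI)
      show "finite C" using fin CS by (auto intro: finite_subset)
      have "(\<lambda>x. arrow (p x) x) ` C \<subseteq> T" using CS p by blast
      then show "\<not> module.dependent frag_cmul ((\<lambda>x. arrow (p x) x) ` C)"
        using module.independent_mono[OF module_frag_cmul ind] by blast
      fix g assume "g \<in> (\<lambda>x. arrow (p x) x) ` C"
      then obtain x where x: "x \<in> C" "g = arrow (p x) x" by blast
      then have "p x \<in> C" "p x \<noteq> x" using pC CS pS(2) by auto
      then show "g \<in> {arrow w v |w v. w \<in> C \<and> v \<in> C \<and> v \<noteq> w}"
        using x by (intro CollectI exI[of _ "p x"] exI[of _ x]) auto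
    qed
    then have "card ((\<lambda>x. arrow (p x) x) ` C) \<le> card C - 1"
      using card_forest_le[of C] nx that by (auto simp: C_def)
    moreover have "card ((\<lambda>x. arrow (p x) x) ` C) = card C"
      using inj CS by (intro card_image) (rule inj_on_subset)
    moreover have "card C > 0"
      using nx that fin by (auto simp: C_def card_gt_0_iff)
    ultimately show False by simp
  qed
  define d where "d x = (LEAST k. (x, r) \<in> A ^^ k)" for x
  have "d (p x) < d x" if x: "x \<in> S - {r}" for x
  proof -
    have "(x, r) \<in> A ^^ d x"
      unfolding d_def using reach[of x] x by (auto intro: LeastI_ex simp: rtrancl_power)
    then obtain k where k: "d x = Suc k" "(x, r) \<in> A ^^ Suc k"
      using x by (cases "d x") auto
    obtain y where "(x, y) \<in> A" "(y, r) \<in> A ^^ k"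
      using relpow_Suc_D2[OF k(2)] by blast
    then have "(p x, r) \<in> A ^^ k" by (auto simp: A_def)
    then have "d (p x) \<le> k" unfolding d_def by (rule Least_le)
    then show ?thesis using k by simp
  qed
  then have "parent_tree S r p d T"
    using r pS T unfolding T'_def parent_tree_def by blast
  then show ?thesis by (rule that)
qed

lemma parent_reaches_root:
  fixes S :: "'b set" and d :: "'b \<Rightarrow> nat"
  assumes "\<And>x. x \<in> S - {r} \<Longrightarrow> p x \<in> S \<and> d (p x) < d x" "x \<in> S"
    and "\<And>x. x \<in> S - {r} \<Longrightarrow> arrow (p x) x \<in> T"
  shows "tree_le T x r"
  using assms(2)
proof (induction "d x" arbitrary: x rule: less_induct)
  case less
  show ?case
  proof (cases "x = r")
    case False
    then have "tree_le T (p x) r" "arrow (p x) x \<in> T" using less assms by auto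
    then show ?thesis by (auto simp: tree_le_def intro: converse_rtrancl_into_rtrancl)
  qed (simp add: tree_le_def)
qed

context parent_tree
begin

lemma zero_notin: "arrow x x \<notin> T"
proof
  assume "arrow x x \<in> T"
  then have "0 \<in> (\<lambda>x. arrow (p x) x) ` (S - {r})" by (simp add: tree)
  then obtain z where z: "z \<in> S - {r}" "0 = arrow (p z) z" by (rule imageE)
  then have "z = p z" using arrow_eq_zero_iff[of "p z" z] by simp
  then show False using parent[OF z(1)] by simp
qed

lemma arrow_iff: "arrow y x \<in> T \<longleftrightarrow> x \<in> S - {r} \<and> y = p x"
proof (cases "x = y")
  case True
  then show ?thesis using zero_notin parent by metis
next
  case False
  then show ?thesis unfolding tree by (auto simp: arrow_eq_iff)
qed

lemma le_refl: "tree_le T x x"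
  by (simp add: tree_le_def)

lemma le_trans: "tree_le T x y \<Longrightarrow> tree_le T y z \<Longrightarrow> tree_le T x z"
  by (simp add: tree_le_def)

lemma le_parent: "x \<in> S - {r} \<Longrightarrow> tree_le T x (p x)"
  unfolding tree_le_def using arrow_iff[of "p x" x] by auto

lemma le_cases:
  assumes "tree_le T x y"
  shows "x = y \<or> x \<in> S - {r} \<and> tree_le T (p x) y"
proof -
  define E where "E = {(x, y). arrow y x \<in> T}"
  have "x = y \<or> (\<exists>z. (x, z) \<in> E \<and> (z, y) \<in> E\<^sup>*)"
    using assms unfolding tree_le_def E_def[symmetric] by (metis converse_rtranclE)
  then show ?thesis
    using arrow_iff unfolding tree_le_def E_def[symmetric] by (auto simp: E_def)
qed

lemma le_d: "tree_le T x y \<Longrightarrow> x = y \<or> d y < d x"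
proof (induction "d x" arbitrary: x rule: less_induct)
  case less
  then show ?case using le_cases[of x y] parent[of x] by fastforce
qed

lemma le_antisym: "tree_le T x y \<Longrightarrow> tree_le T y x \<Longrightarrow> x = y"
  using le_d[of x y] le_d[of y x] by auto

lemma le_root: "x \<in> S \<Longrightarrow> tree_le T x r"
  using parent_reaches_root[of S r p d x T] parent arrow_iff by blast

lemma le_comparable: "tree_le T x y \<Longrightarrow> tree_le T x z \<Longrightarrow> tree_le T y z \<or> tree_le T z y"
proof (induction "d x" arbitrary: x rule: less_induct)
  case less
  then show ?case using le_cases[of x y] le_cases[of x z] parent[of x] by blast
qed

lemma le_child:
  "tree_le T x y \<Longrightarrow> x \<noteq> y \<Longrightarrow> \<exists>c. c \<in> S - {r} \<and> p c = y \<and> tree_le T x c"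
proof (induction "d x" arbitrary: x rule: less_induct)
  case less
  then have x: "x \<in> S - {r}" "tree_le T (p x) y" using le_cases by blast+
  show ?case
  proof (cases "p x = y")
    case True
    then show ?thesis using x le_refl by blast
  next
    case False
    then show ?thesis using less.hyps[of "p x"] parent[OF x(1)] x le_parent[OF x(1)] le_trans
      by blast
  qed
qed

text \<open>This \<open>m\<close> is the lowest common ancestor; it exists because the root is a
  common upper bound.\<close>

lemma common_bound:
  assumes "x \<in> S" "y \<in> S" "finite S"
  obtains m where "m \<in> S" "tree_le T x m" "tree_le T y m"
    "\<And>c. \<lbrakk>c \<in> S; tree_le T x c; tree_le T y c\<rbrakk> \<Longrightarrow> d c \<le> d m"
proof -
  define A where "A = {m \<in> S. tree_le T x m \<and> tree_le T y m}"
  have A: "finite (d ` A)" "d ` A \<noteq> {}" using assms le_root root by (auto simp: A_def)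
  then obtain m where "m \<in> A" "Max (d ` A) = d m" using Max_in by (metis imageE)
  then show ?thesis using that[of m] Max_ge[OF A(1)] by (auto simp: A_def)
qed

end

text \<open>In a vanishing linear combination take a deepest vertex \<open>x\<close> whose edge has
  a nonzero coefficient. Edges into \<open>x\<close> start at deeper vertices, so only the edge
  leaving \<open>x\<close> contributes to the coordinate at \<open>x\<close>.\<close>

lemma rooted_treeI:
  fixes S :: "'b set" and d :: "'b \<Rightarrow> nat"
  assumes fin: "finite S" and r: "r \<in> S"
    and p: "\<And>x. x \<in> S - {r} \<Longrightarrow> p x \<in> S \<and> d (p x) < d x"
  shows "rooted_tree S ((\<lambda>x. arrow (p x) x) ` (S - {r}))" (is "rooted_tree S ?T")
proof -
  have ne: "p x \<noteq> x" if "x \<in> S - {r}" for x using p[OF that] by force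
  have inj: "inj_on (\<lambda>x. arrow (p x) x) (S - {r})"
    using ne by (intro inj_onI) (metis arrow_eq_iff)
  have "\<not> module.dependent frag_cmul ?T"
  proof
    assume "module.dependent frag_cmul ?T"
    then obtain u where u: "(\<Sum>g\<in>?T. frag_cmul (u g) g) = 0" "\<exists>g\<in>?T. u g \<noteq> 0"
      using module.dependent_finite[OF module_frag_cmul, of ?T] fin by auto
    define c where "c x = u (arrow (p x) x)" for x
    have sum0: "(\<Sum>x\<in>S - {r}. frag_cmul (c x) (arrow (p x) x)) = 0"
      using u(1) by (simp add: sum.reindex[OF inj] c_def)
    define N where "N = {x \<in> S - {r}. c x \<noteq> 0}"
    have "finite N" "N \<noteq> {}" using u(2) fin by (auto simp: N_def c_def)
    then obtain x where x: "x \<in> N" "\<And>y. y \<in> N \<Longrightarrow> d y \<le> d x"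
      using Max_in[of "d ` N"] Max_ge[of "d ` N"]
        by (metis (no_types, lifting) finite_imageI image_iff image_is_empty)
    have zero: "c z * poly_mapping.lookup (arrow (p z) z) x = 0" if "z \<in> S - {r} - {x}" for z
    proof (cases "c z = 0")
      case False
      then have "p z \<noteq> x" using x that p[of z] by (force simp: N_def)
      then show ?thesis using that by (auto simp: arrow_def lookup_minus)
    qed simp
    have "(\<Sum>z\<in>S - {r} - {x}. c z * poly_mapping.lookup (arrow (p z) z) x) = 0"
      by (intro sum.neutral ballI zero)
    then have "(\<Sum>z\<in>S - {r}. c z * poly_mapping.lookup (arrow (p z) z) x) = c x * poly_mapping.lookup (arrow (p x) x) x"
      using x fin by (subst sum.remove[of _ x]) (auto simp: N_def)
    also have "\<dots> = - c x"
      using ne[of x] x by (simp add: arrow_def lookup_minus N_def)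
    also have "(\<Sum>z\<in>S - {r}. c z * poly_mapping.lookup (arrow (p z) z) x) =
        poly_mapping.lookup (\<Sum>x\<in>S - {r}. frag_cmul (c x) (arrow (p x) x)) x"
      by (simp add: lookup_sum)
    finally show False using x sum0 by (simp add: N_def)
  qed
  then have forest: "directed_forest S ?T"
    unfolding directed_forest_def
  proof (intro conjI subsetI)
    fix g assume "g \<in> ?T"
    then obtain x where "x \<in> S - {r}" "g = arrow (p x) x" by blast
    then show "g \<in> {arrow w v |w v. w \<in> S \<and> v \<in> S \<and> v \<noteq> w}"
      using p[of x] ne[of x] by (intro CollectI exI[of _ "p x"] exI[of _ x]) auto
  qed (use fin in auto)
  moreover have "card ?T = card S - 1"
    using r fin by (simp add: card_image[OF inj])
  ultimately have "directed_tree S ?T"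
    using card_forest_le[of S] r by (auto simp: directed_tree_def)
  moreover have "\<not> tree_less ?T r w" for w
  proof
    assume "tree_less ?T r w"
    then obtain y where y: "arrow y r \<in> ?T" by (rule tree_less_out_edge)
    moreover from y have "y \<noteq> r"
      using arrow_not_in_independent forest unfolding directed_forest_def by metis
    ultimately show False using ne by (auto simp: arrow_eq_iff)
  qed
  moreover have "tree_less ?T x r" if "x \<in> S" "x \<noteq> r" for x
    using parent_reaches_root[of S r p d x ?T] p that by (auto simp: tree_less_def)
  ultimately show ?thesis
    using r unfolding rooted_tree_def by blast
qed

section \<open>Search orders\<close>

definition segment :: "'a::linorder \<Rightarrow> 'a \<Rightarrow> 'a set" where
  "segment x y = {min x y..max x y}"

lemma in_segment_iff: "z \<in> segment x y \<longleftrightarrow> x \<le> z \<and> z \<le> y \<or> y \<le> z \<and> z \<le> x"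
  by (auto simp: segment_def min_def max_def)

lemma ends_in_segment [simp]: "x \<in> segment x y" "y \<in> segment x y"
  by (auto simp: segment_def)

lemma segment_subset: "\<lbrakk>u \<in> segment x y; v \<in> segment x y; w \<in> segment u v\<rbrakk> \<Longrightarrow> w \<in> segment x y"
  unfolding segment_def min_def max_def by (auto split: if_splits)

lemma in_segment_split: "w \<in> segment x z \<Longrightarrow> w \<in> segment x y \<or> w \<in> segment y z"
  by (auto simp: in_segment_iff)

definition same_part :: "'b set set \<Rightarrow> 'b \<Rightarrow> 'b \<Rightarrow> bool" where
  "same_part S x y \<longleftrightarrow> (\<exists>X\<in>S. x \<in> X \<and> y \<in> X)"

text \<open>For singleton parts this is the ancestor order of a binary search tree. That elements
  above a common element are comparable is not demanded; it follows from the last clause and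
  convexity. Only values on \<open>V\<close> matter, so one relation can serve disjoint sets at
  once.\<close>

definition search_order :: "'a::linorder set \<Rightarrow> 'a set set \<Rightarrow> ('a \<Rightarrow> 'a \<Rightarrow> bool) \<Rightarrow> bool" where
  "search_order V S le \<longleftrightarrow>
     (\<forall>x\<in>V. \<forall>y\<in>V. le x y \<and> le y x \<longleftrightarrow> same_part S x y) \<and>
     (\<forall>x\<in>V. \<forall>y\<in>V. \<forall>z\<in>V. le x y \<longrightarrow> le y z \<longrightarrow> le x z) \<and>
     (\<forall>x\<in>V. \<forall>y\<in>V. \<forall>z\<in>V. le x y \<longrightarrow> z \<in> segment x y \<longrightarrow> le z y) \<and>
     (\<forall>x\<in>V. \<forall>y\<in>V. \<exists>c\<in>V. c \<in> segment x y \<and> (\<forall>z\<in>V. z \<in> segment x y \<longrightarrow> le z c))"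

text \<open>Requiring \<open>y\<close> to lie below all strict upper elements, not merely to be
  minimal among them, makes parents unique up to classes at once.\<close>

definition imm :: "'a set \<Rightarrow> ('a \<Rightarrow> 'a \<Rightarrow> bool) \<Rightarrow> 'a \<Rightarrow> 'a \<Rightarrow> bool" where
  "imm V le x y \<longleftrightarrow> x \<in> V \<and> y \<in> V \<and> le x y \<and> \<not> le y x \<and>
     (\<forall>z\<in>V. le x z \<longrightarrow> \<not> le z x \<longrightarrow> le y z)"

definition order_tree :: "'a set \<Rightarrow> 'a set set \<Rightarrow> ('a \<Rightarrow> 'a \<Rightarrow> bool) \<Rightarrow> ('a set \<Rightarrow>\<^sub>0 int) set" where
  "order_tree V S le = {arrow Y X | X Y. X \<in> S \<and> Y \<in> S \<and> (\<exists>x\<in>X. \<exists>y\<in>Y. imm V le x y)}"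

locale finite_search_order =
  fixes V :: "'a::linorder set" and S :: "'a set set" and le :: "'a \<Rightarrow> 'a \<Rightarrow> bool"
  assumes order: "search_order V S le"
    and finite_V: "finite V"
begin

lemma same_iff: "x \<in> V \<Longrightarrow> y \<in> V \<Longrightarrow> le x y \<and> le y x \<longleftrightarrow> same_part S x y"
  using order unfolding search_order_def by blast

lemma trans: "\<lbrakk>le x y; le y z; x \<in> V; y \<in> V; z \<in> V\<rbrakk> \<Longrightarrow> le x z"
  using order unfolding search_order_def by blast

lemma convex: "\<lbrakk>le x y; z \<in> segment x y; x \<in> V; y \<in> V; z \<in> V\<rbrakk> \<Longrightarrow> le z y"
  using order unfolding search_order_def by blast

lemma segment_max:
  assumes "x \<in> V" "y \<in> V"
  obtains c where "c \<in> V" "c \<in> segment x y" "\<And>z. z \<in> V \<Longrightarrow> z \<in> segment x y \<Longrightarrow> le z c"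
  using order assms unfolding search_order_def by metis

lemma refl: "x \<in> V \<Longrightarrow> le x x"
  by (metis segment_max in_segment_iff order_antisym_conv order_refl)

text \<open>The largest element of the segment from \<open>y\<close> to \<open>z\<close> lies
  between \<open>x\<close> and one of the two. By convexity it is below that one, which therefore
  dominates the other.\<close>

lemma comparable:
  assumes "le x y" "le x z" "x \<in> V" "y \<in> V" "z \<in> V"
  shows "le y z \<or> le z y"
proof -
  obtain c where c: "c \<in> V" "c \<in> segment y z" "\<And>u. u \<in> V \<Longrightarrow> u \<in> segment y z \<Longrightarrow> le u c"
    using segment_max assms by metis
  have yz: "le y c" "le z c" using c(3) assms by auto
  from c(2) have "c \<in> segment x y \<or> c \<in> segment x z"
    by (auto simp: in_segment_iff)
  then have "le c y \<or> le c z"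
    using convex assms c by blast
  then show ?thesis using yz trans assms c by blast
qed

text \<open>Elements strictly above \<open>x\<close> are pairwise comparable, so one with the fewest
  elements below it lies under all of them.\<close>

lemma imm_exists:
  assumes "x \<in> V" "z \<in> V" "le x z" "\<not> le z x"
  obtains y where "imm V le x y"
proof -
  define A where "A = {y \<in> V. le x y \<and> \<not> le y x}"
  define m where "m y = card {u \<in> V. le u y}" for y
  have "\<exists>y. y \<in> A \<and> (\<forall>u. u \<in> A \<longrightarrow> m y \<le> m u)"
    using ex_has_least_nat[of "\<lambda>y. y \<in> A" z m] assms by (auto simp: A_def)
  then obtain y where y: "y \<in> A" "\<And>u. u \<in> A \<Longrightarrow> m y \<le> m u" by blast
  have "le y u" if u: "u \<in> A" for u
  proof (rule ccontr)
    assume n: "\<not> le y u"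
    then have "le u y" using comparable[of x u y] u y(1) assms(1) by (auto simp: A_def)
    then have "{w \<in> V. le w u} \<subset> {w \<in> V. le w y}"
      using n u y trans[of _ u y] refl[of y] unfolding A_def by blast
    then have "m u < m y" unfolding m_def
      by (intro psubset_card_mono) (auto simp: finite_V)
    then show False using y(2)[OF u] by simp
  qed
  then show ?thesis using that[of y] y assms by (auto simp: imm_def A_def)
qed

lemma imm_cong:
  assumes "imm V le x y" "same_part S x x'" "same_part S y y'" "x' \<in> V" "y' \<in> V"
  shows "imm V le x' y'"
proof -
  have *: "le x x'" "le x' x" "le y y'" "le y' y" "x \<in> V" "y \<in> V"
    using assms same_iff unfolding imm_def by blast+
  then show ?thesis using assms unfolding imm_def
    by (meson trans)
qed

lemma part_le_imp_rank:
  assumes "x \<in> V" "y \<in> V" "le x y" "\<not> le y x"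
  shows "card {u \<in> V. le y u} < card {u \<in> V. le x u}"
  using assms refl[of x] trans[of x y] by (intro psubset_card_mono) (auto simp: finite_V)

lemma top_exists:
  assumes "V \<noteq> {}"
  obtains t where "t \<in> V" "\<And>x. x \<in> V \<Longrightarrow> le x t"
proof -
  have "Min V \<in> V" "Max V \<in> V" using assms finite_V by auto
  then obtain c where "c \<in> V" "\<And>z. z \<in> V \<Longrightarrow> z \<in> segment (Min V) (Max V) \<Longrightarrow> le z c"
    using segment_max by metis
  then show ?thesis using that[of c] finite_V by (auto simp: in_segment_iff)
qed

end

lemma same_part_trans:
  assumes "disjoint S" "same_part S x y" "same_part S y z"
  shows "same_part S x z"
  using assms unfolding same_part_def disjoint_def by blast

section \<open>Contraction and expansion\<close>

text \<open>Used with \<open>V\<close> a part of the coarsest partition. Then \<open>V\<close> is a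
  union of parts of \<open>R\<close>, while \<open>S\<close> and \<open>R\<close> may have parts
  elsewhere.\<close>

locale blocks =
  fixes V :: "'a::linorder set" and S R :: "'a set set" and leT :: "'a \<Rightarrow> 'a \<Rightarrow> bool"
  assumes finite: "finite V"
    and disjoint_R: "disjoint R"
    and cover_R: "V \<subseteq> \<Union>R"
    and inside_V: "\<And>W. W \<in> R \<Longrightarrow> W \<inter> V \<noteq> {} \<Longrightarrow> W \<subseteq> V"
    and same_SR: "\<And>x y. same_part S x y \<Longrightarrow> same_part R x y"
    and block_order: "\<And>W. W \<in> R \<Longrightarrow> W \<subseteq> V \<Longrightarrow> search_order W S leT"
begin

lemma blockE:
  assumes "x \<in> V"
  obtains W where "W \<in> R" "x \<in> W" "W \<subseteq> V" "finite_search_order W S leT"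
    "\<And>y. same_part R x y \<longleftrightarrow> y \<in> W"
proof -
  obtain W where W: "W \<in> R" "x \<in> W" using assms cover_R by blast
  then have "W \<subseteq> V" using inside_V assms by blast
  moreover have "same_part R x y \<longleftrightarrow> y \<in> W" for y
    using W disjoint_R unfolding same_part_def disjoint_def by blast
  moreover have "finite_search_order W S leT"
    using block_order W \<open>W \<subseteq> V\<close> finite
    by (auto simp: finite_search_order_def intro: finite_subset)
  ultimately show ?thesis using that W by blast
qed

lemma same_R_sym: "same_part R x y \<Longrightarrow> same_part R y x"
  by (auto simp: same_part_def)

lemma same_R_trans: "same_part R x y \<Longrightarrow> same_part R y z \<Longrightarrow> same_part R x z"
  by (rule same_part_trans[OF disjoint_R])

lemma same_R_refl: "x \<in> V \<Longrightarrow> same_part R x x"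
  using cover_R by (auto simp: same_part_def)

lemma same_R_V: "same_part R x y \<Longrightarrow> x \<in> V \<Longrightarrow> y \<in> V"
  by (metis blockE subsetD)

end

text \<open>The last assumption expresses that the tree of \<open>le\<close> contains the trees of
  the blocks.\<close>

locale block_orders = finite_search_order V S le + blocks V S R leT
  for V :: "'a::linorder set" and S :: "'a set set" and le :: "'a \<Rightarrow> 'a \<Rightarrow> bool"
    and R :: "'a set set" and leT :: "'a \<Rightarrow> 'a \<Rightarrow> bool" +
  assumes imm_block: "\<And>W x y. \<lbrakk>W \<in> R; W \<subseteq> V; imm W leT x y\<rbrakk> \<Longrightarrow> imm V le x y"
begin

text \<open>As long as \<open>x\<close> is not the top of its block, its parent under
  \<open>leT\<close> is also its parent under \<open>le\<close>, so climbing stays in the block. At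
  the top nothing of the block is strictly above, so \<open>c\<close> has been reached. Consequently
  \<open>le\<close> and \<open>leT\<close> agree on blocks, and blocks are convex for
  \<open>le\<close>.\<close>

lemma block_step:
  assumes "x \<in> V" "c \<in> V" "same_part R x y" "le x c" "le c y \<or> same_part R x c"
  shows "same_part R x c \<and> leT x c"
  using assms
proof (induction "card {u \<in> V. le x u}" arbitrary: x rule: less_induct)
  case less
  obtain W where W: "W \<in> R" "x \<in> W" "W \<subseteq> V" "finite_search_order W S leT"
    "\<And>y. same_part R x y \<longleftrightarrow> y \<in> W"
    using blockE less.prems(1) by blast
  interpret T: finite_search_order W S leT by fact
  show ?case
  proof (cases "le c x")
    case True
    then have "same_part S x c" using same_iff less.prems by blast
    then have "same_part R x c" by (rule same_SR)
    moreover from this have "leT x c"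
      using \<open>same_part S x c\<close> T.same_iff[of x c] W(2,5) by simp
    ultimately show ?thesis by simp
  next
    case ncx: False
    have yV: "y \<in> V" using less.prems W by blast
    have "\<exists>z\<in>W. le x z \<and> \<not> le z x"
    proof (cases "le c y")
      case True
      then have "le x y" "\<not> le y x"
        using trans[of x c y] trans[of c y x] less.prems(1,2,4) ncx yV by blast+
      then show ?thesis using W(5) less.prems(3) by blast
    next
      case False
      then show ?thesis using W(5) less.prems(4,5) ncx by blast
    qed
    then obtain z where z: "z \<in> W" "le x z" "\<not> le z x" by blast
    show ?thesis
    proof (cases "\<exists>z\<in>W. leT x z \<and> \<not> leT z x")
      case True
      then obtain x1 where x1: "imm W leT x x1" using T.imm_exists W by blast
      then have i: "imm V le x x1" using imm_block W by blast
      then have le1: "le x1 c" "x1 \<in> V" using less.prems ncx by (auto simp: imm_def)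
      have "card {u \<in> V. le x1 u} < card {u \<in> V. le x u}"
        using i part_le_imp_rank by (auto simp: imm_def)
      moreover have "same_part R x x1" using x1 W by (auto simp: imm_def)
      moreover have "same_part R x1 y" "same_part R x c \<Longrightarrow> same_part R x1 c"
        using same_R_trans[OF same_R_sym[OF \<open>same_part R x x1\<close>]] less.prems(3) by simp_all
      ultimately have *: "same_part R x1 c" "leT x1 c"
        using less.hyps[of x1] le1 less.prems(2,5) by blast+
      have "same_part R x c" using same_R_trans[OF \<open>same_part R x x1\<close> *(1)] .
      moreover from this have "leT x c"
        using T.trans[of x x1 c] x1 *(2) W(2,5) unfolding imm_def by simp
      ultimately show ?thesis by simp
    next
      case False
      obtain t where t: "t \<in> W" "\<And>w. w \<in> W \<Longrightarrow> leT w t" using T.top_exists W by blast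
      then have xtop: "leT w x" if "w \<in> W" for w
        using that t False T.trans[of w t x] W(2) by blast
      \<comment> \<open>Here \<open>x\<close> is the top of its block for \<open>leT\<close>. All
        elements of the block reach it along block edges, each of which is a step of
        \<open>le\<close>.\<close>
      have "le z x"
        using z(1)
      proof (induction "card {u \<in> W. leT z u}" arbitrary: z rule: less_induct)
        case (less z)
        show ?case
        proof (cases "leT x z")
          case True
          then have "same_part S x z" using xtop less.prems T.same_iff[of x z] W(2) by simp
          then show ?thesis using same_iff[of x z] W(2,3) less.prems by blast
        next
          case f: False
          then obtain z1 where z1: "imm W leT z z1" "leT z1 x"
            using T.imm_exists[of z x] xtop less.prems W(2) unfolding imm_def by metis
          have "card {u \<in> W. leT z1 u} < card {u \<in> W. leT z u}"
            using z1 T.part_le_imp_rank by (auto simp: imm_def)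
          then have "le z1 x" using less.hyps[of z1] z1(1) by (simp add: imm_def)
          moreover have "le z z1" "z1 \<in> V" "z \<in> V"
            using imm_block[OF W(1,3) z1(1)] by (auto simp: imm_def)
          ultimately show ?thesis using trans[of z z1 x] W(2,3) by blast
        qed
      qed
      then show ?thesis using z by blast
    qed
  qed
qed

lemma leT_imp_le:
  assumes "x \<in> V" "same_part R x y" "leT x y"
  shows "le x y"
  using assms
proof (induction "card {u \<in> V. le x u}" arbitrary: x rule: less_induct)
  case less
  obtain W where W: "W \<in> R" "x \<in> W" "W \<subseteq> V" "finite_search_order W S leT"
    "\<And>y. same_part R x y \<longleftrightarrow> y \<in> W"
    using blockE less.prems(1) by blast
  interpret T: finite_search_order W S leT by fact
  show ?case
  proof (cases "leT y x")
    case True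
    then have "same_part S x y" using T.same_iff[of x y] less.prems W(2,5) by simp
    then show ?thesis using same_iff[of x y] less.prems W(3,5) by blast
  next
    case False
    then obtain x1 where x1: "imm W leT x x1" "leT x1 y"
      using T.imm_exists[of x y] less.prems W(2,5) unfolding imm_def by metis
    then have i: "imm V le x x1" using imm_block W by blast
    then have "card {u \<in> V. le x1 u} < card {u \<in> V. le x u}"
      using part_le_imp_rank by (auto simp: imm_def)
    moreover have "same_part R x1 y"
      using x1 W less.prems(2) same_R_trans same_R_sym unfolding imm_def by metis
    ultimately have "le x1 y" using less.hyps[of x1] x1 i unfolding imm_def by blast
    then show ?thesis using i trans[of x x1 y] W(3,5) less.prems unfolding imm_def by blast
  qed
qed

lemma leT_iff: "x \<in> V \<Longrightarrow> same_part R x y \<Longrightarrow> leT x y \<longleftrightarrow> le x y"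
  using leT_imp_le block_step same_R_V by blast

lemma block_convex: "\<lbrakk>x \<in> V; c \<in> V; same_part R x y; le x c; le c y\<rbrakk> \<Longrightarrow> same_part R x c"
  using block_step by blast

lemma block_topE:
  assumes "x \<in> V"
  obtains r where "r \<in> V" "same_part R x r" "\<And>w. same_part R x w \<Longrightarrow> le w r"
proof -
  obtain W where W: "W \<in> R" "x \<in> W" "W \<subseteq> V" "finite_search_order W S leT"
    "\<And>y. same_part R x y \<longleftrightarrow> y \<in> W"
    using blockE assms by blast
  interpret T: finite_search_order W S leT by fact
  obtain t where "t \<in> W" "\<And>w. w \<in> W \<Longrightarrow> leT w t" using T.top_exists W by blast
  moreover have "same_part R w t" if "w \<in> W" for w
    using \<open>t \<in> W\<close> that W by (auto simp: same_part_def)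
  ultimately show ?thesis using that[of t] W(2,3,5) leT_imp_le[of _ t] by blast
qed

section \<open>Contraction of a search order to the coarser partition\<close>

definition contract :: "'a \<Rightarrow> 'a \<Rightarrow> bool" where
  "contract x y \<longleftrightarrow> (\<exists>y'. same_part R y y' \<and> le x y')"

lemma contract_iff:
  assumes "x \<in> V" "y \<in> V" "same_part R y r" "\<And>w. same_part R y w \<Longrightarrow> le w r"
  shows "contract x y \<longleftrightarrow> le x r"
proof
  assume "contract x y"
  then obtain y' where "same_part R y y'" "le x y'" by (auto simp: contract_def)
  then show "le x r" using trans[of x y' r] assms same_R_V by blast
qed (use assms in \<open>auto simp: contract_def\<close>)

lemma search_order_contract: "search_order V R contract"
  unfolding search_order_def
proof (intro conjI ballI impI)
  fix x y assume xy: "x \<in> V" "y \<in> V"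
  obtain rx where rx: "rx \<in> V" "same_part R x rx" "\<And>w. same_part R x w \<Longrightarrow> le w rx"
    using block_topE xy by metis
  obtain ry where ry: "ry \<in> V" "same_part R y ry" "\<And>w. same_part R y w \<Longrightarrow> le w ry"
    using block_topE xy by metis
  show "contract x y \<and> contract y x \<longleftrightarrow> same_part R x y"
  proof
    assume "contract x y \<and> contract y x"
    then have *: "le x ry" "le y rx" using contract_iff rx ry xy by metis+
    have "le x rx" "le y ry" using rx ry xy same_R_refl by blast+
    \<comment> \<open>If, say, \<open>ry\<close> is the lower of the two tops, it lies between
      \<open>x\<close> and \<open>rx\<close>, and convexity of the block of \<open>x\<close> merges
      the two blocks.\<close>
    then have "le rx ry \<or> le ry rx" using comparable * xy rx ry by blast
    then have "same_part R x ry \<or> same_part R y rx"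
      using block_convex[of x ry rx] block_convex[of y rx ry] * xy rx ry by blast
    then show "same_part R x y" using rx ry same_R_sym same_R_trans by metis
  next
    assume "same_part R x y"
    then show "contract x y \<and> contract y x"
      unfolding contract_def using refl xy same_R_sym by metis
  qed
  obtain c where "c \<in> V" "c \<in> segment x y" "\<And>z. z \<in> V \<Longrightarrow> z \<in> segment x y \<Longrightarrow> le z c"
    using segment_max xy by metis
  then show "\<exists>c\<in>V. c \<in> segment x y \<and> (\<forall>z\<in>V. z \<in> segment x y \<longrightarrow> contract z c)"
    unfolding contract_def using same_R_refl by blast
next
  fix x y z assume V: "x \<in> V" "y \<in> V" "z \<in> V"
  obtain ry where ry: "ry \<in> V" "same_part R y ry" "\<And>w. same_part R y w \<Longrightarrow> le w ry"
    using block_topE V by metis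
  have yry: "le y ry" using ry V same_R_refl by blast
  {
    assume "contract x y" "contract y z"
    obtain rz where rz: "rz \<in> V" "same_part R z rz" "\<And>w. same_part R z w \<Longrightarrow> le w rz"
      using block_topE V by metis
    have le: "le x ry" "le y rz"
      using contract_iff rz ry V \<open>contract x y\<close> \<open>contract y z\<close> by metis+
    \<comment> \<open>Otherwise \<open>rz\<close> lies between \<open>y\<close> and the top
      \<open>ry\<close> of its block, so \<open>y\<close> and \<open>z\<close> share a block, whose
      top is \<open>rz\<close>.\<close>
    have "le ry rz"
    proof (rule ccontr)
      assume "\<not> le ry rz"
      then have "le rz ry" using comparable[of y ry rz] yry le V ry rz by blast
      then have "same_part R y rz" using block_convex[of y rz ry] le V ry rz by blast
      then have "same_part R z ry" using same_R_trans[OF same_R_trans[OF rz(2) same_R_sym] ry(2)]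
        by blast
      then show False using rz \<open>\<not> le ry rz\<close> by blast
    qed
    then show "contract x z"
      using contract_iff[OF V(1,3) rz(2)] rz trans[of x ry rz] le V ry by blast
  }
  assume "contract x y" "z \<in> segment x y"
  then have "le x ry" "z \<in> segment x ry \<or> z \<in> segment ry y"
    using contract_iff[OF V(1,2) ry(2)] ry in_segment_split by blast+
  then have "le z ry"
    using convex[of x ry z] convex[of y ry z] yry V ry
    by (auto simp: in_segment_iff)
  then show "contract z y" using contract_iff[OF V(3,2) ry(2)] ry by blast
qed

text \<open>By \<open>block_convex\<close> nothing above \<open>y\<close> returns to the block of
  \<open>x\<close>, so the edge stays strict. Immediacy is inherited through the witnesses in
  \<open>contract\<close>.\<close>

lemma imm_contract:
  assumes i: "imm V le x y" and ns: "\<not> same_part R x y"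
  shows "imm V contract x y"
proof -
  have V: "x \<in> V" "y \<in> V" and le: "le x y" using i by (auto simp: imm_def)
  have "\<not> contract y x"
  proof
    assume "contract y x"
    then obtain x' where "same_part R x x'" "le y x'" by (auto simp: contract_def)
    then show False using block_convex[of x y x'] V le ns by blast
  qed
  moreover have "contract x y" using le V same_R_refl by (auto simp: contract_def)
  moreover have "contract y z" if z: "z \<in> V" "contract x z" "\<not> contract z x" for z
  proof -
    obtain z' where z': "same_part R z z'" "le x z'" using z by (auto simp: contract_def)
    have "z' \<in> V" using z' z same_R_V by blast
    have "\<not> le z' x"
    proof
      assume "le z' x"
      then have "same_part R x z'" using same_iff V \<open>z' \<in> V\<close> z' same_SR by blast
      then have "same_part R x z" using z' same_R_sym same_R_trans by metis
      then show False using z refl[of z] by (auto simp: contract_def)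
    qed
    then have "le y z'" using i z' \<open>z' \<in> V\<close> by (auto simp: imm_def)
    then show ?thesis using z' by (auto simp: contract_def)
  qed
  ultimately show ?thesis using V by (auto simp: imm_def)
qed

text \<open>On a block \<open>le\<close> agrees with \<open>leT\<close>, and immediacy in
  \<open>V\<close> restricts to the block. So an edge of the large tree inside a block is an edge of
  the tree of that block.\<close>

lemma imm_same_block:
  assumes i: "imm V le x y" and s: "same_part R x y"
  shows "\<exists>W\<in>R. W \<subseteq> V \<and> imm W leT x y"
proof -
  have V: "x \<in> V" "y \<in> V" using i by (auto simp: imm_def)
  obtain W where W: "W \<in> R" "x \<in> W" "W \<subseteq> V" "finite_search_order W S leT"
    "\<And>y. same_part R x y \<longleftrightarrow> y \<in> W"
    using blockE V(1) by blast
  have "leT u v \<longleftrightarrow> le u v" if "u \<in> W" "v \<in> W" for u v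
    using leT_iff[of u v] that W by (auto simp: same_part_def)
  then have "imm W leT x y" using i s W V unfolding imm_def by (metis subsetD)
  then show ?thesis using W by blast
qed

text \<open>The right-hand side does not mention \<open>le\<close>: the lift of an edge is determined by \<open>leT\<close>.\<close>

lemma le_block_iff:
  assumes x: "x \<in> V" and y: "y \<in> V" and above: "same_part R y z" "le x z"
  shows "le x y \<longleftrightarrow> (\<forall>w. w \<in> segment x y \<longrightarrow> same_part R w y \<longrightarrow> leT w y)"
proof
  assume "le x y"
  then show "\<forall>w. w \<in> segment x y \<longrightarrow> same_part R w y \<longrightarrow> leT w y"
    using convex[of x y] leT_iff[of _ y] same_R_V[OF same_R_sym] x y by metis
next
  assume *: "\<forall>w. w \<in> segment x y \<longrightarrow> same_part R w y \<longrightarrow> leT w y"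
  obtain r where r: "r \<in> V" "same_part R y r" "\<And>w. same_part R y w \<Longrightarrow> le w r"
    using block_topE y by metis
  have "z \<in> V" using above y same_R_V by blast
  have le: "le x r" "le y r"
    using r above same_R_refl[OF y] trans[of x z r] x \<open>z \<in> V\<close> by blast+
  \<comment> \<open>The top \<open>c\<close> of the segment is above \<open>y\<close> and below the
    top \<open>r\<close> of the block of \<open>y\<close>, hence in that block, where the hypothesis
    bounds it by \<open>y\<close>.\<close>
  obtain c where c: "c \<in> V" "c \<in> segment x y" "\<And>z. z \<in> V \<Longrightarrow> z \<in> segment x y \<Longrightarrow> le z c"
    using segment_max x y by metis
  have "le x c" "le y c" using c(3) x y by auto
  have "le c r" using in_segment_split[OF c(2), of r] convex[of x r c] convex[of y r c] le c x y r
    by (auto simp: in_segment_iff)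
  then have "same_part R y c" using block_convex[of y c r] y c r \<open>le y c\<close> by blast
  then have "le c y" using * c leT_imp_le same_R_sym by metis
  then show "le x y" using trans[of x c y] \<open>le x c\<close> x y c by blast
qed

end

section \<open>Refinement of a search order by search orders on the blocks\<close>

locale expansion = finite_search_order V R leR + blocks V S R leT
  for V :: "'a::linorder set" and S :: "'a set set"
    and R :: "'a set set" and leR leT :: "'a \<Rightarrow> 'a \<Rightarrow> bool"
begin

text \<open>The formula is forced: by \<open>le_block_iff\<close>, a search order that contains the
  block trees and contracts to \<open>leR\<close> agrees with it on \<open>V\<close>.\<close>

definition expand :: "'a \<Rightarrow> 'a \<Rightarrow> bool" where
  "expand x y \<longleftrightarrow> leR x y \<and> (\<forall>w. w \<in> segment x y \<longrightarrow> same_part R w y \<longrightarrow> leT w y)"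

lemma expand_block_iff:
  assumes "x \<in> V" "same_part R x y"
  shows "expand x y \<longleftrightarrow> leT x y"
proof -
  obtain W where W: "W \<in> R" "x \<in> W" "W \<subseteq> V" "finite_search_order W S leT"
    "\<And>y. same_part R x y \<longleftrightarrow> y \<in> W"
    using blockE assms(1) by blast
  interpret T: finite_search_order W S leT by fact
  have "w \<in> W" if "same_part R w y" for w
    using that assms W same_R_sym same_R_trans by metis
  then show ?thesis using T.convex[of x y] assms W same_iff[of x y] same_R_V
    unfolding expand_def by (auto simp: in_segment_iff)
qed

lemma search_order_expand: "search_order V S expand"
  unfolding search_order_def
proof (intro conjI ballI impI)
  fix x y assume V: "x \<in> V" "y \<in> V"
  show "expand x y \<and> expand y x \<longleftrightarrow> same_part S x y"
  proof (cases "same_part R x y")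
    case True
    obtain W where W: "W \<in> R" "x \<in> W" "W \<subseteq> V" "finite_search_order W S leT"
      "\<And>y. same_part R x y \<longleftrightarrow> y \<in> W"
      using blockE V(1) by blast
    interpret T: finite_search_order W S leT by fact
    show ?thesis
      using expand_block_iff[OF V(1) True] expand_block_iff[OF V(2) same_R_sym[OF True]]
        T.same_iff[of x y] W True by blast
  next
    case False
    then show ?thesis using same_iff[OF V] same_SR unfolding expand_def by blast
  qed
  obtain c where c: "c \<in> V" "c \<in> segment x y" "\<And>z. z \<in> V \<Longrightarrow> z \<in> segment x y \<Longrightarrow> leR z c"
    using segment_max V by metis
  obtain W where W: "W \<in> R" "c \<in> W" "W \<subseteq> V" "finite_search_order W S leT"
    "\<And>y. same_part R c y \<longleftrightarrow> y \<in> W"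
    using blockE c(1) by blast
  interpret T: finite_search_order W S leT by fact
  \<comment> \<open>The top is found in two stages: the block \<open>W\<close> of the
    \<open>leR\<close>-largest element, then the \<open>leT\<close>-largest among the elements of
    \<open>W\<close> in the segment. As \<open>leT\<close> is a search order on \<open>W\<close>,
    the second stage needs a segment with ends in \<open>W\<close>.\<close>
  define I where "I = W \<inter> segment x y"
  have "finite I" "I \<noteq> {}" using W c T.finite_V by (auto simp: I_def)
  then have mm: "Min I \<in> I" "Max I \<in> I" "\<And>i. i \<in> I \<Longrightarrow> i \<in> segment (Min I) (Max I)"
    by (auto simp: in_segment_iff)
  then obtain d where d: "d \<in> W" "d \<in> segment (Min I) (Max I)"
    "\<And>z. z \<in> W \<Longrightarrow> z \<in> segment (Min I) (Max I) \<Longrightarrow> leT z d"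
    using T.segment_max[of "Min I" "Max I"] by (metis IntD1 I_def)
  have dI: "d \<in> segment x y" using d(2) mm(1,2) segment_subset unfolding I_def by blast
  have "expand z d" if z: "z \<in> V" "z \<in> segment x y" for z
    unfolding expand_def
  proof (intro conjI allI impI)
    have "leR c d" using W(5) d(1) same_iff c(1) W(3) by blast
    then show "leR z d" using trans[of z c d] c z d W by blast
    fix w assume "w \<in> segment z d" "same_part R w d"
    moreover from this have "w \<in> W" using W d same_R_sym same_R_trans by metis
    ultimately have "w \<in> I" using z dI by (auto simp: I_def in_segment_iff)
    then show "leT w d" using d mm \<open>w \<in> W\<close> by blast
  qed
  then show "\<exists>c\<in>V. c \<in> segment x y \<and> (\<forall>z\<in>V. z \<in> segment x y \<longrightarrow> expand z c)"
    using dI d W by blast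
next
  fix x y z assume V: "x \<in> V" "y \<in> V" "z \<in> V"
  {
    assume xy: "expand x y" and yz: "expand y z"
    have "leT w z" if w: "w \<in> segment x z" "same_part R w z" for w
    proof (cases "w \<in> segment y z")
      case True
      then show ?thesis using yz w by (auto simp: expand_def)
    next
      case False
      \<comment> \<open>Now an element \<open>w\<close> of the block of \<open>z\<close> is below
        \<open>y\<close>. As \<open>y\<close> is below \<open>z\<close>, all three share a block,
        and transitivity of \<open>leT\<close> applies.\<close>
      then have wxy: "w \<in> segment x y" using w in_segment_split by blast
      have "w \<in> V" using w V same_R_sym same_R_V by metis
      then have "leR w y" using convex[of x y w] wxy xy V by (auto simp: expand_def)
      moreover have "leR z w" using same_iff[of w z] w V \<open>w \<in> V\<close> by blast
      ultimately have "leR z y" using trans V \<open>w \<in> V\<close> by blast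
      then have zy: "same_part R y z" using same_iff[of y z] V yz by (auto simp: expand_def)
      then have wy: "same_part R w y" using w same_R_sym same_R_trans by metis
      then have "leT w y" using xy wxy by (auto simp: expand_def)
      moreover have "leT y z" using yz zy by (auto simp: expand_def in_segment_iff)
      moreover obtain W where W: "W \<in> R" "y \<in> W" "W \<subseteq> V" "finite_search_order W S leT"
        "\<And>u. same_part R y u \<longleftrightarrow> u \<in> W"
        using blockE V(2) by blast
      ultimately show ?thesis
        using finite_search_order.trans[OF W(4), of w y z] W(2,5) wy zy same_R_sym by blast
    qed
    then show "expand x z"
      using trans[of x y z] xy yz V by (auto simp: expand_def)
  }
  assume xy: "expand x y" and z: "z \<in> segment x y"
  then have "leR z y" using convex V by (auto simp: expand_def)
  moreover have "w \<in> segment x y" if "w \<in> segment z y" for w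
    using that z by (auto simp: in_segment_iff)
  ultimately show "expand z y" using xy by (auto simp: expand_def)
qed

sublocale E: finite_search_order V S expand
  using search_order_expand finite by (simp add: finite_search_order_def)

text \<open>An element strictly above \<open>x\<close> but not above \<open>y\<close> would be
  squeezed between them, hence lie in their block, against immediacy in \<open>W\<close>.\<close>

lemma imm_expand_block:
  assumes W: "W \<in> R" "W \<subseteq> V" and i: "imm W leT x y"
  shows "imm V expand x y"
proof -
  have xyW: "x \<in> W" "y \<in> W" using i by (auto simp: imm_def)
  then have V: "x \<in> V" "y \<in> V" using W by auto
  have R: "same_part R u v" if "u \<in> W" "v \<in> W" for u v
    using that W by (auto simp: same_part_def)
  have eq: "expand u v \<longleftrightarrow> leT u v" if "u \<in> W" "v \<in> W" for u v
    using expand_block_iff[of u v] R that W by blast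
  have xy: "expand x y" "\<not> expand y x" using i eq xyW by (auto simp: imm_def)
  moreover have "expand y z" if z: "z \<in> V" "expand x z" "\<not> expand z x" for z
  proof (rule ccontr)
    assume n: "\<not> expand y z"
    then have "expand z y" using E.comparable[of x y z] z xy V by blast
    then have "leR x z" "leR z y" using z by (auto simp: expand_def)
    moreover have "leR y x" using R xyW same_iff V by blast
    ultimately have "same_part R x z" using same_iff[of x z] trans V z by blast
    then have "z \<in> W" using xyW W disjoint_R unfolding same_part_def disjoint_def by blast
    then have "leT x z" "\<not> leT z x" "\<not> leT y z" using n z eq xyW by blast+
    then show False using i \<open>z \<in> W\<close> unfolding imm_def by blast
  qed
  ultimately show ?thesis using V by (auto simp: imm_def)
qed

text \<open>The lift joins the top of the block of \<open>x\<close> to its parent in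
  \<open>expand\<close>. The parent is outside that block, hence at or above \<open>y\<close> for
  \<open>leR\<close>, and it is bounded by the top of the block of \<open>y\<close>.\<close>

lemma imm_expand_lift:
  assumes i: "imm V leR x y"
  shows "\<exists>x' y'. same_part R x x' \<and> same_part R y y' \<and> imm V expand x' y'"
proof -
  have V: "x \<in> V" "y \<in> V" using i by (auto simp: imm_def)
  have topE: "\<exists>r\<in>V. same_part R u r \<and> (\<forall>w. same_part R u w \<longrightarrow> leT w r)" if "u \<in> V" for u
  proof -
    obtain W where W: "W \<in> R" "u \<in> W" "W \<subseteq> V" "finite_search_order W S leT"
      "\<And>y. same_part R u y \<longleftrightarrow> y \<in> W"
      using blockE \<open>u \<in> V\<close> by blast
    then show ?thesis using finite_search_order.top_exists[OF W(4)] by (metis empty_iff subsetD)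
  qed
  obtain r where r: "r \<in> V" "same_part R x r" "\<And>w. same_part R x w \<Longrightarrow> leT w r"
    using topE V by blast
  obtain t where t: "t \<in> V" "same_part R y t" "\<And>w. same_part R y w \<Longrightarrow> leT w t"
    using topE V by blast
  have rx: "leR r x" "leR x r" "leR t y" "leR y t" using same_iff V r t by blast+
  have xy: "leR x y" "\<not> leR y x" using i by (auto simp: imm_def)
  have "leR x t" using trans[of x y t] rx xy V t(1) by blast
  then have "leR r t" using trans[of r x t] rx V r(1) t(1) by blast
  moreover have "leT w t" if "same_part R w t" for w
    using t that same_R_trans same_R_sym by metis
  ultimately have rt: "expand r t" unfolding expand_def by blast
  moreover have "\<not> expand t r"
  proof
    assume "expand t r"
    then have "leR t r" by (simp add: expand_def)
    then have "leR t x" using trans[of t r x] rx V r(1) t(1) by blast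
    then have "leR y x" using trans[of y t x] rx(4) V t(1) by simp
    then show False using xy(2) by simp
  qed
  ultimately obtain z where z: "imm V expand r z" using E.imm_exists[OF r(1) t(1)] by metis
  then have zV: "z \<in> V" and rz: "expand r z" "\<not> expand z r" "expand z t"
    using rt \<open>\<not> expand t r\<close> t unfolding imm_def by blast+
  have nsame: "\<not> same_part R x z"
  proof
    assume "same_part R x z"
    moreover from this have "same_part R z r" using r same_R_trans same_R_sym by metis
    ultimately show False using expand_block_iff[OF zV] r rz by blast
  qed
  have "leR r z" "leR z t" using rz by (simp_all add: expand_def)
  have "leR x z" using \<open>leR r z\<close> rx trans[of x r z] V r(1) zV by blast
  then have "\<not> leR z x" using nsame same_iff V zV by blast
  then have "leR y z" using i \<open>leR x z\<close> zV unfolding imm_def by blast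
  moreover have "leR z y" using \<open>leR z t\<close> rx trans[of z t y] V t(1) zV by blast
  ultimately have "same_part R y z" using same_iff V zV by blast
  then show ?thesis using r z by blast
qed

end

section \<open>Coherent families of edges\<close>

text \<open>For distinct parts of a noncrossing partition, \<open>straddles Y X\<close> means that
  \<open>X\<close> is vertically below \<open>Y\<close> (\<open>below_iff\<close>). One element of
  \<open>X\<close> suffices, since noncrossing drags the others along
  (\<open>straddle_all\<close>).\<close>

definition straddles :: "'a::linorder set \<Rightarrow> 'a set \<Rightarrow> bool" where
  "straddles Y X \<longleftrightarrow> (\<exists>y\<in>Y. \<exists>y'\<in>Y. \<exists>x\<in>X. y < x \<and> x < y')"

text \<open>\<open>link S X Y\<close>: the edge from \<open>X\<close> to \<open>Y\<close> belongs to \<open>edges S\<close>, in the form that \<open>X\<close>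
  is not above \<open>Y\<close> and that replacing \<open>X\<close> and \<open>Y\<close> by their union gives a noncrossing partition.\<close>

definition link :: "'a::linorder set set \<Rightarrow> 'a set \<Rightarrow> 'a set \<Rightarrow> bool" where
  "link S X Y \<longleftrightarrow> X \<in> S \<and> Y \<in> S \<and> X \<noteq> Y \<and> \<not> straddles X Y \<and>
     (\<forall>Z\<in>S. Z \<noteq> X \<longrightarrow> Z \<noteq> Y \<longrightarrow>
       (\<forall>x\<in>X. \<forall>y\<in>Y. \<forall>z\<in>Z. z \<in> segment x y \<longrightarrow> Z \<subseteq> segment x y))"

text \<open>\<open>forced (X, Y) Z W\<close> says that \<open>Z\<close> is strictly below \<open>W\<close> in every search tree that contains the edge from
  \<open>X\<close> to \<open>Y\<close>: all parts in the same gap of \<open>Y\<close> as \<open>X\<close>, except those on the other side of \<open>X\<close> if the gap is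
  unbounded, are below \<open>X\<close>.  The last clause of \<open>cohere\<close> says that \<open>g\<close> does not force a part strictly between
  the endpoints of \<open>f\<close>.\<close>

definition beyond :: "'a::linorder set \<Rightarrow> 'a set \<Rightarrow> 'a set \<Rightarrow> bool" where
  "beyond X Y Z \<longleftrightarrow> Z \<noteq> X \<and> Z \<noteq> Y \<and>
     (\<exists>x\<in>X. \<exists>y\<in>Y. \<exists>z\<in>Z. z \<in> segment x y \<and> Y \<inter> segment x z = {})"

definition forced :: "'a::linorder set \<times> 'a set \<Rightarrow> 'a set \<Rightarrow> 'a set \<Rightarrow> bool" where
  "forced f Z W \<longleftrightarrow> (case f of (X, Y) \<Rightarrow>
     (W = X \<or> W = Y) \<and> beyond X Y Z \<or> W = Y \<and> Z = X)"

definition cohere :: "'a::linorder set \<times> 'a set \<Rightarrow> 'a set \<times> 'a set \<Rightarrow> bool" where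
  "cohere f g \<longleftrightarrow> (fst f = fst g \<longrightarrow> snd f = snd g) \<and>
     (\<forall>Z W. \<not> (forced f Z W \<and> forced g W Z)) \<and>
     (\<forall>U. \<not> (forced g (fst f) U \<and> forced g U (snd f)))"

definition admissible :: "'a::linorder set set \<Rightarrow> ('a set \<times> 'a set) set \<Rightarrow> 'a set \<Rightarrow> bool" where
  "admissible S E A \<longleftrightarrow> A \<in> S \<and> (\<forall>X\<in>S. X \<noteq> A \<longrightarrow> \<not> straddles X A) \<and> A \<notin> fst ` E \<and>
     (\<forall>X Y x y. (X, Y) \<in> E \<longrightarrow> X \<noteq> A \<longrightarrow> Y \<noteq> A \<longrightarrow> x \<in> X \<longrightarrow> y \<in> Y \<longrightarrow> A \<inter> segment x y = {})"

lemma noncrossing_subset: "noncrossing S \<Longrightarrow> S' \<subseteq> S \<Longrightarrow> noncrossing S'"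
  unfolding noncrossing_def by (meson subsetD)

lemma segment_commute: "segment x y = segment y x"
  by (simp add: segment_def min.commute max.commute)

locale nc_partition =
  fixes V :: "'a::linorder set" and S :: "'a set set"
  assumes noncrossing: "noncrossing_partition V S"
begin

lemma finite: "finite V" and partition: "partition_on V S"
  using noncrossing by (simp_all add: noncrossing_partition_def)

lemma part_subset: "X \<in> S \<Longrightarrow> X \<subseteq> V"
  using partition by (auto simp: partition_on_def)

lemma part_nonempty: "X \<in> S \<Longrightarrow> X \<noteq> {}"
  using partition by (auto simp: partition_on_def)

lemma partE: assumes "x \<in> V" obtains X where "X \<in> S" "x \<in> X"
  using partition assms by (auto simp: partition_on_def)

lemma part_eq: "\<lbrakk>X \<in> S; Y \<in> S; x \<in> X; x \<in> Y\<rbrakk> \<Longrightarrow> X = Y"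
  using partition unfolding partition_on_def disjoint_def by blast

lemma no_crossing:
  "\<lbrakk>X \<in> S; Y \<in> S; X \<noteq> Y; a \<in> X; c \<in> X; b \<in> Y; d \<in> Y; a < b; b < c\<rbrakk> \<Longrightarrow> \<not> c < d"
proof
  assume *: "X \<in> S" "Y \<in> S" "X \<noteq> Y" "a \<in> X" "c \<in> X" "b \<in> Y" "d \<in> Y" "a < b" "b < c" "c < d"
  have "noncrossing S" using noncrossing by (simp add: noncrossing_partition_def)
  then show False unfolding noncrossing_def using * by metis
qed

lemma straddle_all:
  assumes "X \<in> S" "Y \<in> S" "X \<noteq> Y" "y \<in> Y" "y' \<in> Y" "x \<in> X" "y < x" "x < y'" "x' \<in> X"
  shows "y < x' \<and> x' < y'"
proof -
  have "x' \<noteq> y" "x' \<noteq> y'" using part_eq assms by blast+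
  moreover have "\<not> x' < y" using no_crossing[of X Y x' x y y'] assms by blast
  moreover have "\<not> y' < x'" using no_crossing[of Y X y y' x x'] assms by blast
  ultimately show ?thesis by auto
qed

lemma lateral:
  assumes "X \<in> S" "Y \<in> S" "X \<noteq> Y" "\<not> straddles X Y" "\<not> straddles Y X"
  shows "left_of X Y \<or> left_of Y X"
proof -
  have ne: "x \<noteq> y" if "x \<in> X" "y \<in> Y" for x y using part_eq assms that by blast
  obtain x0 y0 where xy: "x0 \<in> X" "y0 \<in> Y" using part_nonempty assms by blast
  have *: "\<not> (y < x \<and> x < y')" "\<not> (x < y \<and> y < x')" if "x \<in> X" "x' \<in> X" "y \<in> Y" "y' \<in> Y"
    for x x' y y'
    using assms that unfolding straddles_def by blast+
  show ?thesis
  proof (cases "x0 < y0")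
    case True
    have "x < y" if "x \<in> X" "y \<in> Y" for x y
      using *(1)[of x x0 y y0] *(1)[of x0 x y y0] *(2)[of x0 x y y0] ne xy that True
      by (metis linorder_neqE)
    then show ?thesis by (simp add: left_of_def)
  next
    case False
    have "y < x" if "x \<in> X" "y \<in> Y" for x y
      using *(2)[of x x0 y y0] *(1)[of x0 x y0 y] *(2)[of x x0 y0 y] ne xy that False
      by (metis linorder_neqE)
    then show ?thesis by (simp add: left_of_def)
  qed
qed

text \<open>An element of \<open>Y\<close> between \<open>x\<close> and \<open>z\<close> would,
  together with \<open>y\<close>, enclose \<open>z\<close>. So for a part that \<open>Y\<close> does
  not straddle, lying between \<open>x\<close> and \<open>y\<close> is enough.\<close>

lemma beyondI:
  assumes "\<not> straddles Y Z" "Z \<noteq> X" "Z \<noteq> Y" "Y \<in> S" "Z \<in> S"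
    "x \<in> X" "y \<in> Y" "z \<in> Z" "z \<in> segment x y"
  shows "beyond X Y Z"
proof -
  have "y' \<notin> segment x z" if y': "y' \<in> Y" for y'
  proof
    assume "y' \<in> segment x z"
    moreover have "y' \<noteq> z" "y \<noteq> z" using part_eq assms y' by blast+
    ultimately have "y' < z \<and> z < y \<or> y < z \<and> z < y'"
      using assms(9) by (auto simp: in_segment_iff)
    then show False using assms y' unfolding straddles_def by blast
  qed
  then show ?thesis using assms unfolding beyond_def by blast
qed

end

locale coherent_links = nc_partition V S
  for V :: "'a::linorder set" and S :: "'a set set" +
  fixes E :: "('a set \<times> 'a set) set"
  assumes links: "\<And>X Y. (X, Y) \<in> E \<Longrightarrow> link S X Y"
    and coheres: "\<And>f g. f \<in> E \<Longrightarrow> g \<in> E \<Longrightarrow> cohere f g"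
begin

lemma linkD:
  assumes "(X, Y) \<in> E"
  shows "X \<in> S" "Y \<in> S" "X \<noteq> Y" "\<not> straddles X Y"
    "\<lbrakk>Z \<in> S; Z \<noteq> X; Z \<noteq> Y; x \<in> X; y \<in> Y; z \<in> Z; z \<in> segment x y\<rbrakk> \<Longrightarrow> Z \<subseteq> segment x y"
proof -
  have l: "link S X Y" by (rule links[OF assms])
  then show "X \<in> S" "Y \<in> S" "X \<noteq> Y" "\<not> straddles X Y" by (simp_all add: link_def)
  show "Z \<subseteq> segment x y"
    if "Z \<in> S" "Z \<noteq> X" "Z \<noteq> Y" "x \<in> X" "y \<in> Y" "z \<in> Z" "z \<in> segment x y"
    using l that unfolding link_def by metis
qed

lemma not_both_forced: "\<lbrakk>f \<in> E; g \<in> E; forced f Z W\<rbrakk> \<Longrightarrow> \<not> forced g W Z"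
  using coheres unfolding cohere_def by blast

text \<open>Among the candidates, the one that ends furthest to the right is not the source of an edge, since the
  target of such an edge would again be a candidate.\<close>

definition candidate :: "'a set \<Rightarrow> bool" where
  "candidate A \<longleftrightarrow> A \<in> S \<and> (\<forall>X\<in>S. X \<noteq> A \<longrightarrow> \<not> straddles X A) \<and>
     (\<forall>X Y x y. (X, Y) \<in> E \<longrightarrow> X \<noteq> A \<longrightarrow> Y \<noteq> A \<longrightarrow> x \<in> X \<longrightarrow> y \<in> Y \<longrightarrow> A \<inter> segment x y = {}) \<and>
     (\<forall>B. (A, B) \<in> E \<longrightarrow> left_of A B)"

text \<open>The part of the leftmost element qualifies: straddling it, crossing it, or an edge
  leaving it to the left would require an element further left.\<close>

lemma candidate_first:
  assumes "V \<noteq> {}"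
  obtains A where "candidate A"
proof -
  define m where "m = Min V"
  have m: "m \<in> V" "\<And>x. x \<in> V \<Longrightarrow> m \<le> x" using assms finite by (auto simp: m_def)
  obtain A where A: "A \<in> S" "m \<in> A" using partE m by blast
  have ns: "\<not> straddles X A" if "X \<in> S" "X \<noteq> A" for X
  proof
    assume "straddles X A"
    then obtain x a x' where "x \<in> X" "x' \<in> X" "a \<in> A" "x < a" "a < x'"
      by (auto simp: straddles_def)
    then have "x < m" using straddle_all[of A X x x' a m] A that by blast
    moreover have "m \<le> x" using m(2) part_subset[OF that(1)] \<open>x \<in> X\<close> by blast
    ultimately show False by simp
  qed
  have "A \<inter> segment x y = {}" if XY: "(X, Y) \<in> E" "X \<noteq> A" "Y \<noteq> A" "x \<in> X" "y \<in> Y" for X Y x y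
  proof (rule ccontr)
    assume "A \<inter> segment x y \<noteq> {}"
    then have "m \<in> segment x y" using linkD(5)[OF XY(1), of A x y] A XY by blast
    moreover have "m \<le> x" "m \<le> y" using m part_subset linkD[OF XY(1)] XY by blast+
    ultimately have "m = x \<or> m = y" by (auto simp: in_segment_iff)
    then have "m \<in> X \<or> m \<in> Y" using XY(4,5) by blast
    then show False using part_eq[of A X m] part_eq[of A Y m] A linkD(1,2)[OF XY(1)] XY(2,3)
      by blast
  qed
  moreover have "left_of A B" if AB: "(A, B) \<in> E" for B
  proof -
    have "left_of A B \<or> left_of B A"
      using lateral[of A B] linkD(1-4)[OF AB] ns[of B] by blast
    moreover have "\<not> left_of B A"
    proof
      assume "left_of B A"
      moreover obtain b where "b \<in> B" using linkD(2)[OF AB] part_nonempty by blast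
      ultimately have "b < m" "b \<in> V" using A part_subset linkD(2)[OF AB]
        by (auto simp: left_of_def)
      then show False using m by force
    qed
    ultimately show ?thesis by blast
  qed
  ultimately have "candidate A" using A ns unfolding candidate_def by blast
  then show ?thesis by (rule that)
qed

lemma candidate_step:
  assumes cand: "candidate A" and AB: "(A, B) \<in> E"
  shows "candidate B"
proof -
  note lAB = linkD[OF AB]
  have candA: "\<And>X. X \<in> S \<Longrightarrow> X \<noteq> A \<Longrightarrow> \<not> straddles X A"
    "\<And>X Y x y. \<lbrakk>(X, Y) \<in> E; X \<noteq> A; Y \<noteq> A; x \<in> X; y \<in> Y\<rbrakk> \<Longrightarrow> A \<inter> segment x y = {}"
    and "left_of A B"
    using cand AB by (simp_all add: candidate_def)
  then have less: "a < b" if "a \<in> A" "b \<in> B" for a b using that by (simp add: left_of_def)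
  obtain a where a: "a \<in> A" using part_nonempty lAB by blast
  have ns: "\<not> straddles X B" if X: "X \<in> S" "X \<noteq> B" for X
  proof
    assume "straddles X B"
    then obtain x1 b x2 where x: "x1 \<in> X" "x2 \<in> X" "b \<in> B" "x1 < b" "b < x2"
      by (auto simp: straddles_def)
    have "X \<noteq> A" using \<open>straddles X B\<close> lAB by blast
    \<comment> \<open>By the link condition on \<open>(A, B)\<close> a part that enters the segment
      stays in it, but \<open>X\<close> reaches beyond \<open>b\<close>. So \<open>X\<close> starts
      before \<open>a\<close> and straddles \<open>A\<close> too.\<close>
    have "x1 \<notin> segment a b"
    proof
      assume "x1 \<in> segment a b"
      then have "x2 \<in> segment a b"
        using lAB(5)[of X a b x1] X \<open>X \<noteq> A\<close> a x by blast
      then show False using x less[OF a x(3)] by (auto simp: in_segment_iff)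
    qed
    then have "x1 < a" using x by (auto simp: in_segment_iff)
    then have "straddles X A"
      using a x less[OF a x(3)] unfolding straddles_def by (meson order.strict_trans)
    then show False using candA X \<open>X \<noteq> A\<close> by blast
  qed
  \<comment> \<open>An edge that crosses \<open>B\<close> forces \<open>B\<close> below both of its
    ends. As it does not cross \<open>A\<close>, its left end lies between \<open>A\<close> and
    \<open>B\<close>, where \<open>(A, B)\<close> forces it below \<open>B\<close>.\<close>
  have "B \<inter> segment x y = {}" if XY: "(X, Y) \<in> E" "X \<noteq> B" "Y \<noteq> B" "x \<in> X" "y \<in> Y" for X Y x y
  proof (rule ccontr)
    assume "B \<inter> segment x y \<noteq> {}"
    then obtain b where b: "b \<in> B" "b \<in> segment x y" by blast
    note lXY = linkD[OF XY(1)]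
    have "beyond X Y B"
      using beyondI[of Y B X x y b] ns lXY XY b lAB by blast
    then have forced: "forced (X, Y) B X" "forced (X, Y) B Y" by (auto simp: forced_def)
    have "forced (A, B) A B" by (simp add: forced_def)
    then have neA: "X \<noteq> A" "Y \<noteq> A" using not_both_forced[OF AB XY(1)] forced by blast+
    have sub: "B \<subseteq> segment x y" using lXY(5)[of B x y b] b XY lAB by blast
    have "a \<notin> segment x y" using candA(2)[OF XY(1) neA XY(4,5)] a by blast
    then have "\<not> min x y \<le> a" using less[OF a b(1)] b(2) by (auto simp: segment_def)
    then have "a < min x y" by (rule not_le_imp_less)
    obtain L l where L: "L = X \<or> L = Y" "l \<in> L" "l = min x y"
      using XY by (metis min_def)
    have "a < l" using \<open>a < min x y\<close> L(3) by simp
    have "l \<notin> B" using L lXY lAB XY part_eq by metis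
    have lB: "l < b'" if "b' \<in> B" for b'
      using sub that L(3) \<open>l \<notin> B\<close>
        by (metis atLeastAtMost_iff order_le_imp_less_or_eq segment_def subsetD)
    have "beyond A B L"
      unfolding beyond_def
    proof (intro conjI bexI)
      show "L \<noteq> A" "L \<noteq> B" using L neA XY by blast+
      show "a \<in> A" "b \<in> B" "l \<in> L" by fact+
      show "l \<in> segment a b" using \<open>a < l\<close> lB[OF b(1)] by (auto simp: in_segment_iff)
      show "B \<inter> segment a l = {}" using lB \<open>a < l\<close> by (fastforce simp: in_segment_iff)
    qed
    then have "forced (A, B) L B" by (simp add: forced_def)
    then show False using not_both_forced[OF AB XY(1)] forced L by blast
  qed
  \<comment> \<open>An edge from \<open>B\<close> to the left must not cross \<open>A\<close>, so it
    ends between \<open>A\<close> and \<open>B\<close>, and \<open>(A, B)\<close> forces its target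
    below \<open>B\<close>.\<close>
  moreover have "left_of B C" if BC: "(B, C) \<in> E" for C
  proof (rule ccontr)
    assume "\<not> left_of B C"
    note lBC = linkD[OF BC]
    have CB: "c < b" if "c \<in> C" "b \<in> B" for b c
      using lateral[of B C] lBC ns \<open>\<not> left_of B C\<close> that unfolding left_of_def by metis
    have f: "forced (B, C) B C" by (simp add: forced_def)
    moreover have "forced (A, B) A B" by (simp add: forced_def)
    ultimately have "C \<noteq> A" using not_both_forced[OF AB BC] by blast
    obtain b c where bc: "b \<in> B" "c \<in> C" using part_nonempty lBC by blast
    have "a \<notin> segment b c" using candA(2)[OF BC] lAB \<open>C \<noteq> A\<close> bc a by blast
    then have "a < c" using less[OF a bc(1)] by (auto simp: in_segment_iff)
    have "beyond A B C"
      unfolding beyond_def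
    proof (intro conjI bexI)
      show "C \<noteq> A" "C \<noteq> B" using \<open>C \<noteq> A\<close> lBC by blast+
      show "c \<in> segment a b" using \<open>a < c\<close> CB bc by (force simp: in_segment_iff)
      show "B \<inter> segment a c = {}" using CB[OF bc(2)] \<open>a < c\<close> by (force simp: in_segment_iff)
    qed (fact a bc)+
    then have "forced (A, B) C B" by (simp add: forced_def)
    then show False using not_both_forced[OF AB BC] f by blast
  qed
  ultimately show ?thesis using ns lAB(2) unfolding candidate_def by simp
qed

lemma admissible_exists:
  assumes "V \<noteq> {}"
  obtains A where "admissible S E A"
proof -
  have "finite {A. candidate A}"
    using partition finite by (auto simp: candidate_def intro: finite_subset[OF _ finite_elements])
  moreover have "{A. candidate A} \<noteq> {}" using candidate_first[OF assms] by blast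
  ultimately have *: "finite (Max ` {A. candidate A})" "Max ` {A. candidate A} \<noteq> {}" by simp_all
  from Max_in[OF this] obtain A where A: "candidate A" "Max (Max ` {A. candidate A}) = Max A"
    by auto
  have le: "Max B \<le> Max A" if "candidate B" for B
    using Max_ge[OF *(1)] that A(2) by simp
  have "(A, B) \<notin> E" for B
  proof
    assume AB: "(A, B) \<in> E"
    have "left_of A B" using A AB by (simp add: candidate_def)
    moreover have "finite A" "A \<noteq> {}" "finite B" "B \<noteq> {}"
      using linkD(1,2)[OF AB] part_nonempty part_subset finite_subset[OF _ finite] by simp_all
    ultimately have "Max A < Max B" by (simp add: left_of_def)
    then show False using le[OF candidate_step[OF A(1) AB]] by simp
  qed
  then have "admissible S E A" using A(1) unfolding admissible_def candidate_def by auto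
  then show ?thesis by (rule that)
qed

end

text \<open>The root is a parameter because, in the recursion, a gap that contains the source of an
  edge to the chosen root must receive this source as its own root. Each step only has to exclude
  conflicts between two edges, so coherence of pairs suffices.\<close>

theorem coherent_links_search_order:
  assumes "coherent_links V S E" "admissible S E A"
  shows "\<exists>le. search_order V S le \<and> (\<forall>x\<in>V. \<forall>a\<in>A. le x a) \<and>
    (\<forall>X Y x y. (X, Y) \<in> E \<longrightarrow> x \<in> X \<longrightarrow> y \<in> Y \<longrightarrow> imm V le x y)"
  using assms
proof (induction "card V" arbitrary: V S E A rule: less_induct)
  case less
  interpret coherent_links V S E by (rule less.prems)
  have A: "A \<in> S" "\<And>X. X \<in> S \<Longrightarrow> X \<noteq> A \<Longrightarrow> \<not> straddles X A" "\<And>Y. (A, Y) \<notin> E"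
    "\<And>X Y x y. \<lbrakk>(X, Y) \<in> E; X \<noteq> A; Y \<noteq> A; x \<in> X; y \<in> Y\<rbrakk> \<Longrightarrow> A \<inter> segment x y = {}"
    using less.prems(2) by (auto simp: admissible_def image_iff)
  have AV: "A \<subseteq> V" "A \<noteq> {}" using A part_subset part_nonempty by auto
  \<comment> \<open>A partial equivalence relation: its classes are the gaps of \<open>A\<close>,
    and elements of \<open>A\<close> are not near themselves.\<close>
  define near where "near x y \<longleftrightarrow> x \<in> V \<and> y \<in> V \<and> A \<inter> segment x y = {}" for x y
  have near_sym: "near y x" if "near x y" for x y
    using that by (auto simp: near_def segment_commute)
  have near_trans: "near x z" if "near x y" "near y z" for x y z
    using that in_segment_split unfolding near_def by blast
  have near_notA: "x \<notin> A" "y \<notin> A" if "near x y" for x y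
    using that unfolding near_def by (metis disjoint_iff ends_in_segment)+
  have near_refl: "near x x" if "x \<in> V" "x \<notin> A" for x
    using that by (auto simp: near_def in_segment_iff)
  have near_seg: "near u v" if "near x y" "u \<in> segment x y" "v \<in> segment x y" "u \<in> V" "v \<in> V"
    for x y u v
    using that segment_subset unfolding near_def by blast
  define gap where "gap x = {y. near x y}" for x
  have gap_eq: "gap x = gap y" if "near x y" for x y
    using that near_sym near_trans unfolding gap_def by blast
  have gap_V: "gap x \<subseteq> V" for x by (auto simp: gap_def near_def)
  have gap_near: "near y z" if "y \<in> gap x" "z \<in> gap x" for x y z
    using that near_sym near_trans unfolding gap_def by blast
  have part_near: "near x y" if "X \<in> S" "X \<noteq> A" "x \<in> X" "y \<in> X" for X x y
  proof -
    have "a \<notin> segment x y" if "a \<in> A" for a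
    proof
      assume "a \<in> segment x y"
      moreover have "a \<noteq> x" "a \<noteq> y"
        using part_eq[of A X a] A(1) that \<open>X \<in> S\<close> \<open>X \<noteq> A\<close> \<open>x \<in> X\<close> \<open>y \<in> X\<close> by auto
      ultimately have "straddles X A"
        using \<open>x \<in> X\<close> \<open>y \<in> X\<close> that unfolding straddles_def in_segment_iff
        by (metis order_le_imp_less_or_eq)
      then show False using A(2) \<open>X \<in> S\<close> \<open>X \<noteq> A\<close> by blast
    qed
    then show ?thesis using that part_subset unfolding near_def by blast
  qed
  define SG where "SG G = {X \<in> S. X \<subseteq> G}" for G
  define EG where "EG G = {(X, Y). (X, Y) \<in> E \<and> X \<subseteq> G \<and> Y \<subseteq> G}" for G
  have part_gap: "X \<subseteq> gap x" if "X \<in> S" "X \<noteq> A" "x \<in> X" for X x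
    using part_near that unfolding gap_def by blast
  have partA: "X = A" if "X \<in> S" "x \<in> X" "x \<in> A" for X x
    using part_eq A(1) that by blast
  have sub: "coherent_links (gap x) (SG (gap x)) (EG (gap x))" if "x \<in> V" for x
  proof (unfold_locales)
    have "partition_on (gap x) (SG (gap x))"
    proof (rule partition_onI)
      show "\<Union>(SG (gap x)) = gap x"
      proof
        show "gap x \<subseteq> \<Union>(SG (gap x))"
        proof
          fix y assume y: "y \<in> gap x"
          then obtain Y where Y: "Y \<in> S" "y \<in> Y" using gap_V partE by blast
          moreover have "y \<notin> A" using y near_notA by (auto simp: gap_def)
          ultimately have "Y \<subseteq> gap y" using part_gap partA by blast
          then have "Y \<in> SG (gap x)" using y gap_eq[of x y] Y by (auto simp: SG_def gap_def)
          then show "y \<in> \<Union>(SG (gap x))" using Y by blast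
        qed
      qed (auto simp: SG_def)
      show "disjnt p q" if "p \<in> SG (gap x)" "q \<in> SG (gap x)" "p \<noteq> q" for p q
        using that part_eq unfolding SG_def disjnt_def by blast
      show "{} \<notin> SG (gap x)" using part_nonempty by (auto simp: SG_def)
    qed
    moreover have "noncrossing (SG (gap x))"
      using noncrossing noncrossing_subset[of S] by (auto simp: noncrossing_partition_def SG_def)
    ultimately show "noncrossing_partition (gap x) (SG (gap x))"
      using finite gap_V unfolding noncrossing_partition_def by (meson finite_subset)
    show "link (SG (gap x)) X Y" if "(X, Y) \<in> EG (gap x)" for X Y
      using links[of X Y] that by (simp add: link_def EG_def SG_def)
    show "cohere f g" if "f \<in> EG (gap x)" "g \<in> EG (gap x)" for f g
      using coheres[of f g] that by (auto simp: EG_def)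
  qed
  \<comment> \<open>The last clause makes the source of an edge to \<open>A\<close> the root of its
    gap; only then is \<open>A\<close> its immediate successor after gluing.\<close>
  define P where "P G le \<longleftrightarrow> search_order G (SG G) le \<and>
      (\<forall>X Y x y. (X, Y) \<in> EG G \<longrightarrow> x \<in> X \<longrightarrow> y \<in> Y \<longrightarrow> imm G le x y) \<and>
      (\<forall>X. (X, A) \<in> E \<longrightarrow> X \<subseteq> G \<longrightarrow> (\<forall>u\<in>G. \<forall>v\<in>X. le u v))" for G le
  have ex: "\<exists>le. P (gap x) le" if x: "x \<in> V - A" for x
  proof -
    define G where "G = gap x"
    interpret G: coherent_links G "SG G" "EG G" unfolding G_def using sub x by blast
    have xG: "x \<in> G" using near_refl x by (auto simp: G_def gap_def)
    obtain a where a: "a \<in> A" using AV by blast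
    have card: "card G < card V"
      using gap_V finite a AV near_notA
      by (intro psubset_card_mono) (auto simp: G_def gap_def)
    have seg: "a \<notin> segment u v" if "a \<in> A" "u \<in> G" "v \<in> G" for a u v
      using gap_near that unfolding G_def near_def by blast
    have GA: "u \<notin> A" if "u \<in> G" for u using that near_notA by (auto simp: G_def gap_def)
    have adm: "admissible (SG G) (EG G) X" if XA: "(X, A) \<in> E" and XG: "X \<subseteq> G" for X
    proof -
      note l = linkD[OF XA]
      obtain x0 where x0: "x0 \<in> X" using part_nonempty l by blast
      have ns: "\<not> straddles U X" if U: "U \<in> SG G" "U \<noteq> X" for U
      proof
        assume "straddles U X"
        then obtain u x u' where u: "u \<in> U" "u' \<in> U" "x \<in> X" "u < x" "x < u'"
          by (auto simp: straddles_def)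
        have US: "U \<in> S" "U \<subseteq> G" "U \<noteq> A" using U GA a by (auto simp: SG_def)
        \<comment> \<open>No element of \<open>A\<close> separates the gap, so one end of
          \<open>U\<close> lies between \<open>X\<close> and \<open>a\<close>. The link condition on
          \<open>(X, A)\<close> then confines \<open>U\<close> to one side of
          \<open>x\<close>.\<close>
        have "a \<notin> segment u u'" using seg a u US by blast
        then have "a < u \<or> u' < a" by (auto simp: in_segment_iff)
        then have "u \<in> segment x a \<or> u' \<in> segment x a" using u by (auto simp: in_segment_iff)
        then have "U \<subseteq> segment x a" using l(5)[of U x a] US U(2) u a by blast
        then have "u \<in> segment x a" "u' \<in> segment x a" using u by blast+
        then show False using u \<open>a < u \<or> u' < a\<close> by (auto simp: in_segment_iff)
      qed
      have "X \<notin> fst ` EG G"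
      proof
        assume "X \<in> fst ` EG G"
        then obtain Y where Y: "(X, Y) \<in> E" "Y \<subseteq> G" by (auto simp: EG_def)
        then have "Y = A" using coheres[OF Y(1) XA] by (simp add: cohere_def)
        then show False using Y(2) GA a by blast
      qed
      moreover have "X \<inter> segment z w = {}"
        if ZW: "(Z, W) \<in> EG G" "Z \<noteq> X" "W \<noteq> X" "z \<in> Z" "w \<in> W" for Z W z w
      proof (rule ccontr)
        assume "X \<inter> segment z w \<noteq> {}"
        then obtain x where x: "x \<in> X" "x \<in> segment z w" by blast
        have ZWE: "(Z, W) \<in> E" "Z \<subseteq> G" "W \<subseteq> G" using ZW by (auto simp: EG_def)
        note lg = G.linkD[OF ZW(1)]
        have XS: "X \<in> SG G" using l XG by (simp add: SG_def)
        have "beyond Z W X"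
          using G.beyondI[of W X Z z w x] ns lg XS ZW x by blast
        then have g: "forced (Z, W) X Z" "forced (Z, W) X W" by (auto simp: forced_def)
        \<comment> \<open>An edge that crosses \<open>X\<close> forces \<open>X\<close> below both
          of its ends, but the end on the side of \<open>a\<close> lies between \<open>X\<close> and
          \<open>A\<close> and is forced below \<open>X\<close> by \<open>(X, A)\<close>.\<close>
        have "a \<notin> segment z w" using seg a ZWE ZW by blast
        then obtain U u where U: "U = Z \<or> U = W" "u \<in> U" "u \<in> segment x a"
          using x(2) ZW(4,5) unfolding in_segment_iff by (metis linorder_le_cases)
        have "U \<subseteq> G" using U ZWE by blast
        have "beyond X A U"
          unfolding beyond_def
        proof (intro conjI bexI)
          show "U \<noteq> X" using U ZW by blast
          show "U \<noteq> A" using U \<open>U \<subseteq> G\<close> GA by blast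
          show "A \<inter> segment x u = {}" using seg x XG U(2) \<open>U \<subseteq> G\<close> by blast
        qed (fact x a U)+
        then have "forced (X, A) U X" by (simp add: forced_def)
        then show False using not_both_forced[OF XA ZWE(1)] g U(1) by blast
      qed
      ultimately show ?thesis using ns l(1) XG unfolding admissible_def by (simp add: SG_def)
    qed
    have uniq: "X = X'" if "(X, A) \<in> E" "(X', A) \<in> E" "X \<subseteq> G" "X' \<subseteq> G" for X X'
    proof (rule ccontr)
      assume ne: "X \<noteq> X'"
      note l = linkD[OF that(1)] and l' = linkD[OF that(2)]
      obtain x x' where x: "x \<in> X" "x' \<in> X'" using part_nonempty l(1) l'(1) by blast
      \<comment> \<open>Of two sources in one gap, one lies between the other and \<open>a\<close>.
        The edge of the outer one forces the inner one below the outer one and the outer one below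
        \<open>A\<close>, which the last clause of \<open>cohere\<close> excludes.\<close>
      have "a \<notin> segment x x'" using seg a x that by blast
      then have "x' \<in> segment x a \<or> x \<in> segment x' a"
        unfolding in_segment_iff by (metis linorder_le_cases)
      moreover have "A \<inter> segment x x' = {}" "A \<inter> segment x' x = {}" using seg x that by blast+
      ultimately have "beyond X A X' \<or> beyond X' A X"
        using x a ne l(3) l'(3) unfolding beyond_def by blast
      then have "forced (X, A) X' X \<or> forced (X', A) X X'" by (auto simp: forced_def)
      moreover have "forced (X, A) X A" "forced (X', A) X' A" by (simp_all add: forced_def)
      ultimately show False
        using coheres[OF that(1,2)] coheres[OF that(2,1)] unfolding cohere_def by auto
    qed
    obtain B where B: "admissible (SG G) (EG G) B" "\<And>X. (X, A) \<in> E \<Longrightarrow> X \<subseteq> G \<Longrightarrow> X = B"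
    proof (cases "\<exists>X. (X, A) \<in> E \<and> X \<subseteq> G")
      case True
      then show ?thesis using that adm uniq by blast
    next
      case False
      moreover obtain B where "admissible (SG G) (EG G) B" using G.admissible_exists xG by blast
      ultimately show ?thesis using that by blast
    qed
    obtain le where "search_order G (SG G) le" "\<forall>x\<in>G. \<forall>b\<in>B. le x b"
      "\<forall>X Y x y. (X, Y) \<in> EG G \<longrightarrow> x \<in> X \<longrightarrow> y \<in> Y \<longrightarrow> imm G le x y"
      using less.hyps[OF card G.coherent_links_axioms B(1)] by blast
    then show ?thesis using B(2) unfolding G_def P_def by blast
  qed
  \<comment> \<open>The choice depends on the gap only, so near elements receive the same
    order.\<close>
  define M where "M x = (SOME le. P (gap x) le)" for x
  have M_eq: "M x = M y" if "near x y" for x y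
    using gap_eq[OF that] by (simp add: M_def)
  have M: "finite_search_order (gap x) (SG (gap x)) (M x)"
    and M_imm: "\<And>X Y x' y. \<lbrakk>(X, Y) \<in> EG (gap x); x' \<in> X; y \<in> Y\<rbrakk> \<Longrightarrow> imm (gap x) (M x) x' y"
    and M_top: "\<And>X u v. \<lbrakk>(X, A) \<in> E; X \<subseteq> gap x; u \<in> gap x; v \<in> X\<rbrakk> \<Longrightarrow> M x u v"
    if "x \<in> V - A" for x
  proof -
    have "P (gap x) (M x)" unfolding M_def using someI_ex[OF ex[OF that]] .
    then show "finite_search_order (gap x) (SG (gap x)) (M x)"
      "\<And>X Y x' y. \<lbrakk>(X, Y) \<in> EG (gap x); x' \<in> X; y \<in> Y\<rbrakk> \<Longrightarrow> imm (gap x) (M x) x' y"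
      "\<And>X u v. \<lbrakk>(X, A) \<in> E; X \<subseteq> gap x; u \<in> gap x; v \<in> X\<rbrakk> \<Longrightarrow> M x u v"
      using finite_subset[OF gap_V finite] unfolding P_def finite_search_order_def by blast+
  qed
  define le where "le x y \<longleftrightarrow> y \<in> A \<or> near x y \<and> M y x y" for x y
  have same_gap: "same_part S x y \<longleftrightarrow> near x y \<and> same_part (SG (gap y)) x y"
    if "x \<in> V - A" "y \<in> V - A" for x y
  proof
    assume "same_part S x y"
    then obtain X where X: "X \<in> S" "x \<in> X" "y \<in> X" by (auto simp: same_part_def)
    then have "X \<noteq> A" using that by blast
    moreover have "near x y" using part_near X calculation by blast
    moreover have "X \<subseteq> gap y" using part_gap X \<open>X \<noteq> A\<close> by blast
    ultimately show "near x y \<and> same_part (SG (gap y)) x y"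
      using X by (auto simp: same_part_def SG_def)
  qed (auto simp: same_part_def SG_def)
  have near_V: "x \<in> V - A" "y \<in> V - A" if "near x y" for x y
    using that near_notA[OF that] by (auto simp: near_def)
  have "search_order V S le"
    unfolding search_order_def
  proof (intro conjI ballI impI)
    fix x y assume V: "x \<in> V" "y \<in> V"
    show "le x y \<and> le y x \<longleftrightarrow> same_part S x y"
    proof (cases "x \<in> A \<or> y \<in> A")
      case True
      have "le x y \<and> le y x \<longleftrightarrow> x \<in> A \<and> y \<in> A"
        using True near_notA unfolding le_def by blast
      also have "\<dots> \<longleftrightarrow> same_part S x y"
        using True partA A(1) unfolding same_part_def by blast
      finally show ?thesis .
    next
      case False
      then have VA: "x \<in> V - A" "y \<in> V - A" using V by auto
      have "le x y \<and> le y x \<longleftrightarrow> near x y \<and> M y x y \<and> M y y x"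
        using False near_sym M_eq unfolding le_def by metis
      also have "\<dots> \<longleftrightarrow> near x y \<and> same_part (SG (gap y)) x y"
        using finite_search_order.same_iff[OF M[OF VA(2)], of x y] near_sym near_refl[of y] VA
        by (auto simp: gap_def)
      finally show ?thesis using same_gap[OF VA] by simp
    qed
    show "\<exists>c\<in>V. c \<in> segment x y \<and> (\<forall>z\<in>V. z \<in> segment x y \<longrightarrow> le z c)"
    proof (cases "A \<inter> segment x y = {}")
      case True
      then have xy: "near x y" using V by (simp add: near_def)
      note yV = near_V(2)[OF xy]
      have g: "x \<in> gap y" "y \<in> gap y"
        using near_sym[OF xy] near_refl yV by (auto simp: gap_def)
      obtain c where c: "c \<in> gap y" "c \<in> segment x y" 
        "\<And>z. z \<in> gap y \<Longrightarrow> z \<in> segment x y \<Longrightarrow> M y z c"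
        using finite_search_order.segment_max[OF M[OF yV] g] by blast
      have "le z c" if "z \<in> V" "z \<in> segment x y" for z
      proof -
        have "c \<in> V" using c gap_V by blast
        then have "near z c" "near y z" using near_seg[OF xy] that c(2) V by simp_all
        then show ?thesis
          using c(3)[of z] that M_eq[of y c] c(1) unfolding le_def gap_def by simp
      qed
      then show ?thesis using c gap_V by blast
    next
      case False
      then obtain a where "a \<in> A" "a \<in> segment x y" by blast
      then show ?thesis using AV by (auto simp: le_def)
    qed
  next
    fix x y z assume V: "x \<in> V" "y \<in> V" "z \<in> V"
    {
      assume xy: "le x y" and yz: "le y z"
      show "le x z"
      proof (cases "z \<in> A")
        case False
        then have yz: "near y z" "M z y z" using yz by (auto simp: le_def)
        then have xy: "near x y" "M z x y" using xy near_notA M_eq[of y z] by (auto simp: le_def)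
        have "x \<in> gap z" "y \<in> gap z" "z \<in> gap z" and xz: "near x z"
          using near_trans[OF xy(1) yz(1)] near_sym yz near_refl near_V
          by (auto simp: gap_def)
        then have "M z x z"
          using finite_search_order.trans[OF M[OF near_V(2)[OF yz(1)]] xy(2) yz(2)] by blast
        then show ?thesis using xz by (simp add: le_def)
      qed (simp add: le_def)
    }
    assume xy: "le x y" and z: "z \<in> segment x y"
    show "le z y"
    proof (cases "y \<in> A")
      case False
      then have xy: "near x y" "M y x y" using xy by (auto simp: le_def)
      then have zy: "near z y" using near_seg z V by simp
      have "x \<in> gap y" "y \<in> gap y" "z \<in> gap y"
        using near_sym[OF xy(1)] near_sym[OF zy] near_refl near_V[OF xy(1)] by (auto simp: gap_def)
      then have "M y z y"
        using finite_search_order.convex[OF M[OF near_V(2)[OF xy(1)]] xy(2) z] by blast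
      then show ?thesis using zy by (simp add: le_def)
    qed (simp add: le_def)
  qed
  moreover have "\<forall>x\<in>V. \<forall>a\<in>A. le x a" by (simp add: le_def)
  moreover have "imm V le x y" if XY: "(X, Y) \<in> E" "x \<in> X" "y \<in> Y" for X Y x y
  proof -
    note l = linkD[OF XY(1)]
    have "X \<noteq> A" using A(3) XY by blast
    then have xV: "x \<in> V - A" and XG: "X \<subseteq> gap x" and yV: "y \<in> V"
      using part_subset partA l(1,2) XY part_gap by blast+
    have xG: "x \<in> gap x" using XG XY by blast
    have le_x: "le x z \<longleftrightarrow> z \<in> A \<or> z \<in> gap x \<and> M x x z" for z
      unfolding le_def using M_eq[of x z] by (auto simp: gap_def)
    have le_G: "le u v \<longleftrightarrow> M x u v" if "u \<in> gap x" "v \<in> gap x" for u v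
    proof -
      have "near x v" "near u v" "v \<notin> A" using that gap_near[OF that] near_notA(2)
        by (simp_all add: gap_def)
      then show ?thesis using M_eq[of x v] by (simp add: le_def)
    qed
    show ?thesis
    proof (cases "Y = A")
      case True
      have "\<not> le y x" using near_notA(1) XY True xV unfolding le_def by blast
      moreover have "le z x" if "z \<in> gap x" for z
        using le_G[OF that xG] M_top[OF xV _ XG that] XY True by blast
      ultimately show ?thesis
        using xV yV XY True le_x unfolding imm_def le_def by blast
    next
      case False
      have "near x y" using A(4)[OF XY(1) \<open>X \<noteq> A\<close> False XY(2,3)] xV yV by (simp add: near_def)
      then have "gap y = gap x" using gap_eq by blast
      then have "(X, Y) \<in> EG (gap x)" using XG part_gap[OF l(2) False XY(3)] XY(1)
        by (simp add: EG_def)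
      then have i: "imm (gap x) (M x) x y" using M_imm[OF xV] XY by blast
      then have yG: "y \<in> gap x" by (simp add: imm_def)
      have "le y z" if "z \<in> V" "le x z" "\<not> le z x" for z
      proof (cases "z \<in> A")
        case False
        then have "z \<in> gap x" using that le_x by blast
        then show ?thesis using i that le_G xG yG unfolding imm_def by blast
      qed (simp add: le_def)
      then show ?thesis using i xV yV le_G[OF xG yG] le_G[OF yG xG] by (simp add: imm_def)
    qed
  qed
  ultimately show ?case by blast
qed

section \<open>The vertical order\<close>

text \<open>Parallel or equal, expressed without covers and maximal parts. In this form it is an
  equivalence relation on \<open>S\<close> whose classes are the parallel sets
  (\<open>parallel_iff\<close>, \<open>parallel_set_iff\<close>).\<close>

definition par :: "'a::linorder set set \<Rightarrow> 'a set \<Rightarrow> 'a set \<Rightarrow> bool" where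
  "par S X Y \<longleftrightarrow> (\<forall>C\<in>S. below X C \<or> below Y C \<longrightarrow> (\<forall>x\<in>X. \<forall>y\<in>Y. C \<inter> segment x y = {}))"

lemma below_trans: "below X Y \<Longrightarrow> below Y Z \<Longrightarrow> below X Z"
  by (auto simp: below_def)

lemma below_asym: "below X Y \<Longrightarrow> \<not> below Y X"
  by (auto simp: below_def)

lemma par_sym: "par S X Y \<longleftrightarrow> par S Y X"
  unfolding par_def using segment_commute by metis

context nc_partition
begin

lemma part_finite: "X \<in> S \<Longrightarrow> finite X"
  using part_subset finite finite_subset by blast

lemma below_iff:
  assumes "X \<in> S" "Y \<in> S"
  shows "below X Y \<longleftrightarrow> X \<noteq> Y \<and> straddles Y X"
proof
  have fin: "finite X" "finite Y" "X \<noteq> {}" "Y \<noteq> {}"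
    using assms part_finite part_nonempty by auto
  then have mm: "Min X \<in> X" "Max X \<in> X" "Min Y \<in> Y" "Max Y \<in> Y" "Min X \<le> Max X" by auto
  {
    assume b: "below X Y"
    then have "X \<noteq> Y" by (auto simp: below_def)
    have "Min Y \<le> Min X" "Max X \<le> Max Y"
      using b mm by (auto simp: below_def supp_def)
    moreover have "Min Y \<noteq> Min X" "Max X \<noteq> Max Y"
      using part_eq[of X Y] mm assms \<open>X \<noteq> Y\<close> by metis+
    ultimately have "Min Y < Min X" "Min X < Max Y" using mm by auto
    then show "X \<noteq> Y \<and> straddles Y X" using mm \<open>X \<noteq> Y\<close> unfolding straddles_def by blast
  }
  assume "X \<noteq> Y \<and> straddles Y X"
  then obtain y y' x where "X \<noteq> Y" and y: "y \<in> Y" "y' \<in> Y" "x \<in> X" "y < x" "x < y'"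
    by (auto simp: straddles_def)
  have "y < x' \<and> x' < y'" if "x' \<in> X" for x'
    using straddle_all[of X Y y y' x x'] y assms \<open>X \<noteq> Y\<close> that by blast
  then have "y < Min X" "Max X < y'" using mm by auto
  moreover have "Min Y \<le> y" "y' \<le> Max Y" using fin y by auto
  ultimately have "Min Y < Min X" "Max X < Max Y" by auto
  then show "below X Y" using mm by (auto simp: below_def supp_def)
qed

lemma belowE:
  assumes "X \<in> S" "Y \<in> S" "below X Y"
  obtains y y' where "y \<in> Y" "y' \<in> Y" "\<And>x. x \<in> X \<Longrightarrow> y < x" "\<And>x. x \<in> X \<Longrightarrow> x < y'"
proof -
  obtain y y' x where "y \<in> Y" "y' \<in> Y" "x \<in> X" "y < x" "x < y'" "X \<noteq> Y"
    using assms below_iff unfolding straddles_def by blast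
  then show ?thesis using that straddle_all[of X Y y y' x] assms by blast
qed

lemma belowI:
  assumes "X \<in> S" "Y \<in> S" "y \<in> Y" "y' \<in> Y" "x \<in> X" "y < x" "x < y'" "x \<notin> Y"
  shows "below X Y"
  using assms below_iff[of X Y] unfolding straddles_def by blast

lemma segment_part:
  assumes "X \<in> S" "Z \<in> S" "x \<in> X" "x' \<in> X" "z \<in> Z" "z \<in> segment x x'"
  shows "Z = X \<or> below Z X"
proof (rule disjCI)
  assume n: "\<not> below Z X"
  show "Z = X"
  proof (rule ccontr)
    assume "Z \<noteq> X"
    then have "z \<notin> X" using part_eq assms by blast
    then have "z \<noteq> x" "z \<noteq> x'" using assms by auto
    then have "x < z \<and> z < x' \<or> x' < z \<and> z < x" using assms(6) by (auto simp: in_segment_iff)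
    then show False using n belowI[of Z X x x' z] belowI[of Z X x' x z] assms \<open>z \<notin> X\<close> by blast
  qed
qed

text \<open>Both \<open>C\<close> and \<open>D\<close> enclose \<open>x\<close>, so the one that
  starts further right starts inside the other, and noncrossing nests them.\<close>

lemma laminar:
  assumes "X \<in> S" "C \<in> S" "D \<in> S" "below X C" "below X D" "C \<noteq> D"
  shows "below C D \<or> below D C"
proof -
  obtain x where x: "x \<in> X" using part_nonempty assms by blast
  obtain c c' where c: "c \<in> C" "c' \<in> C" "c < x" "x < c'" using belowE[OF assms(1,2,4)] x by metis
  obtain d d' where d: "d \<in> D" "d' \<in> D" "d < x" "x < d'" using belowE[OF assms(1,3,5)] x by metis
  have CD: "u \<notin> D" if "u \<in> C" for u using part_eq[of C D u] assms that by blast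
  have DC: "u \<notin> C" if "u \<in> D" for u using part_eq[of C D u] assms that by blast
  have ne: "c \<noteq> d" using CD c d by blast
  show ?thesis
  proof (cases "c < d")
    case True
    have "d < c'" using c d by simp
    then show ?thesis using belowI[of D C c c' d] True c d assms DC by blast
  next
    case False
    then have "d < c" "c < d'" using c d ne by auto
    then show ?thesis using belowI[of C D d d' c] c d assms CD by blast
  qed
qed

text \<open>Counted from above: it vanishes on the vertically maximal parts and grows
  downwards.\<close>

definition height :: "'a set \<Rightarrow> nat" where
  "height X = card {C \<in> S. below X C}"

lemma finite_S: "finite S"
  using finite partition finite_elements by blast

lemma height_less: "Y \<in> S \<Longrightarrow> below X Y \<Longrightarrow> height Y < height X"
proof -
  assume Y: "Y \<in> S" "below X Y"
  then have "{C \<in> S. below Y C} \<subset> {C \<in> S. below X C}"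
    using below_trans[of X Y] below_asym[of Y Y] by blast
  then show ?thesis unfolding height_def using finite_S by (intro psubset_card_mono) auto
qed

lemma cover_exists:
  assumes "C \<in> S" "below X C" "X \<in> S"
  obtains D where "covers S D X" "D = C \<or> below D C"
proof -
  define A where "A = {D \<in> S. below X D \<and> (D = C \<or> below D C)}"
  have "C \<in> A" using assms by (simp add: A_def)
  have "\<exists>D. D \<in> A \<and> (\<forall>E. E \<in> A \<longrightarrow> height E \<le> height D)"
  proof (rule ex_has_greatest_nat)
    show "C \<in> A" by fact
    show "\<forall>E. E \<in> A \<longrightarrow> height E < Suc (card S)"
      using finite_S by (auto simp: height_def less_Suc_eq_le intro!: card_mono)
  qed
  then obtain D where D: "D \<in> A" "\<And>E. E \<in> A \<Longrightarrow> height E \<le> height D" by blast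
  have "\<not> (below X E \<and> below E D)" if E: "E \<in> S" for E
  proof
    assume b: "below X E \<and> below E D"
    then have "E \<in> A" using D(1) E below_trans by (auto simp: A_def)
    moreover have "height D < height E" using height_less[of D E] D(1) b by (simp add: A_def)
    ultimately show False using D(2) by force
  qed
  then have "covers S D X" using D assms by (auto simp: covers_def A_def)
  then show ?thesis using that D(1) by (auto simp: A_def)
qed

lemma cover_unique: "covers S C X \<Longrightarrow> covers S D X \<Longrightarrow> C = D"
  unfolding covers_def using laminar by blast

lemma not_below_self: "\<not> below X X"
  by (simp add: below_def)

lemma par_refl:
  assumes "X \<in> S"
  shows "par S X X"
  unfolding par_def
proof (intro ballI impI)
  fix C x y assume C: "C \<in> S" "below X C \<or> below X C" "x \<in> X" "y \<in> X"
  show "C \<inter> segment x y = {}"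
    using segment_part[of X C x y] below_asym[of X C] not_below_self C assms by blast
qed

text \<open>\<open>C\<close> encloses \<open>X\<close> and has no element between \<open>X\<close>
  and \<open>Y\<close>, so it encloses \<open>Y\<close> as well.\<close>

lemma par_below:
  assumes "par S X Y" "X \<in> S" "Y \<in> S" "C \<in> S" "below X C"
  shows "below Y C"
proof -
  obtain x y where xy: "x \<in> X" "y \<in> Y" using assms part_nonempty by blast
  obtain c c' where c: "c \<in> C" "c' \<in> C" "c < x" "x < c'"
    using belowE[OF assms(2,4,5)] xy by metis
  have "C \<inter> segment x y = {}" using assms xy unfolding par_def by blast
  then have "c \<notin> segment x y" "c' \<notin> segment x y" "y \<notin> C" using c by auto
  then have "c < y" "y < c'" using c by (auto simp: in_segment_iff)
  then show ?thesis using belowI[of Y C c c' y] c xy assms \<open>y \<notin> C\<close> by blast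
qed

lemma par_trans:
  assumes "par S X Y" "par S Y Z" "X \<in> S" "Y \<in> S" "Z \<in> S"
  shows "par S X Z"
  unfolding par_def
proof (intro ballI impI)
  fix C x z assume C: "C \<in> S" "below X C \<or> below Z C" "x \<in> X" "z \<in> Z"
  obtain y where y: "y \<in> Y" using part_nonempty assms by blast
  have "below Y C" using C par_below assms par_sym by blast
  then have "C \<inter> segment x y = {}" "C \<inter> segment y z = {}"
    using assms(1,2) C y unfolding par_def by blast+
  then show "C \<inter> segment x z = {}" using in_segment_split by blast
qed

lemma par_not_below:
  assumes "par S X Y" "X \<in> S" "Y \<in> S"
  shows "\<not> below X Y"
proof
  assume b: "below X Y"
  obtain x y where xy: "x \<in> X" "y \<in> Y" using assms part_nonempty by blast
  then have "Y \<inter> segment x y = {}" using assms b unfolding par_def by blast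
  then show False using xy ends_in_segment by blast
qed

lemma par_lateral:
  assumes "par S X Y" "X \<in> S" "Y \<in> S" "X \<noteq> Y"
  shows "left_of X Y \<or> left_of Y X"
  using lateral[of X Y] par_not_below[of X Y] par_not_below[of Y X] assms below_iff par_sym by blast

lemma parallel_iff: "parallel_parts S X Y \<longleftrightarrow> X \<in> S \<and> Y \<in> S \<and> X \<noteq> Y \<and> par S X Y"
proof
  assume p: "parallel_parts S X Y"
  then have S: "X \<in> S" "Y \<in> S" "X \<noteq> Y" by (auto simp: parallel_parts_def)
  have "par S X Y"
  proof (cases "vmaximal S X \<and> vmaximal S Y")
    case True
    then show ?thesis unfolding par_def vmaximal_def by blast
  next
    case False
    then obtain C where C: "covers S C X" "covers S C Y" "\<not> (\<exists>c\<in>C. element_between X Y c)"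
      using p unfolding parallel_parts_def by blast
    then have CS: "C \<in> S" "below X C" "below Y C" by (auto simp: covers_def)
    obtain c0 c1 where c01: "c0 \<in> C" "c1 \<in> C" "\<And>x. x \<in> X \<Longrightarrow> c0 < x" "\<And>x. x \<in> X \<Longrightarrow> x < c1"
      using belowE[OF S(1) CS(1,2)] by metis
    obtain c2 c3 where c23: "c2 \<in> C" "c3 \<in> C" "\<And>x. x \<in> Y \<Longrightarrow> c2 < x" "\<And>x. x \<in> Y \<Longrightarrow> x < c3"
      using belowE[OF S(2) CS(1,3)] by metis
    show ?thesis
      unfolding par_def
    proof (intro ballI impI)
      fix D x y assume D: "D \<in> S" "below X D \<or> below Y D" and xy: "x \<in> X" "y \<in> Y"
      show "D \<inter> segment x y = {}"
      proof (cases "D = C")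
        case True
        have "c \<notin> segment x y" if c: "c \<in> C" for c
        proof
          assume seg: "c \<in> segment x y"
          have "c \<notin> X" "c \<notin> Y" using part_eq[of C] CS S not_below_self c by blast+
          have "\<not> (x' < c \<and> c < x'')" if "x' \<in> X" "x'' \<in> X" for x' x''
            using belowI[of C X x' x'' c] below_asym[of X C] CS S c that \<open>c \<notin> X\<close> by blast
          moreover have "\<not> (x' < c \<and> c < x'')" if "x' \<in> Y" "x'' \<in> Y" for x' x''
            using belowI[of C Y x' x'' c] below_asym[of Y C] CS S c that \<open>c \<notin> Y\<close> by blast
          ultimately have "element_between X Y c"
            using seg xy \<open>c \<notin> X\<close> \<open>c \<notin> Y\<close> unfolding element_between_def in_segment_iff
            by (metis linorder_neqE order_le_imp_less_or_eq)
          then show False using C c by blast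
        qed
        then show ?thesis using True by blast
      next
        case False
        \<comment> \<open>A part \<open>D\<close> above \<open>X\<close> or \<open>Y\<close> other
          than their cover \<open>C\<close> lies above \<open>C\<close>. But an element of
          \<open>D\<close> between \<open>x\<close> and \<open>y\<close> lies within the support of
          \<open>C\<close> and would put \<open>D\<close> below \<open>C\<close>.\<close>
        then have CD: "below C D"
          using laminar[of X C D] laminar[of Y C D] D S CS C unfolding covers_def by blast
        have "d \<notin> segment x y" if d: "d \<in> D" for d
        proof
          assume seg: "d \<in> segment x y"
          have "d \<notin> C" using part_eq[of C D d] D CS False d by blast
          have lt: "c0 < x" "x < c1" "c2 < y" "y < c3" using c01 c23 xy by auto
          have "c0 < d \<and> d < c3 \<or> c2 < d \<and> d < c1"
            using seg lt by (auto simp: in_segment_iff)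
          then have "below D C"
            using belowI[of D C _ _ d] D CS d \<open>d \<notin> C\<close> c01 c23 by blast
          then show False using CD below_asym by blast
        qed
        then show ?thesis by blast
      qed
    qed
  qed
  then show "X \<in> S \<and> Y \<in> S \<and> X \<noteq> Y \<and> par S X Y" using S by blast
next
  assume p: "X \<in> S \<and> Y \<in> S \<and> X \<noteq> Y \<and> par S X Y"
  then have same: "below X C \<longleftrightarrow> below Y C" if "C \<in> S" for C
    using par_below par_sym that by blast
  show "parallel_parts S X Y"
  proof (cases "\<exists>C\<in>S. below X C")
    case True
    then obtain C where C: "covers S C X" using cover_exists p by blast
    then have CS: "C \<in> S" "below X C" "covers S C Y" using same p by (auto simp: covers_def)
    have "\<not> element_between X Y c" if "c \<in> C" for c
    proof
      assume e: "element_between X Y c"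
      obtain x y where "x \<in> X" "y \<in> Y" using p part_nonempty by blast
      moreover from this have "x < c \<and> c < y \<or> y < c \<and> c < x"
        using e unfolding element_between_def by blast
      then have "c \<in> segment x y" by (auto simp: in_segment_iff)
      ultimately show False using p CS that unfolding par_def by blast
    qed
    then show ?thesis using p C CS unfolding parallel_parts_def by blast
  next
    case False
    then show ?thesis using p same unfolding parallel_parts_def vmaximal_def by blast
  qed
qed

lemma edges_iff:
  assumes "X \<noteq> Y"
  shows "arrow Y X \<in> edges S \<longleftrightarrow> X \<in> S \<and> Y \<in> S \<and> (par S X Y \<or> covers S Y X)"
  unfolding edges_def using arrow_eq_iff[OF assms] parallel_iff[of Y X] par_sym[of S X Y] assms
    by auto

lemma edgesE:
  assumes "e \<in> edges S"
  obtains X Y where "e = arrow Y X" "X \<noteq> Y" "X \<in> S" "Y \<in> S" "par S X Y \<or> covers S Y X"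
  using assms unfolding edges_def parallel_iff
  by (auto simp: par_sym covers_def not_below_self)

text \<open>A part \<open>Z\<close> that enters the segment and leaves it straddles \<open>X\<close>
  or \<open>Y\<close>. For parallel parts \<open>par\<close> rules this out. For a cover,
  \<open>Z\<close> also has an element within the support of \<open>Y\<close>, so it would lie
  strictly between \<open>X\<close> and \<open>Y\<close>.\<close>

lemma edge_link:
  assumes "X \<in> S" "Y \<in> S" "X \<noteq> Y" "par S X Y \<or> covers S Y X"
  shows "link S X Y"
proof -
  have nb: "\<not> below Y X"
    using assms(4) par_not_below[of Y X] assms(1,2) below_asym[of X Y] par_sym[of S X Y]
    by (auto simp: covers_def)
  moreover have False
    if Z: "Z \<in> S" "Z \<noteq> X" "Z \<noteq> Y" "x \<in> X" "y \<in> Y" "z \<in> Z" "z \<in> segment x y" "z' \<in> Z"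
      "z' \<notin> segment x y"
    for Z x y z z'
  proof -
    have nZ: "x \<notin> Z" "y \<notin> Z" "z \<notin> Y" using part_eq Z assms by blast+
    have "x \<noteq> z" "x \<noteq> z'" "y \<noteq> z" "y \<noteq> z'" using nZ Z by auto
    then have "(z' < x \<and> x < z \<or> z < x \<and> x < z') \<or> (z' < y \<and> y < z \<or> z < y \<and> y < z')"
      using Z(7,9) by (auto simp: in_segment_iff)
    then have or: "below X Z \<or> below Y Z"
      using belowI[of X Z _ _ x] belowI[of Y Z _ _ y] Z assms nZ by blast
    show False
    proof (cases "par S X Y")
      case True
      then show False using or Z unfolding par_def by blast
    next
      case False
      then have c: "covers S Y X" using assms by blast
      then have XY: "below X Y" by (simp add: covers_def)
      obtain y0 y1 where y01: "y0 \<in> Y" "y1 \<in> Y" "y0 < x" "x < y1"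
        using belowE[OF assms(1,2) XY] Z(4) by metis
      have "y0 < z \<and> z < y \<or> y < z \<and> z < y1"
        using Z(7) y01 \<open>y \<noteq> z\<close> by (auto simp: in_segment_iff)
      then have "below Z Y"
        using belowI[of Z Y _ _ z] Z y01 assms nZ by blast
      then show False using or c Z below_asym[of Z Y] unfolding covers_def by blast
    qed
  qed
  ultimately show ?thesis using assms below_iff[of Y X] unfolding link_def by blast
qed

text \<open>Used for climbing: a part between two parallel ones but not parallel to them is replaced
  by a higher part that still meets the segment, so induction on \<open>height\<close>
  applies.\<close>

lemma par_between:
  assumes "par S X Y" "X \<in> S" "Y \<in> S" "Z \<in> S" "x \<in> X" "y \<in> Y" "z \<in> Z" "z \<in> segment x y"
    "\<not> par S X Z"
  obtains C where "C \<in> S" "below Z C" "C \<inter> segment x y \<noteq> {}"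
proof -
  obtain C x' z' c where C: "C \<in> S" "below X C \<or> below Z C" "x' \<in> X" "z' \<in> Z" "c \<in> C"
    "c \<in> segment x' z'"
    using assms(9) unfolding par_def by blast
  have XC: "\<not> below X C"
  proof
    assume b: "below X C"
    then have *: "C \<inter> segment x y = {}" "C \<inter> segment x' x = {}"
      using assms(1,5,6) C(1,3) par_refl[OF assms(2)] unfolding par_def by blast+
    then have "z \<notin> C" using assms by blast
    then have "Z \<noteq> C" using assms by blast
    have "segment x z \<subseteq> segment x y" using assms(8) by (auto simp: in_segment_iff)
    then have "c \<in> segment z z'"
      using * C(5,6) in_segment_split[of c x' z' x] in_segment_split[of c x z' z] by blast
    then have "below C Z" using segment_part[of Z C z z' c] assms C \<open>Z \<noteq> C\<close> by blast
    obtain c0 c1 where c01: "c0 \<in> C" "c1 \<in> C" "c0 < x" "x < c1"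
      using belowE[OF assms(2) C(1) b] assms(5) by metis
    have "c0 \<notin> segment x y" "c1 \<notin> segment x y" using * c01 by auto
    then have "c0 < z" "z < c1" using c01 assms(8) by (auto simp: in_segment_iff)
    then have "below Z C" using belowI[of Z C c0 c1 z] c01 assms C \<open>z \<notin> C\<close> by blast
    then show False using \<open>below C Z\<close> below_asym by blast
  qed
  then have ZC: "below Z C" using C by blast
  obtain c0 c1 where c01: "c0 \<in> C" "c1 \<in> C" "c0 < z" "z < c1"
    using belowE[OF assms(4) C(1) ZC] assms(7) by metis
  have "C \<inter> segment x y \<noteq> {}"
  proof
    assume n: "C \<inter> segment x y = {}"
    then have "c0 \<notin> segment x y" "c1 \<notin> segment x y" "x \<notin> C" using c01 by auto
    then have "c0 < x" "x < c1" using c01 assms(8) by (auto simp: in_segment_iff)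
    then have "below X C" using belowI[of X C c0 c1 x] c01 assms C \<open>x \<notin> C\<close> by blast
    then show False using XC by blast
  qed
  then show ?thesis using that C ZC by blast
qed

text \<open>A maximal clique of an equivalence relation is a class. For empty \<open>S\<close> the
  empty set would be a parallel set as well.\<close>

lemma parallel_set_iff:
  assumes "S \<noteq> {}"
  shows "parallel_set S P \<longleftrightarrow> (\<exists>X\<in>S. P = {Y \<in> S. par S X Y})"
proof
  assume P: "parallel_set S P"
  then have sub: "P \<subseteq> S" and pw: "pairwise (parallel_parts S) P"
    and mx: "\<And>P'. \<lbrakk>P' \<subseteq> S; pairwise (parallel_parts S) P'; P \<subseteq> P'\<rbrakk> \<Longrightarrow> P' = P"
    by (auto simp: parallel_set_def)
  have "P \<noteq> {}"
  proof
    assume "P = {}"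
    obtain X where "X \<in> S" using assms by blast
    then have "{X} = P" using mx[of "{X}"] \<open>P = {}\<close> by (simp add: pairwise_def)
    then show False using \<open>P = {}\<close> by blast
  qed
  then obtain X where X: "X \<in> P" by blast
  have "{Y \<in> S. par S X Y} = P"
  proof (rule mx)
    show "pairwise (parallel_parts S) {Y \<in> S. par S X Y}"
      unfolding pairwise_def parallel_iff using par_trans par_sym X sub by blast
    show "P \<subseteq> {Y \<in> S. par S X Y}"
    proof
      fix Y assume "Y \<in> P"
      then show "Y \<in> {Y \<in> S. par S X Y}"
        using X pw sub par_refl[of X] unfolding pairwise_def parallel_iff by (cases "X = Y") auto
    qed
  qed auto
  then show "\<exists>X\<in>S. P = {Y \<in> S. par S X Y}" using X sub by blast
next
  assume "\<exists>X\<in>S. P = {Y \<in> S. par S X Y}"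
  then obtain X where X: "X \<in> S" "P = {Y \<in> S. par S X Y}" by blast
  have "pairwise (parallel_parts S) P"
    unfolding pairwise_def parallel_iff X using par_trans par_sym X(1) by blast
  moreover have "P' = P" if "P' \<subseteq> S" "pairwise (parallel_parts S) P'" "P \<subseteq> P'" for P'
  proof
    have "X \<in> P'" using that X par_refl by blast
    show "P' \<subseteq> P"
    proof
      fix Y assume "Y \<in> P'"
      then show "Y \<in> P"
        using that \<open>X \<in> P'\<close> par_refl[OF X(1)] X unfolding pairwise_def parallel_iff
          by (cases "X = Y") auto
    qed
  qed (fact that)
  ultimately show "parallel_set S P" using X by (auto simp: parallel_set_def)
qed

end

section \<open>Search orders and binary forests\<close>

locale nc_search_order = nc_partition V S + finite_search_order V S le
  for V :: "'a::linorder set" and S :: "'a set set" and le :: "'a \<Rightarrow> 'a \<Rightarrow> bool" +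
  assumes nonempty: "V \<noteq> {}"
begin

definition part_le :: "'a set \<Rightarrow> 'a set \<Rightarrow> bool" where
  "part_le X Y \<longleftrightarrow> (\<exists>x\<in>X. \<exists>y\<in>Y. le x y)"

definition part_imm :: "'a set \<Rightarrow> 'a set \<Rightarrow> bool" where
  "part_imm X Y \<longleftrightarrow> (\<exists>x\<in>X. \<exists>y\<in>Y. imm V le x y)"

definition depth :: "'a set \<Rightarrow> nat" where
  "depth X = card {u \<in> V. \<exists>x\<in>X. le x u}"

lemma in_V: "X \<in> S \<Longrightarrow> x \<in> X \<Longrightarrow> x \<in> V"
  using part_subset by blast

lemma same_part_iff: "X \<in> S \<Longrightarrow> x \<in> X \<Longrightarrow> same_part S x y \<longleftrightarrow> y \<in> X"
  using part_eq unfolding same_part_def by blast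

lemma le_same: "\<lbrakk>X \<in> S; x \<in> X; y \<in> X\<rbrakk> \<Longrightarrow> le x y"
  using same_iff[of x y] in_V same_part_iff by blast

lemma part_leD:
  assumes "part_le X Y" "X \<in> S" "Y \<in> S" "x \<in> X" "y \<in> Y"
  shows "le x y"
proof -
  obtain x' y' where "x' \<in> X" "y' \<in> Y" "le x' y'" using assms by (auto simp: part_le_def)
  then show ?thesis
    using trans[of x x' y'] trans[of x y' y] le_same[of X x x'] le_same[of Y y' y] assms in_V
      by blast
qed

lemma part_leI: "\<lbrakk>le x y; x \<in> X; y \<in> Y\<rbrakk> \<Longrightarrow> part_le X Y"
  by (auto simp: part_le_def)

lemma part_le_iff:
  assumes "X \<in> S" "Y \<in> S" "x \<in> X" "y \<in> Y"
  shows "part_le X Y \<longleftrightarrow> le x y"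
  using part_leD[OF _ assms] part_leI[OF _ assms(3,4)] by blast

lemma part_le_trans:
  assumes "part_le X Y" "part_le Y Z" "X \<in> S" "Y \<in> S" "Z \<in> S"
  shows "part_le X Z"
proof -
  obtain x y z where "x \<in> X" "y \<in> Y" "z \<in> Z" using assms part_nonempty by (metis ex_in_conv)
  then show ?thesis
    using assms trans[of x y z] in_V by (simp add: part_le_iff)
qed

lemma part_le_antisym:
  assumes "part_le X Y" "part_le Y X" "X \<in> S" "Y \<in> S"
  shows "X = Y"
proof -
  obtain x y where xy: "x \<in> X" "y \<in> Y" using assms part_nonempty by (metis ex_in_conv)
  then have "same_part S x y"
    using assms same_iff[of x y] in_V by (simp add: part_le_iff)
  then show ?thesis using same_part_iff[OF assms(3) xy(1)] part_eq[OF assms(3,4) _ xy(2)] by blast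
qed

lemma depth_less:
  assumes "part_le X Y" "X \<noteq> Y" "X \<in> S" "Y \<in> S"
  shows "depth Y < depth X"
proof -
  obtain x y where xy: "x \<in> X" "y \<in> Y" using assms part_nonempty by blast
  have eq: "{u \<in> V. \<exists>z\<in>Z. le z u} = {u \<in> V. le z u}" if "Z \<in> S" "z \<in> Z" for Z z
    using that le_same trans in_V by blast
  have "\<not> le y x" using part_le_antisym[OF assms(1)] part_leI xy assms by blast
  then show ?thesis
    using part_le_imp_rank[of x y] part_leD[OF assms(1,3,4) xy] xy assms in_V
    unfolding depth_def by (simp add: eq)
qed

lemma part_imm_iff:
  assumes "X \<in> S" "Y \<in> S"
  shows "part_imm X Y \<longleftrightarrow> part_le X Y \<and> X \<noteq> Y \<and> (\<forall>Z\<in>S. part_le X Z \<longrightarrow> Z \<noteq> X \<longrightarrow> part_le Y Z)"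
proof
  assume "part_imm X Y"
  then obtain x y where xy: "x \<in> X" "y \<in> Y" and i: "imm V le x y" by (auto simp: part_imm_def)
  have "part_le X Y" "X \<noteq> Y" using i xy le_same assms unfolding imm_def part_le_def by blast+
  moreover have "part_le Y Z" if Z: "Z \<in> S" "part_le X Z" "Z \<noteq> X" for Z
  proof -
    obtain z where z: "z \<in> Z" using part_nonempty Z by blast
    have "le x z" "\<not> le z x"
      using part_leD[OF Z(2) assms(1) Z(1) xy(1) z] part_le_antisym[OF Z(2) _ assms(1) Z(1)] Z(3) part_leI[OF _ z xy(1)]
      by blast+
    then show ?thesis using i z xy in_V[OF Z(1)] part_leI unfolding imm_def by blast
  qed
  ultimately show "part_le X Y \<and> X \<noteq> Y \<and> (\<forall>Z\<in>S. part_le X Z \<longrightarrow> Z \<noteq> X \<longrightarrow> part_le Y Z)" by blast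
next
  assume *: "part_le X Y \<and> X \<noteq> Y \<and> (\<forall>Z\<in>S. part_le X Z \<longrightarrow> Z \<noteq> X \<longrightarrow> part_le Y Z)"
  obtain x y where xy: "x \<in> X" "y \<in> Y" using assms part_nonempty by blast
  have "le x y" "\<not> le y x"
    using * part_leD xy assms part_le_antisym[of X Y] part_leI[of y x Y X] by blast+
  moreover have "le y z" if z: "z \<in> V" "le x z" "\<not> le z x" for z
  proof -
    obtain Z where Z: "Z \<in> S" "z \<in> Z" using partE z by blast
    then have "part_le X Z" "Z \<noteq> X" using part_leI z xy le_same assms by blast+
    then show ?thesis using * Z part_leD[of Y Z] xy assms by blast
  qed
  ultimately have "imm V le x y" using in_V xy assms by (auto simp: imm_def)
  then show "part_imm X Y" using xy by (auto simp: part_imm_def)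
qed

lemma part_imm_exists:
  assumes "X \<in> S" "Z \<in> S" "part_le X Z" "X \<noteq> Z"
  obtains Y where "Y \<in> S" "part_imm X Y" "part_le Y Z"
proof -
  obtain x z where xz: "x \<in> X" "z \<in> Z" using assms part_nonempty by blast
  have "le x z" "\<not> le z x"
    using part_leD[OF assms(3,1,2) xz] part_le_antisym[OF assms(3) _ assms(1,2)] part_leI[OF _ xz(2,1)] assms(4)
    by blast+
  then obtain y where y: "imm V le x y" using imm_exists in_V xz assms by blast
  then obtain Y where Y: "Y \<in> S" "y \<in> Y" using partE by (auto simp: imm_def)
  then have "part_imm X Y" using y xz by (auto simp: part_imm_def)
  then show ?thesis using that Y part_imm_iff assms by blast
qed

lemma part_imm_unique:
  "\<lbrakk>part_imm X Y; part_imm X Z; X \<in> S; Y \<in> S; Z \<in> S\<rbrakk> \<Longrightarrow> Y = Z"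
  using part_imm_iff part_le_antisym by metis

text \<open>An element of \<open>X\<close> lies between two elements of \<open>C\<close>, which are
  equivalent for \<open>le\<close>; convexity puts it below them.\<close>

lemma below_part_le:
  assumes "below X C" "X \<in> S" "C \<in> S"
  shows "part_le X C"
proof -
  obtain x where x: "x \<in> X" using part_nonempty assms by blast
  obtain c c' where c: "c \<in> C" "c' \<in> C" "c < x" "x < c'" using belowE[OF assms(2,3,1)] x by metis
  have "x \<in> segment c c'" using c by (auto simp: in_segment_iff)
  then have "le x c'" using convex[of c c' x] le_same[of C c c'] c x assms in_V by blast
  then show ?thesis using part_leI x c by blast
qed

text \<open>The top of the segment from \<open>x\<close> to \<open>z\<close> is above
  \<open>x\<close> and, by convexity, below \<open>Y\<close>. No part lies properly between
  \<open>X\<close> and \<open>Y\<close>, and \<open>Y\<close> misses the segment, so the top lies in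
  \<open>X\<close>. This gives condition (i) of binary trees and justifies
  \<open>forced\<close>.\<close>

lemma part_imm_between:
  assumes i: "part_imm X Y" and S: "X \<in> S" "Y \<in> S" "Z \<in> S"
    and seg: "x \<in> X" "y \<in> Y" "z \<in> Z" "z \<in> segment x y" "Y \<inter> segment x z = {}"
  shows "part_le Z X"
proof -
  note V = in_V[OF S(1) seg(1)] in_V[OF S(2) seg(2)] in_V[OF S(3) seg(3)]
  obtain c where c: "c \<in> V" "c \<in> segment x z" "\<And>u. u \<in> V \<Longrightarrow> u \<in> segment x z \<Longrightarrow> le u c"
    using segment_max V by metis
  obtain C where C: "C \<in> S" "c \<in> C" using partE c by blast
  have XY: "part_le X Y" using part_imm_iff[OF S(1,2)] i by blast
  then have "le x y" using part_leD S seg by blast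
  have "c \<in> segment x y" using segment_subset[OF _ seg(4) c(2)] by simp
  then have "le c y" using convex[of x y c] \<open>le x y\<close> V c by blast
  have lexc: "le x c" "le z c" using c(3) V by simp_all
  have "C = X"
  proof (rule ccontr)
    assume "C \<noteq> X"
    then have "part_le Y C" using part_imm_iff[OF S(1,2)] i C lexc part_leI seg by blast
    then have "C = Y" using part_le_antisym[of C Y] part_leI[OF \<open>le c y\<close>] C S seg by blast
    then show False using C c seg(5) by blast
  qed
  then show ?thesis using lexc C seg part_leI by blast
qed

lemma part_imm_beyond:
  assumes "part_imm X Y" "X \<in> S" "Y \<in> S" "Z \<in> S" "beyond X Y Z"
  shows "part_le Z X"
  using assms part_imm_between unfolding beyond_def by blast

text \<open>Every part vertically above \<open>X\<close> is at or above \<open>Y\<close> in the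
  tree. So if \<open>Y\<close> encloses \<open>X\<close>, it covers \<open>X\<close>. Otherwise a
  part above \<open>X\<close> or \<open>Y\<close> that met the space between them would be below
  \<open>Y\<close> by convexity, hence equal to \<open>Y\<close>.\<close>

lemma part_imm_edge:
  assumes i: "part_imm X Y" and S: "X \<in> S" "Y \<in> S"
  shows "par S X Y \<or> covers S Y X"
proof -
  have XY: "part_le X Y" "X \<noteq> Y" "\<And>Z. \<lbrakk>Z \<in> S; part_le X Z; Z \<noteq> X\<rbrakk> \<Longrightarrow> part_le Y Z"
    using part_imm_iff[OF S] i by blast+
  have above: "part_le Y C" if "C \<in> S" "below X C" for C
    using XY(3) below_part_le that S not_below_self by blast
  show ?thesis
  proof (cases "below X Y")
    case True
    have False if "C \<in> S" "below X C" "below C Y" for C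
      using above[OF that(1,2)] below_part_le[OF that(3,1) S(2)] part_le_antisym[of C Y] that S not_below_self
      by blast
    then show ?thesis using True S by (auto simp: covers_def)
  next
    case False
    have "c \<notin> segment x y"
      if C: "C \<in> S" "below X C \<or> below Y C" and xy: "x \<in> X" "y \<in> Y" and c: "c \<in> C" for C x y c
    proof
      assume "c \<in> segment x y"
      have "C \<noteq> Y" using False not_below_self C by blast
      have "part_le Y C" using above below_part_le C S by blast
      moreover have "le c y"
        using convex[of x y c] part_leD[OF XY(1) S xy] \<open>c \<in> segment x y\<close> in_V S xy C c by blast
      ultimately show False using part_le_antisym part_leI c xy C S \<open>C \<noteq> Y\<close> by blast
    qed
    then show ?thesis unfolding par_def by blast
  qed
qed

lemma rooted_tree_imm:
  assumes P: "P \<subseteq> S" "R \<in> P" "\<And>X. X \<in> P \<Longrightarrow> part_le X R"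
    and step: "\<And>X Y. \<lbrakk>X \<in> P; X \<noteq> R; Y \<in> S; part_imm X Y\<rbrakk> \<Longrightarrow> Y \<in> P"
  shows "rooted_tree P {arrow Y X | X Y. X \<in> P \<and> Y \<in> P \<and> part_imm X Y}"
proof -
  define p where "p X = (SOME Y. Y \<in> S \<and> part_imm X Y)" for X
  have p: "p X \<in> S \<and> part_imm X (p X)" if X: "X \<in> P - {R}" for X
  proof -
    have "X \<in> S" "R \<in> S" "part_le X R" "X \<noteq> R" using X P by blast+
    then obtain Y where "Y \<in> S" "part_imm X Y" by (metis part_imm_exists)
    then have "\<exists>Y. Y \<in> S \<and> part_imm X Y" by blast
    then show ?thesis unfolding p_def by (rule someI_ex)
  qed
  have pP: "p X \<in> P \<and> depth (p X) < depth X" if X: "X \<in> P - {R}" for X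
  proof -
    have "X \<in> S" using X P by blast
    then show ?thesis
      using p[OF X] step[of X "p X"] X depth_less[of X "p X"] part_imm_iff[of X "p X"] by blast
  qed
  have "\<not> part_imm R Y" if "Y \<in> P" for Y
    using part_imm_iff[of R Y] P that part_le_antisym[of R Y] by blast
  then have eq: "{arrow Y X | X Y. X \<in> P \<and> Y \<in> P \<and> part_imm X Y} = (\<lambda>X. arrow (p X) X) ` (P - {R})"
    using p pP part_imm_unique P(1) by blast
  have "finite P" using finite_S P finite_subset by blast
  then show ?thesis unfolding eq using rooted_treeI[OF _ P(2) pP] by blast
qed

text \<open>Take a member \<open>R\<close> of least depth. If it is not the top of everything, its
  parent \<open>Y\<close> is not parallel to it, hence covers it. Every parallel part then lies
  between \<open>R\<close> and an end of \<open>Y\<close> with no element of \<open>Y\<close>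
  nearer, so \<open>part_imm_between\<close> puts it below \<open>R\<close>.\<close>

lemma par_class_root:
  assumes X: "X \<in> S"
  obtains R where "R \<in> S" "par S X R" "\<And>Y. Y \<in> S \<Longrightarrow> par S X Y \<Longrightarrow> part_le Y R"
proof -
  obtain R where R: "R \<in> S \<and> par S X R" "\<And>Y. Y \<in> S \<and> par S X Y \<Longrightarrow> depth R \<le> depth Y"
    using ex_has_least_nat[of "\<lambda>R. R \<in> S \<and> par S X R" X depth] X par_refl by blast
  have "part_le Z R" if Z: "Z \<in> S" "par S X Z" for Z
  proof (cases "\<exists>t\<in>R. \<forall>v\<in>V. le v t")
    case True
    then show ?thesis using part_nonempty Z in_V part_leI by blast
  next
    case False
    obtain r where r: "r \<in> R" using part_nonempty R by blast
    obtain t where t: "t \<in> V" "\<And>v. v \<in> V \<Longrightarrow> le v t" using top_exists nonempty by blast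
    obtain T where T: "T \<in> S" "t \<in> T" using partE t by blast
    have "T \<noteq> R" using False T t by blast
    moreover have "part_le R T" using part_leI[OF t(2) r T(2)] in_V R(1) r by blast
    ultimately obtain Y where Y: "Y \<in> S" "part_imm R Y" using part_imm_exists R T by blast
    have nR: "\<not> par S R Y"
    proof
      assume "par S R Y"
      then have "depth R \<le> depth Y" using R(2) Y par_trans R(1) X by blast
      then show False using depth_less[of R Y] part_imm_iff[of R Y] Y R(1) by fastforce
    qed
    then have "covers S Y R" using part_imm_edge Y R by blast
    then have b: "below R Y" by (simp add: covers_def)
    have RZ: "par S R Z" using par_trans[of R X Z] R Z X par_sym by blast
    obtain z where z: "z \<in> Z" using part_nonempty Z by blast
    obtain y0 y1 where y01: "y0 \<in> Y" "y1 \<in> Y" "\<And>r. r \<in> R \<Longrightarrow> y0 < r" "\<And>r. r \<in> R \<Longrightarrow> r < y1"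
      using belowE[OF _ Y(1) b] R by metis
    have "Y \<inter> segment r z = {}" using RZ Y b r z unfolding par_def by blast
    then have "y0 \<notin> segment r z" "y1 \<notin> segment r z" using y01 by blast+
    then have "z \<in> segment r y0 \<or> z \<in> segment r y1"
      using y01(3,4)[OF r] by (auto simp: in_segment_iff)
    then show ?thesis
      using part_imm_between[OF Y(2) _ Y(1) Z(1) r _ z] y01 R \<open>Y \<inter> segment r z = {}\<close> by blast
  qed
  then show ?thesis using that R by blast
qed

definition class_tree :: "'a set set \<Rightarrow> ('a set \<Rightarrow>\<^sub>0 int) set" where
  "class_tree P = {arrow Y X | X Y. X \<in> P \<and> Y \<in> P \<and> part_imm X Y}"

lemma arrow_in_class_tree: "\<lbrakk>arrow Y X \<in> class_tree P; P \<subseteq> S; X \<noteq> Y\<rbrakk> \<Longrightarrow> X \<in> P \<and> Y \<in> P \<and> part_imm X Y"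
  unfolding class_tree_def using arrow_eq_iff[of X Y] by auto

lemma binary_tree_class:
  assumes X: "X \<in> S" and P: "P = {Y \<in> S. par S X Y}"
  shows "binary_tree left_of P (class_tree P)"
proof -
  have PS: "P \<subseteq> S" using P by blast
  have parP: "par S Y Z" if "Y \<in> P" "Z \<in> P" for Y Z
    using that P par_trans[of Y X Z] par_sym X by blast
  obtain R where R: "R \<in> P" "\<And>Y. Y \<in> P \<Longrightarrow> part_le Y R"
  proof -
    obtain R where "R \<in> S" "par S X R" "\<And>Y. Y \<in> S \<Longrightarrow> par S X Y \<Longrightarrow> part_le Y R"
      using par_class_root[OF X] by blast
    then show ?thesis using that P by simp
  qed
  \<comment> \<open>A parent outside the class covers \<open>Z\<close>, so it is vertically above
    the whole class, including \<open>U\<close>, and cannot be below \<open>U\<close> in the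
    tree.\<close>
  have step: "Y \<in> P" if "Z \<in> P" "Y \<in> S" "part_imm Z Y" "part_le Y U" "U \<in> P" for U Y Z
  proof (rule ccontr)
    assume n: "Y \<notin> P"
    then have "\<not> par S Z Y" using that P par_trans[of X Z Y] X by blast
    then have b: "below Z Y" using part_imm_edge[OF that(3)] that PS by (auto simp: covers_def)
    then have b: "below U Y" using par_below[OF parP[OF that(1,5)]] that PS by blast
    then have "part_le U Y" using below_part_le that PS by blast
    then have "U = Y" using part_le_antisym that PS by blast
    then show False using b not_below_self by blast
  qed
  have rooted: "rooted_tree P (class_tree P)"
    unfolding class_tree_def
  proof (rule rooted_tree_imm[OF PS R])
    show "Y \<in> P" if Z: "Z \<in> P" "Z \<noteq> R" "Y \<in> S" "part_imm Z Y" for Z Y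
    proof -
      have "part_le Y R" using part_imm_iff[of Z Y] Z R PS by blast
      then show ?thesis using step Z R by blast
    qed
  qed
  have ne: "Z \<noteq> Y" if "arrow Y Z \<in> class_tree P" for Y Z
    using that rooted arrow_not_in_independent
    unfolding rooted_tree_def directed_tree_def directed_forest_def by metis
  have imm: "Z \<in> P \<and> Y \<in> P \<and> part_imm Z Y" if "arrow Y Z \<in> class_tree P" for Y Z
    using arrow_in_class_tree[OF that PS] ne[OF that] by blast
  have path: "tree_le (class_tree P) Z U" if "Z \<in> P" "U \<in> P" "part_le Z U" for Z U
    using that
  proof (induction "depth Z" arbitrary: Z rule: less_induct)
    case less
    show ?case
    proof (cases "Z = U")
      case False
      then obtain Y where Y: "Y \<in> S" "part_imm Z Y" "part_le Y U"
        using part_imm_exists less.prems PS by blast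
      then have "Y \<in> P" using step less.prems by blast
      moreover have "depth Y < depth Z"
        using depth_less[of Z Y] part_imm_iff[of Z Y] Y less.prems PS by blast
      ultimately have "tree_le (class_tree P) Y U" using less Y by blast
      moreover have "arrow Y Z \<in> class_tree P"
        using Y \<open>Y \<in> P\<close> less.prems by (auto simp: class_tree_def)
      ultimately show ?thesis
        unfolding tree_le_def by (auto intro: converse_rtrancl_into_rtrancl)
    qed (simp add: tree_le_def)
  qed
  have lat: "left_of Y Z \<or> left_of Z Y" if "Y \<in> P" "Z \<in> P" "Y \<noteq> Z" for Y Z
    using par_lateral parP that PS by blast
  have mid: "part_le Z Y" if "Y \<in> P" "U \<in> P" "Z \<in> P" "part_imm Y U"
    "strictly_between left_of Y U Z" for Y U Z
  proof -
    have "Y \<in> S" "U \<in> S" "Z \<in> S" using that PS by blast+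
    then obtain y u z where yuz: "y \<in> Y" "u \<in> U" "z \<in> Z" using part_nonempty by (metis ex_in_conv)
    have "z \<in> segment y u" "U \<inter> segment y z = {}"
      using that(5) yuz unfolding strictly_between_def left_of_def
      by (force simp: in_segment_iff)+
    then show ?thesis using part_imm_between[OF that(4), of Z y u z] that PS yuz by blast
  qed
  have asym: "\<not> left_of Z Y" if "left_of Y Z" "Y \<in> P" "Z \<in> P" for Y Z
    using that PS part_nonempty unfolding left_of_def by (meson ex_in_conv order.asym subsetD)
  \<comment> \<open>Of two children on the same side of \<open>U\<close>, the nearer one lies
    between the other and \<open>U\<close>, so it is below the other in the tree; its parent
    \<open>U\<close> would then be below a child of \<open>U\<close>.\<close>
  have sides: "strictly_between left_of Y Z U"
    if U: "Y \<in> children P (class_tree P) U" "Z \<in> children P (class_tree P) U" "Y \<noteq> Z" for Y Z U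
  proof (rule ccontr)
    assume n: "\<not> strictly_between left_of Y Z U"
    have i: "Y \<in> P" "Z \<in> P" "U \<in> P" "part_imm Y U" "part_imm Z U" "Y \<noteq> U" "Z \<noteq> U"
      using U imm ne unfolding children_def by blast+
    have "strictly_between left_of Y U Z \<or> strictly_between left_of Z U Y"
      using n lat[OF i(1,2) U(3)] lat[OF i(1,3,6)] lat[OF i(2,3,7)] unfolding strictly_between_def
        by blast
    then have "part_le Z Y \<or> part_le Y Z" using mid i by blast
    then have "part_le U Y \<or> part_le U Z"
      using part_imm_iff i(4,5) i(1-3) PS U(3) by (metis subsetD)
    moreover have "part_le Y U" "part_le Z U" using part_imm_iff i PS by (metis subsetD)+
    ultimately show False using part_le_antisym i PS by (metis subsetD)
  qed
  have "card (children P (class_tree P) U) \<le> 2" for U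
  proof (rule ccontr)
    assume "\<not> ?thesis"
    then have "3 \<le> card (children P (class_tree P) U)" by simp
    then obtain D where "D \<subseteq> children P (class_tree P) U" "card D = 3"
      using obtain_subset_with_card_n by metis
    then obtain A B C where D: "A \<in> children P (class_tree P) U" "B \<in> children P (class_tree P) U"
      "C \<in> children P (class_tree P) U" "A \<noteq> B" "A \<noteq> C" "B \<noteq> C"
      by (auto simp: card_3_iff)
    then have in_P: "A \<in> P" "B \<in> P" "C \<in> P" "U \<in> P"
      using imm unfolding children_def by blast+
    \<comment> \<open>Among three children, two lie on the same side of \<open>U\<close>.\<close>
    then show False
      using sides[OF D(1,2,4)] sides[OF D(1,3,5)] sides[OF D(2,3,6)] asym
      unfolding strictly_between_def by blast
  qed
  moreover have "tree_less (class_tree P) Z Y"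
    if "Y \<in> P" "U \<in> P" "arrow U Y \<in> class_tree P" "Z \<in> P" "strictly_between left_of Y U Z" for Y U Z
  proof -
    have "Z \<noteq> Y" using that(5) asym[of Y Y] that(1) asym[of Y U] unfolding strictly_between_def
      by blast
    moreover have "part_le Z Y" using mid that imm by blast
    ultimately show ?thesis using path that unfolding tree_less_def by blast
  qed
  ultimately show ?thesis using rooted sides unfolding binary_tree_def by blast
qed

lemma generated_by_search_order:
  shows "\<exists>F. binary_forest S F \<and> generated_tree S F (order_tree V S le)"
proof -
  have "S \<noteq> {}" using nonempty partition by (auto simp: partition_on_def)
  define F where "F = (\<Union>P\<in>{P. parallel_set S P}. class_tree P)"
  have "binary_forest S F"
    unfolding binary_forest_def F_def parallel_set_iff[OF \<open>S \<noteq> {}\<close>]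
    using binary_tree_class by blast
  moreover have T: "order_tree V S le = {arrow Y X | X Y. X \<in> S \<and> Y \<in> S \<and> part_imm X Y}"
    by (auto simp: order_tree_def part_imm_def)
  obtain t where t: "t \<in> V" "\<And>v. v \<in> V \<Longrightarrow> le v t" using top_exists nonempty by blast
  obtain R where R: "R \<in> S" "t \<in> R" using partE t by blast
  have "rooted_tree S (order_tree V S le)"
    unfolding T
  proof (rule rooted_tree_imm[OF _ R(1)])
    show "part_le X R" if "X \<in> S" for X using part_nonempty[OF that] in_V[OF that] t R part_leI
      by blast
  qed auto
  moreover have "F \<subseteq> order_tree V S le"
    unfolding F_def T class_tree_def parallel_set_def by blast
  moreover have "order_tree V S le \<subseteq> edges S"
  proof
    fix e assume "e \<in> order_tree V S le"
    then obtain X Y where XY: "e = arrow Y X" "X \<in> S" "Y \<in> S" "part_imm X Y" by (auto simp: T)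
    then show "e \<in> edges S" using edges_iff[of X Y] part_imm_edge[of X Y] part_imm_iff[of X Y]
      by blast
  qed
  ultimately show ?thesis unfolding generated_tree_def by blast
qed

end

section \<open>From binary forests to search orders\<close>

locale forest_tree = nc_partition V S
  for V :: "'a::linorder set" and S :: "'a set set" +
  fixes F T :: "('a set \<Rightarrow>\<^sub>0 int) set"
  assumes nonempty: "V \<noteq> {}"
    and forest: "binary_forest S F"
    and generated: "generated_tree S F T"
begin

lemma S_nonempty: "S \<noteq> {}"
  using nonempty partition by (auto simp: partition_on_def)

text \<open>The order is the tree order of \<open>T\<close>, pulled back to elements. The delicate
  clause is the largest element of an interval. It comes from comparability of neighbouring
  elements, which rests on the fact that two children of a part are separated by an element of that
  part.\<close>

lemma search_order_exists: "\<exists>le. search_order V S le \<and> order_tree V S le = T"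
proof -
  have rooted: "rooted_tree S T" and FT: "F \<subseteq> T" and TE: "T \<subseteq> edges S"
    using generated by (auto simp: generated_tree_def)
  obtain r p d where "parent_tree S r p d T" using rooted_treeD[OF rooted] by blast
  then interpret parent_tree S r p d T .
  obtain B where B: "\<And>P. parallel_set S P \<Longrightarrow> binary_tree left_of P (B P)"
    "F = (\<Union>P\<in>{P. parallel_set S P}. B P)"
    using forest unfolding binary_forest_def by blast
  define cls where "cls X = {Y \<in> S. par S X Y}" for X
  have cls: "parallel_set S (cls X)" "B (cls X) \<subseteq> T" "binary_tree left_of (cls X) (B (cls X))"
    if "X \<in> S" for X
    using parallel_set_iff[OF S_nonempty] that B FT unfolding cls_def by blast+
  have cls_eq: "cls X = cls Y" if "X \<in> S" "Y \<in> S" "par S X Y" for X Y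
    using that par_trans par_sym unfolding cls_def by blast
  have self: "X \<in> cls X" if "X \<in> S" for X using that par_refl by (simp add: cls_def)
  have edge: "par S X (p X) \<or> covers S (p X) X" if "X \<in> S - {r}" for X
    using edges_iff[of X "p X"] parent[OF that] arrow_iff[of "p X" X] TE that by blast
  define is_rt where "is_rt X R \<longleftrightarrow> R \<in> cls X \<and> (\<forall>Y\<in>cls X. tree_le T Y R) \<and>
      (\<forall>Y\<in>cls X - {R}. Y \<noteq> r \<and> p Y \<in> cls X \<and> arrow (p Y) Y \<in> B (cls X)) \<and>
      (R = r \<or> covers S (p R) R)" for X R
  have ex_rt: "\<exists>R. is_rt X R" if X: "X \<in> S" for X
  proof -
    have rootB: "rooted_tree (cls X) (B (cls X))" using cls(3)[OF X] by (simp add: binary_tree_def)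
    obtain R q e where "parent_tree (cls X) R q e (B (cls X))"
      using rooted_treeD[OF rootB] by blast
    then have R: "R \<in> cls X" and q: "\<And>x. x \<in> cls X - {R} \<Longrightarrow> q x \<in> cls X \<and> q x \<noteq> x \<and> e (q x) < e x"
      and Beq: "B (cls X) = (\<lambda>x. arrow (q x) x) ` (cls X - {R})"
      unfolding parent_tree_def by blast+
    have pq: "Y \<noteq> r" "p Y = q Y" "arrow (q Y) Y \<in> B (cls X)" if "Y \<in> cls X - {R}" for Y
    proof -
      show "arrow (q Y) Y \<in> B (cls X)" using that Beq by blast
      then have "arrow (q Y) Y \<in> T" using cls(2)[OF X] by blast
      then show "Y \<noteq> r" "p Y = q Y" using arrow_iff by blast+
    qed
    have "tree_le T Y R" if "Y \<in> cls X" for Y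
      using parent_reaches_root[of "cls X" R q e Y T] q pq(3) cls(2)[OF X] that by blast
    \<comment> \<open>A parallel parent would belong to the class and hence lie below its root
      \<open>R\<close>.\<close>
    moreover have "covers S (p R) R" if "R \<noteq> r"
    proof (rule ccontr)
      assume n: "\<not> ?thesis"
      have RS: "R \<in> S" "R \<in> S - {r}" using R that by (auto simp: cls_def)
      then have "par S R (p R)" "p R \<in> S" using edge n parent by blast+
      then have "p R \<in> cls X" using R par_trans[of X R "p R"] X RS by (auto simp: cls_def)
      then have "tree_le T (p R) R" using calculation by blast
      then show False using le_parent[OF RS(2)] le_antisym parent[OF RS(2)] by metis
    qed
    ultimately show ?thesis
      unfolding is_rt_def using R pq q by (intro exI[of _ R]) auto
  qed
  define rt where "rt X = (SOME R. is_rt X R)" for X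
  have rt: "is_rt X (rt X)" if "X \<in> S" for X unfolding rt_def using ex_rt[OF that]
    by (rule someI_ex)
  have rt_eq: "rt X = rt Y" if "X \<in> S" "Y \<in> S" "par S X Y" for X Y
    using cls_eq[OF that] by (simp add: rt_def is_rt_def)
  have rtS: "rt X \<in> S" "par S X (rt X)" "tree_le T X (rt X)" "rt X = r \<or> covers S (p (rt X)) (rt X)"
    if "X \<in> S" for X
    using rt[OF that] self[OF that] by (auto simp: is_rt_def cls_def)
  have non_rt: "X \<noteq> r" "p X \<in> S" "par S X (p X)" "arrow (p X) X \<in> B (cls X)" if "X \<in> S" "X \<noteq> rt X"
    for X
    using rt[OF that(1)] self[OF that(1)] that by (auto simp: is_rt_def cls_def)
  have B_le: "tree_le T Z Y" if "tree_less (B (cls X)) Z Y" "X \<in> S" for X Y Z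
  proof -
    have "{(x, y). arrow y x \<in> B (cls X)}\<^sup>* \<subseteq> {(x, y). arrow y x \<in> T}\<^sup>*"
      using cls(2)[OF that(2)] by (intro rtrancl_mono) auto
    then show ?thesis using that unfolding tree_less_def tree_le_def by blast
  qed
  \<comment> \<open>For a vertically maximal part, the root of its parallel set has no cover, so it
    is the root of the whole tree.\<close>
  obtain E where E: "E \<in> S" "\<not> (\<exists>C\<in>S. below E C)"
  proof -
    obtain X where "X \<in> S" using S_nonempty by blast
    then obtain E where E: "E \<in> S" "\<And>Y. Y \<in> S \<Longrightarrow> height E \<le> height Y"
      using ex_has_least_nat[of "\<lambda>X. X \<in> S" X height] by blast
    have "\<not> below E C" if "C \<in> S" for C using height_less[OF that, of E] E(2)[OF that] by auto
    then show ?thesis using that E by blast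
  qed
  have rt_E: "rt E = r"
  proof (rule ccontr)
    assume "rt E \<noteq> r"
    then have "covers S (p (rt E)) (rt E)" using rtS[OF E(1)] by blast
    then have "below (rt E) (p (rt E))" "p (rt E) \<in> S" by (auto simp: covers_def)
    then show False using E par_below[of "rt E" E] rtS[OF E(1)] par_sym by blast
  qed
  have r_top: "\<not> below r C" if "C \<in> S" for C
    using E par_below[of r E C] rtS[OF E(1)] par_sym rt_E that root by blast
  \<comment> \<open>The path from \<open>X\<close> runs up its parallel set to \<open>rt X\<close>
    and then to the part that covers the whole set, which is the cover of \<open>X\<close>.\<close>
  have vertical: "tree_le T X C" if "below X C" "X \<in> S" "C \<in> S" for X C
    using that
  proof (induction "height X" arbitrary: X rule: less_induct)
    case less
    obtain D where D: "covers S D X" "D = C \<or> below D C" using cover_exists less.prems by blast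
    have DS: "D \<in> S" "below X D" using D by (auto simp: covers_def)
    have "below (rt X) D" using par_below rtS[OF less.prems(2)] less.prems DS by blast
    then have "rt X \<noteq> r" using r_top DS by blast
    then have cov: "covers S (p (rt X)) (rt X)" using rtS less.prems by blast
    then have P: "p (rt X) \<in> S" "below (rt X) (p (rt X))" by (auto simp: covers_def)
    have "covers S (p (rt X)) X"
    proof -
      have "below X (p (rt X))"
        using par_below[of "rt X" X] rtS[OF less.prems(2)] P par_sym less.prems by blast
      moreover have "\<not> below E (p (rt X))" if "E \<in> S" "below X E" for E
        using cov par_below[of X "rt X" E] rtS[OF less.prems(2)] that less.prems
          unfolding covers_def by blast
      ultimately show ?thesis using P less.prems by (auto simp: covers_def)
    qed
    then have "p (rt X) = D" using D cover_unique by blast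
    then have "tree_le T X D"
      using rtS[OF less.prems(2)] le_parent[of "rt X"] \<open>rt X \<noteq> r\<close> le_trans by blast
    moreover have "D = C \<or> tree_le T D C"
      using D less.hyps[of D] height_less[of D X] DS less.prems by blast
    ultimately show ?case using le_trans by blast
  qed
  have side: "strictly_between left_of X Y Z"
    if "par S X Y" "par S X Z" "X \<in> S" "Y \<in> S" "Z \<in> S" "Z \<noteq> X" "Z \<noteq> Y" "x \<in> X" "y \<in> Y" "z \<in> Z"
      "z \<in> segment x y" for X Y Z x y z
  proof -
    have "par S Y Z" using par_trans[of Y X Z] that par_sym by blast
    then have "left_of X Z \<or> left_of Z X" "left_of Y Z \<or> left_of Z Y"
      using par_lateral that by blast+
    moreover have "\<not> (left_of X Z \<and> left_of Y Z)" "\<not> (left_of Z X \<and> left_of Z Y)"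
    proof -
      have "\<not> (x < z \<and> y < z)" "\<not> (z < x \<and> z < y)" using that(11) by (auto simp: in_segment_iff)
      then show "\<not> (left_of X Z \<and> left_of Y Z)" "\<not> (left_of Z X \<and> left_of Z Y)"
        using that(8-10) unfolding left_of_def by blast+
    qed
    ultimately show ?thesis unfolding strictly_between_def by blast
  qed
  \<comment> \<open>A part strictly between \<open>X\<close> and its parallel parent is below
    \<open>X\<close> by condition (i) if it is parallel to them; otherwise it lies under a part of
    smaller \<open>height\<close> that also meets the segment.\<close>
  have lateral_edge: "tree_le T Z (p X)"
    if ass: "X \<in> S" "X \<noteq> rt X" "x \<in> X" "y \<in> p X" "Z \<in> S" "z \<in> Z" "z \<in> segment x y" for X x y Z z
    using ass(5-7)
  proof (induction "height Z" arbitrary: Z z rule: less_induct)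
    case less
    note nr = non_rt[OF ass(1,2)]
    show ?case
    proof (cases "par S X Z")
      case True
      show ?thesis
      proof (cases "Z = X \<or> Z = p X")
        case True
        then show ?thesis using le_refl le_parent[of X] ass nr by blast
      next
        case False
        then have "strictly_between left_of X (p X) Z"
          using side[OF nr(3) \<open>par S X Z\<close> ass(1) nr(2)] less.prems ass by blast
        moreover have "X \<in> cls X" "p X \<in> cls X" "Z \<in> cls X"
          using self ass nr True less.prems \<open>par S X Z\<close> by (auto simp: cls_def)
        ultimately have "tree_less (B (cls X)) Z X"
          using cls(3)[OF ass(1)] nr(4) unfolding binary_tree_def by blast
        then have "tree_le T Z X" using B_le ass by blast
        then show ?thesis using le_parent[of X] le_trans ass nr by blast
      qed
    next
      case False
      obtain C where C: "C \<in> S" "below Z C" "C \<inter> segment x y \<noteq> {}"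
        using par_between[OF nr(3) ass(1) nr(2) less.prems(1) ass(3,4) less.prems(2,3) False]
          by blast
      then obtain c where "c \<in> C" "c \<in> segment x y" by blast
      then have "tree_le T C (p X)" using less.hyps[of C c] height_less C by blast
      then show ?thesis using vertical C less.prems le_trans by blast
    qed
  qed
  have edge_convex: "tree_le T Z (p X)"
    if ass: "X \<in> S - {r}" "x \<in> X" "y \<in> p X" "Z \<in> S" "z \<in> Z" "z \<in> segment x y" for X x y Z z
  proof (cases "X = rt X")
    case True
    then have cov: "covers S (p X) X" using rtS[of X] ass by auto
    then have b: "below X (p X)" "p X \<in> S" by (auto simp: covers_def)
    obtain y0 y1 where y01: "y0 \<in> p X" "y1 \<in> p X" "y0 < x" "x < y1"
      using belowE[OF _ b(2,1)] ass by (metis DiffE)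
    have "z \<in> segment y0 y \<or> z \<in> segment y y1"
      using y01 ass(6) by (auto simp: in_segment_iff)
    then have "Z = p X \<or> below Z (p X)"
      using segment_part[of "p X" Z _ _ z] y01 b ass by blast
    then show ?thesis using vertical b ass le_refl by blast
  qed (use lateral_edge ass in blast)
  define le where "le x y \<longleftrightarrow> (\<exists>X\<in>S. \<exists>Y\<in>S. x \<in> X \<and> y \<in> Y \<and> tree_le T X Y)" for x y
  have le_iff: "le x y \<longleftrightarrow> tree_le T X Y" if "X \<in> S" "Y \<in> S" "x \<in> X" "y \<in> Y" for x y X Y
    using that part_eq unfolding le_def by metis
  \<comment> \<open>Segments along the path from \<open>X\<close> to \<open>Y\<close> cover the
    segment from \<open>x\<close> to \<open>y\<close>, so some edge of the path, or \<open>Y\<close>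
    itself, accounts for \<open>z\<close>.\<close>
  have convex: "tree_le T Z Y"
    if "tree_le T X Y" "X \<in> S" "Y \<in> S" "Z \<in> S" "x \<in> X" "y \<in> Y" "z \<in> Z" "z \<in> segment x y"
      for X Y Z x y z
    using that(1,2,5,8)
  proof (induction "d X" arbitrary: X x rule: less_induct)
    case less
    show ?case
    proof (cases "X = Y")
      case True
      then have "Z = Y \<or> below Z Y" using segment_part[of Y Z x y z] less.prems that by blast
      then show ?thesis using vertical that le_refl by blast
    next
      case False
      then have X: "X \<in> S - {r}" "tree_le T (p X) Y" using le_cases less.prems by blast+
      then have pX: "p X \<in> S" "d (p X) < d X" using parent by blast+
      obtain w where w: "w \<in> p X" using part_nonempty pX by blast
      show ?thesis
      proof (cases "z \<in> segment w y")
        case True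
        then show ?thesis using less.hyps[OF pX(2) X(2) pX(1) w] by blast
      next
        case False
        then have "z \<in> segment x w" using less.prems in_segment_split by blast
        then show ?thesis using edge_convex[OF X(1) less.prems(3) w] that X le_trans by blast
      qed
    qed
  qed
  \<comment> \<open>Two covered children are not parallel, as each is the root of its parallel set,
    so an element of the parent lies between them. Two lateral children are separated by condition
    (iii). In the mixed case the parent encloses one child and lies beside the other.\<close>
  have separated: "\<exists>m\<in>p X. \<exists>x\<in>X. \<exists>y\<in>Y. m \<in> segment x y"
    if XY: "X \<in> S - {r}" "Y \<in> S - {r}" "X \<noteq> Y" "p X = p Y" for X Y
  proof -
    have pS: "p X \<in> S" "p X \<noteq> X" "p X \<noteq> Y" using parent XY by metis+
    obtain x y m where xym: "x \<in> X" "y \<in> Y" "m \<in> p X"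
      using part_nonempty pS XY by (metis DiffE ex_in_conv)
    have mixed: "\<exists>m\<in>M. m \<in> segment u w"
      if ass: "covers S M U" "par S W M" "U \<in> S" "W \<in> S" "M \<in> S" "M \<noteq> W" "u \<in> U" "w \<in> W"
        for U W M u w
    proof -
      have "below U M" using ass by (simp add: covers_def)
      then obtain m0 m1 where m: "m0 \<in> M" "m1 \<in> M" "m0 < u" "u < m1"
        using belowE[of U M] ass by metis
      have "left_of W M \<or> left_of M W" using par_lateral[of W M] ass by blast
      then show ?thesis
      proof
        assume "left_of W M"
        then have "w < m0" using m ass by (simp add: left_of_def)
        then show ?thesis using m by (intro bexI[of _ m0]) (auto simp: in_segment_iff)
      next
        assume "left_of M W"
        then have "m1 < w" using m ass by (simp add: left_of_def)
        then show ?thesis using m by (intro bexI[of _ m1]) (auto simp: in_segment_iff)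
      qed
    qed
    show ?thesis
    proof (cases "X = rt X"; cases "Y = rt Y")
      assume "X = rt X" "Y = rt Y"
      then have cov: "covers S (p X) X" "covers S (p X) Y" using rtS[of X] rtS[of Y] XY by auto
      have "\<not> par S X Y" using rt_eq[of X Y] \<open>X = rt X\<close> \<open>Y = rt Y\<close> XY by auto
      then have "\<not> parallel_parts S X Y" using parallel_iff by blast
      then obtain c where c: "c \<in> p X" "element_between X Y c"
        using cov pS XY unfolding parallel_parts_def by blast
      then have "x < c \<and> c < y \<or> y < c \<and> c < x"
        using xym unfolding element_between_def by blast
      then have "c \<in> segment x y" by (auto simp: in_segment_iff)
      then show ?thesis using c xym by blast
    next
      assume "X = rt X" "Y \<noteq> rt Y"
      then have "covers S (p X) X" "par S Y (p X)" using rtS[of X] non_rt[of Y] XY by auto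
      then show ?thesis using mixed[of "p X" X Y x y] pS XY xym by blast
    next
      assume "X \<noteq> rt X" "Y = rt Y"
      then have "covers S (p X) Y" "par S X (p X)" using rtS[of Y] non_rt[of X] XY by auto
      then show ?thesis using mixed[of "p X" Y X y x] pS XY xym by (auto simp: segment_commute)
    next
      assume "X \<noteq> rt X" "Y \<noteq> rt Y"
      then have nX: "par S X (p X)" "arrow (p X) X \<in> B (cls X)"
        and nY: "par S Y (p X)" "arrow (p X) Y \<in> B (cls Y)"
        using non_rt[of X] non_rt[of Y] XY by auto
      have "par S X Y" using par_trans[of X "p X" Y] nX nY par_sym pS XY by blast
      then have "cls Y = cls X" using cls_eq XY by blast
      then have "X \<in> children (cls X) (B (cls X)) (p X)" "Y \<in> children (cls X) (B (cls X)) (p X)"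
        "p X \<in> cls X"
        using nX nY self XY pS \<open>par S X Y\<close> by (auto simp: children_def cls_def)
      then have "strictly_between left_of X Y (p X)"
        using cls(3)[of X] XY unfolding binary_tree_def by blast
      then have "m \<in> segment x y"
        using xym unfolding strictly_between_def left_of_def by (force simp: in_segment_iff)
      then show ?thesis using xym by blast
    qed
  qed
  \<comment> \<open>If \<open>u\<close> and \<open>v\<close> are incomparable, an element of their
    lowest common ancestor \<open>M\<close> separates the two children of \<open>M\<close> above
    them. Since \<open>M\<close> is not below these children, convexity places that element between
    \<open>u\<close> and \<open>v\<close>.\<close>
  have adjacent: "le u v \<or> le v u"
    if uv: "u \<in> V" "v \<in> V" "\<And>w. w \<in> V \<Longrightarrow> w \<in> segment u v \<Longrightarrow> w = u \<or> w = v" for u v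
  proof (rule ccontr)
    assume n: "\<not> (le u v \<or> le v u)"
    obtain U W where UW: "U \<in> S" "u \<in> U" "W \<in> S" "v \<in> W" using partE uv by metis
    obtain M where M: "M \<in> S" "tree_le T U M" "tree_le T W M"
      "\<And>c. \<lbrakk>c \<in> S; tree_le T U c; tree_le T W c\<rbrakk> \<Longrightarrow> d c \<le> d M"
      using common_bound[OF UW(1,3) finite_S] by metis
    have neM: "U \<noteq> M" "W \<noteq> M" using n le_iff UW M by blast+
    obtain X where X: "X \<in> S - {r}" "p X = M" "tree_le T U X" using le_child M neM by metis
    obtain Y where Y: "Y \<in> S - {r}" "p Y = M" "tree_le T W Y" using le_child M neM by metis
    have "X \<noteq> Y" using M(4)[of X] X Y parent[OF X(1)] by auto
    then obtain m x y where m: "m \<in> M" "x \<in> X" "y \<in> Y" "m \<in> segment x y"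
      using separated[OF X(1) Y(1)] X Y by auto
    have nle: "\<not> tree_le T M X" "\<not> tree_le T M Y"
      using le_d[of M X] le_d[of M Y] parent[OF X(1)] parent[OF Y(1)] X(2) Y(2) by auto
    have "m \<notin> segment u x" using convex[OF X(3) UW(1) _ M(1) UW(2) m(2,1)] nle X by blast
    moreover have "m \<notin> segment v y" using convex[OF Y(3) UW(3) _ M(1) UW(4) m(3,1)] nle Y by blast
    ultimately have "m \<in> segment u v"
      using in_segment_split[OF m(4), of u] in_segment_split[of m u y v]
      by (auto simp: segment_commute)
    then have "m = u \<or> m = v" using uv(3) M(1) m part_subset by blast
    then show False using neM part_eq[OF M(1)] UW m(1) by blast
  qed
  have le_tr: "le x z" if "le x y" "le y z" for x y z
  proof -
    obtain X Y where XY: "X \<in> S" "Y \<in> S" "x \<in> X" "y \<in> Y" "tree_le T X Y" using \<open>le x y\<close>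
      by (auto simp: le_def)
    obtain Y' Z where YZ: "Y' \<in> S" "Z \<in> S" "y \<in> Y'" "z \<in> Z" "tree_le T Y' Z" using \<open>le y z\<close>
      by (auto simp: le_def)
    have "Y' = Y" using part_eq XY YZ by blast
    then show ?thesis using XY YZ le_trans unfolding le_def by blast
  qed
  have le_rf: "le x x" if "x \<in> V" for x
    using partE[OF that] le_refl unfolding le_def by metis
  have le_cmp: "le y z \<or> le z y" if "le x y" "le x z" for x y z
  proof -
    obtain X Y where XY: "X \<in> S" "Y \<in> S" "x \<in> X" "y \<in> Y" "tree_le T X Y" using \<open>le x y\<close>
      by (auto simp: le_def)
    obtain X' Z where XZ: "X' \<in> S" "Z \<in> S" "x \<in> X'" "z \<in> Z" "tree_le T X' Z" using \<open>le x z\<close>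
      by (auto simp: le_def)
    have "X' = X" using part_eq XY XZ by blast
    then have "tree_le T Y Z \<or> tree_le T Z Y" using XY XZ le_comparable by blast
    then show ?thesis using le_iff[of Y Z y z] le_iff[of Z Y z y] XY XZ by blast
  qed
  \<comment> \<open>Adding the right end \<open>b\<close>: it is comparable with its left neighbour,
    hence with the previous maximum \<open>c\<close>, and the larger of \<open>b\<close> and
    \<open>c\<close> works.\<close>
  have interval_max: "\<exists>c\<in>V. a \<le> c \<and> c \<le> b \<and> (\<forall>z\<in>V. a \<le> z \<longrightarrow> z \<le> b \<longrightarrow> le z c)"
    if "a \<in> V" "b \<in> V" "a \<le> b" for a b
    using that(2,3)
  proof (induction "card {w \<in> V. a \<le> w \<and> w < b}" arbitrary: b rule: less_induct)
    case less
    define A where "A = {w \<in> V. a \<le> w \<and> w < b}"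
    have finA: "finite A" using finite by (simp add: A_def)
    show ?case
    proof (cases "a = b")
      case True
      then show ?thesis using le_rf that(1) by (intro bexI[of _ a]) auto
    next
      case False
      then have "A \<noteq> {}" using that(1) less.prems by (auto simp: A_def)
      define b' where "b' = Max A"
      have b': "b' \<in> V" "a \<le> b'" "b' < b" "\<And>w. \<lbrakk>w \<in> V; a \<le> w; w < b\<rbrakk> \<Longrightarrow> w \<le> b'"
        using Max_in[OF finA \<open>A \<noteq> {}\<close>] Max_ge[OF finA] unfolding b'_def by (auto simp: A_def)
      have "{w \<in> V. a \<le> w \<and> w < b'} \<subset> A"
        using b' by (auto simp: A_def)
      then have "card {w \<in> V. a \<le> w \<and> w < b'} < card A" using finA
        by (rule psubset_card_mono[rotated])
      then obtain c where c: "c \<in> V" "a \<le> c" "c \<le> b'" "\<And>z. \<lbrakk>z \<in> V; a \<le> z; z \<le> b'\<rbrakk> \<Longrightarrow> le z c"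
        using less.hyps[of b'] b' unfolding A_def by blast
      have step: "z = b \<or> z \<le> b'" if "z \<in> V" "a \<le> z" "z \<le> b" for z
        using that b'(4)[of z] by (cases "z = b") auto
      have "le b' b \<or> le b b'"
      proof (rule adjacent)
        show "w = b' \<or> w = b" if "w \<in> V" "w \<in> segment b' b" for w
        proof -
          have "b' \<le> w" "w \<le> b" using that b'(3) by (auto simp: in_segment_iff)
          then show ?thesis using step[of w] b'(2) that(1) by auto
        qed
      qed (fact b' less.prems)+
      moreover have "le b' c" using c b' by blast
      ultimately have "le b c \<or> le c b" using le_tr le_cmp by blast
      then show ?thesis
      proof
        assume bc: "le b c"
        have "le z c" if "z \<in> V" "a \<le> z" "z \<le> b" for z using step[OF that] bc c(4)[of z] that
          by auto
        then show ?thesis using c b' by (intro bexI[of _ c]) auto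
      next
        assume cb: "le c b"
        have "le z b" if "z \<in> V" "a \<le> z" "z \<le> b" for z
          using step[OF that] le_rf[OF that(1)] le_tr[OF c(4)[of z] cb] that by auto
        then show ?thesis using less.prems by (intro bexI[of _ b]) auto
      qed
    qed
  qed
  have "search_order V S le"
    unfolding search_order_def
  proof (intro conjI ballI impI)
    fix x y assume V: "x \<in> V" "y \<in> V"
    obtain X Y where XY: "X \<in> S" "x \<in> X" "Y \<in> S" "y \<in> Y" using partE V by metis
    have "le x y \<and> le y x \<longleftrightarrow> X = Y"
      using le_iff XY le_antisym le_refl by metis
    also have "\<dots> \<longleftrightarrow> same_part S x y"
      using XY part_eq unfolding same_part_def by metis
    finally show "le x y \<and> le y x \<longleftrightarrow> same_part S x y" .
    have "min x y \<in> V" "max x y \<in> V" "min x y \<le> max x y" using V by (auto simp: min_def max_def)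
    from interval_max[OF this]
    show "\<exists>c\<in>V. c \<in> segment x y \<and> (\<forall>z\<in>V. z \<in> segment x y \<longrightarrow> le z c)"
      unfolding segment_def by auto
  next
    fix x y z assume V: "x \<in> V" "y \<in> V" "z \<in> V"
    show "le x z" if "le x y" "le y z" using le_tr that .
    assume xy: "le x y" and z: "z \<in> segment x y"
    obtain X Y Z where *: "X \<in> S" "x \<in> X" "Y \<in> S" "y \<in> Y" "Z \<in> S" "z \<in> Z" using partE V by metis
    then have "tree_le T X Y" using le_iff[of X Y x y] xy by blast
    then have "tree_le T Z Y" using convex[of X Y Z x y z] * z by blast
    then show "le z y" using le_iff[of Z Y z y] * by blast
  qed
  moreover have "order_tree V S le = T"
  proof
    show "T \<subseteq> order_tree V S le"
    proof
      fix e assume "e \<in> T"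
      then obtain X where X: "X \<in> S - {r}" "e = arrow (p X) X" unfolding tree by blast
      have pX: "p X \<in> S" "p X \<noteq> X" using parent X by blast+
      obtain x y where xy: "x \<in> X" "y \<in> p X" using part_nonempty pX X by (metis DiffE ex_in_conv)
      have "le x y" "\<not> le y x" using le_iff xy pX X le_parent le_antisym by (metis DiffE)+
      moreover have "le y z" if "z \<in> V" "le x z" "\<not> le z x" for z
      proof -
        obtain Z where Z: "Z \<in> S" "z \<in> Z" using partE \<open>z \<in> V\<close> by blast
        then have "tree_le T X Z" "Z \<noteq> X" using that le_iff[of X Z x z] le_iff[of Z X z x] xy X
          by auto
        then have "tree_le T (p X) Z" using le_cases[of X Z] by blast
        then show ?thesis using le_iff[of "p X" Z y z] pX xy Z by blast
      qed
      ultimately have "imm V le x y" using xy pX X part_subset by (auto simp: imm_def)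
      then show "e \<in> order_tree V S le" using X pX xy unfolding order_tree_def by blast
    qed
    show "order_tree V S le \<subseteq> T"
    proof
      fix e assume "e \<in> order_tree V S le"
      then obtain X Y x y where e: "e = arrow Y X" "X \<in> S" "Y \<in> S" "x \<in> X" "y \<in> Y" "imm V le x y"
        unfolding order_tree_def by blast
      then have XY: "tree_le T X Y" "X \<noteq> Y" using le_iff le_refl unfolding imm_def by metis+
      then have X: "X \<in> S - {r}" "tree_le T (p X) Y" using le_cases by blast+
      have pX: "p X \<in> S" "p X \<noteq> X" using parent X by blast+
      obtain w where w: "w \<in> p X" using part_nonempty pX by blast
      have "le x w" "\<not> le w x"
        using le_iff[of X "p X" x w] le_iff[of "p X" X w x] e w pX X le_parent[OF X(1)] le_antisym[of X "p X"] by auto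
      then have "le y w" using e(6) part_subset pX w unfolding imm_def by blast
      then have "tree_le T Y (p X)" using le_iff[of Y "p X" y w] e pX w by blast
      then have "Y = p X" using X le_antisym by blast
      then show "e \<in> T" using X e arrow_iff by blast
    qed
  qed
  ultimately show ?thesis by blast
qed

end

section \<open>Compatible edges\<close>

lemma search_order_congD:
  assumes so: "search_order V S le"
    and le: "\<And>x y. x \<in> V \<Longrightarrow> y \<in> V \<Longrightarrow> le' x y \<longleftrightarrow> le x y"
    and same: "\<And>x y. x \<in> V \<Longrightarrow> y \<in> V \<Longrightarrow> same_part S' x y \<longleftrightarrow> same_part S x y"
  shows "search_order V S' le'"
  unfolding search_order_def
proof (intro conjI ballI impI)
  fix x y assume V: "x \<in> V" "y \<in> V"
  show "le' x y \<and> le' y x \<longleftrightarrow> same_part S' x y"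
    using so V unfolding search_order_def le[OF V] le[OF V(2,1)] same[OF V] by blast
  obtain c where "c \<in> V" "c \<in> segment x y" "\<And>z. z \<in> V \<Longrightarrow> z \<in> segment x y \<Longrightarrow> le z c"
    using so V unfolding search_order_def by metis
  then show "\<exists>c\<in>V. c \<in> segment x y \<and> (\<forall>z\<in>V. z \<in> segment x y \<longrightarrow> le' z c)"
    using le by blast
next
  fix x y z assume V: "x \<in> V" "y \<in> V" "z \<in> V"
  show "le' x z" if "le' x y" "le' y z"
    using that so V unfolding search_order_def le[OF V(1,2)] le[OF V(2,3)] le[OF V(1,3)] by blast
  show "le' z y" if "le' x y" "z \<in> segment x y"
    using that so V unfolding search_order_def le[OF V(1,2)] le[OF V(3,2)] by blast
qed

lemma search_order_cong:
  assumes "\<And>x y. x \<in> V \<Longrightarrow> y \<in> V \<Longrightarrow> le x y \<longleftrightarrow> le' x y"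
    and "\<And>x y. x \<in> V \<Longrightarrow> y \<in> V \<Longrightarrow> same_part S x y \<longleftrightarrow> same_part S' x y"
  shows "search_order V S le \<longleftrightarrow> search_order V S' le'"
  using search_order_congD[of V S le le' S'] search_order_congD[of V S' le' le S] assms by blast

lemma imm_cong_order:
  assumes "\<And>x y. x \<in> V \<Longrightarrow> y \<in> V \<Longrightarrow> le x y \<longleftrightarrow> le' x y"
  shows "imm V le x y \<longleftrightarrow> imm V le' x y"
  unfolding imm_def using assms by blast

lemma order_tree_cong:
  assumes "\<And>x y. x \<in> V \<Longrightarrow> y \<in> V \<Longrightarrow> le x y \<longleftrightarrow> le' x y"
  shows "order_tree V S le = order_tree V S le'"
proof -
  have "imm V le = imm V le'" by (intro ext imm_cong_order assms)
  then show ?thesis by (simp add: order_tree_def)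
qed

text \<open>If the top \<open>r\<close> of the block were not below \<open>x\<close>, the parent
  \<open>y\<close> of \<open>x\<close> would be below \<open>r\<close>, hence in the block by
  convexity. So in every tree an edge that leaves a block starts at its top.\<close>

lemma (in block_orders) imm_block_top:
  assumes i: "imm V le x y" and ns: "\<not> same_part R x y" and w: "same_part R x w"
  shows "leT w x"
proof -
  have V: "x \<in> V" "y \<in> V" "le x y" using i by (auto simp: imm_def)
  obtain r where r: "r \<in> V" "same_part R x r" "\<And>w. same_part R x w \<Longrightarrow> le w r"
    using block_topE V by metis
  have "le r x"
  proof (rule ccontr)
    assume n: "\<not> le r x"
    have "le x r" using r V same_R_refl by blast
    then have "le y r" using i n r by (auto simp: imm_def)
    then show False using block_convex[of x y r] V r ns by blast
  qed
  have wV: "w \<in> V" using w V same_R_V by blast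
  have "le w x" using trans[of w r x] r w wV V \<open>le r x\<close> by blast
  then show ?thesis using leT_iff[OF wV same_R_sym[OF w]] by blast
qed

context nc_search_order
begin

lemma forced_le:
  assumes i: "part_imm X Y" and S: "X \<in> S" "Y \<in> S" "Z \<in> S" and f: "forced (X, Y) Z W"
  shows "W \<in> S \<and> part_le Z W \<and> Z \<noteq> W"
proof -
  have XY: "part_le X Y" "X \<noteq> Y" using part_imm_iff[OF S(1,2)] i by blast+
  show ?thesis
  proof (cases "beyond X Y Z")
    case True
    then have Z: "part_le Z X" "Z \<noteq> X" "Z \<noteq> Y" using part_imm_beyond[OF i S]
      by (auto simp: beyond_def)
    then have "part_le Z Y" using part_le_trans XY S by blast
    then show ?thesis using f Z S XY by (auto simp: forced_def)
  next
    case False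
    then show ?thesis using f XY S by (auto simp: forced_def)
  qed
qed

lemma forced_endpoint: "forced (X, Y) Z W \<Longrightarrow> W = X \<or> W = Y"
  by (auto simp: forced_def)

text \<open>Relations forced by an edge of a tree hold in its order, so antisymmetry and immediacy
  exclude every conflict between two of its edges.\<close>

lemma cohere_imm:
  assumes f: "part_imm X Y" "X \<in> S" "Y \<in> S" and g: "part_imm X' Y'" "X' \<in> S" "Y' \<in> S"
  shows "cohere (X, Y) (X', Y')"
proof -
  have "\<not> (forced (X, Y) Z W \<and> forced (X', Y') W Z)" for Z W
  proof
    assume a: "forced (X, Y) Z W \<and> forced (X', Y') W Z"
    then have "Z \<in> S" "W \<in> S" using forced_endpoint f g by blast+
    then show False
      using forced_le[OF f, of Z W] forced_le[OF g, of W Z] a part_le_antisym by blast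
  qed
  moreover have "\<not> (forced (X', Y') X U \<and> forced (X', Y') U Y)" for U
  proof
    assume a: "forced (X', Y') X U \<and> forced (X', Y') U Y"
    have U: "U \<in> S" "part_le X U" "X \<noteq> U" using forced_le[OF g f(2)] a by blast+
    then have "part_le U Y" "U \<noteq> Y" using forced_le[OF g U(1)] a by blast+
    moreover have "part_le Y U" using part_imm_iff[OF f(2,3)] f(1) U by blast
    ultimately show False using part_le_antisym U f by blast
  qed
  moreover have "Y = Y'" if "X = X'" using part_imm_unique f g that by blast
  ultimately show ?thesis unfolding cohere_def by simp
qed

end

text \<open>Compatibility will be known for distinct edges only; the diagonal is what allows a
  single edge to be extended to a tree.\<close>

lemma cohere_self: "X \<noteq> Y \<Longrightarrow> cohere (X, Y) (X, Y)"
  by (auto simp: cohere_def forced_def beyond_def)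

lemma part_containing_eq:
  assumes "disjoint R" "W \<in> R" "X \<subseteq> W" "X \<noteq> {}"
  shows "part_containing R X = W"
  unfolding part_containing_def
  using assms by (intro the_equality) (auto simp: disjoint_def, blast+)

lemma pi_star_arrow: "pi_star R (arrow Y X) = arrow (part_containing R Y) (part_containing R X)"
  by (simp add: pi_star_def arrow_def frag_extend_diff)

section \<open>Cluster morphisms as families of search orders\<close>

locale refinement =
  fixes V :: "'a::linorder set" and S Q :: "'a set set"
  assumes nc: "noncrossing_partition V S"
    and refines: "refines V S Q"
begin

sublocale nc_partition V S
  using nc by unfold_locales

lemma partition_Q: "partition_on V Q"
  using refines by (simp add: refines_def)

lemma disjoint_Q: "disjoint Q"
  using partition_Q by (simp add: partition_on_def)

lemma Q_nonempty: "W \<in> Q \<Longrightarrow> W \<noteq> {}"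
  using partition_Q by (auto simp: partition_on_def)

lemma Q_subset: "W \<in> Q \<Longrightarrow> W \<subseteq> V"
  using partition_Q by (auto simp: partition_on_def)

lemma Q_eq: "\<lbrakk>W \<in> Q; W' \<in> Q; x \<in> W; x \<in> W'\<rbrakk> \<Longrightarrow> W = W'"
  using disjoint_Q unfolding disjoint_def by blast

lemma QE: assumes "x \<in> V" obtains W where "W \<in> Q" "x \<in> W"
  using partition_Q assms by (auto simp: partition_on_def)

lemma part_in_Q: assumes "X \<in> S" obtains W where "W \<in> Q" "X \<subseteq> W"
  using refines assms by (auto simp: refines_def)

lemma part_sub: "\<lbrakk>X \<in> S; W \<in> Q; x \<in> X; x \<in> W\<rbrakk> \<Longrightarrow> X \<subseteq> W"
  using part_in_Q Q_eq by (metis subsetD)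

lemma same_SQ: "same_part S x y \<Longrightarrow> same_part Q x y"
  unfolding same_part_def using part_in_Q by (metis subsetD)

lemma nc_fiber:
  assumes "W \<in> Q"
  shows "noncrossing_partition W (fiber S W)"
proof -
  have "partition_on W (fiber S W)"
  proof (rule partition_onI)
    show "\<Union>(fiber S W) = W"
    proof
      show "W \<subseteq> \<Union>(fiber S W)"
        using part_sub assms Q_subset partE by (auto simp: fiber_def) (metis subsetD)
    qed (auto simp: fiber_def)
    show "disjnt p q" if "p \<in> fiber S W" "q \<in> fiber S W" "p \<noteq> q" for p q
      using that part_eq unfolding fiber_def disjnt_def by blast
    show "{} \<notin> fiber S W" using part_nonempty by (auto simp: fiber_def)
  qed
  moreover have "noncrossing (fiber S W)"
    using nc noncrossing_subset[of S] by (auto simp: noncrossing_partition_def fiber_def)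
  ultimately show ?thesis
    using finite Q_subset[OF assms] finite_subset by (auto simp: noncrossing_partition_def)
qed

lemma same_part_fiber:
  assumes "W \<in> Q" "x \<in> W" "y \<in> W"
  shows "same_part (fiber S W) x y \<longleftrightarrow> same_part S x y"
  using part_sub assms unfolding same_part_def fiber_def by blast

lemma search_order_fiber:
  assumes "W \<in> Q"
  shows "search_order W (fiber S W) le \<longleftrightarrow> search_order W S le"
  by (rule search_order_cong) (simp_all add: same_part_fiber[OF assms])

lemma order_tree_fiber:
  assumes "W \<in> Q"
  shows "order_tree W (fiber S W) le = order_tree W S le"
  unfolding order_tree_def fiber_def imm_def using part_sub assms by blast

lemma nc_search_order_fiber:
  assumes "W \<in> Q" "search_order W S le"
  shows "nc_search_order W (fiber S W) le"
proof -
  have "finite W" using nc_fiber[OF assms(1)] by (simp add: noncrossing_partition_def)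
  then show ?thesis
    using assms nc_fiber[OF assms(1)] Q_nonempty search_order_fiber
    unfolding nc_search_order_def nc_partition_def finite_search_order_def nc_search_order_axioms_def
    by blast
qed

definition orders :: "('a \<Rightarrow> 'a \<Rightarrow> bool) \<Rightarrow> bool" where
  "orders le \<longleftrightarrow> (\<forall>W\<in>Q. search_order W S le)"

definition cluster :: "('a \<Rightarrow> 'a \<Rightarrow> bool) \<Rightarrow> ('a set \<Rightarrow>\<^sub>0 int) set" where
  "cluster le = (\<Union>W\<in>Q. order_tree W S le)"

lemma glue:
  obtains le where "\<And>W x y. W \<in> Q \<Longrightarrow> x \<in> W \<Longrightarrow> le x y \<longleftrightarrow> L W x y"
proof
  show "(\<exists>W\<in>Q. x \<in> W \<and> L W x y) \<longleftrightarrow> L W x y" if "W \<in> Q" "x \<in> W" for W x y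
    using that Q_eq by blast
qed

lemma cluster_morphism_iff:
  "cluster_morphism Q S T \<longleftrightarrow> (\<exists>le. orders le \<and> T = cluster le)"
proof
  assume "cluster_morphism Q S T"
  then obtain U
    where U: "\<And>W. W \<in> Q \<Longrightarrow> \<exists>F. binary_forest (fiber S W) F \<and> generated_tree (fiber S W) F (U W)"
    and T: "T = (\<Union>W\<in>Q. U W)"
    unfolding cluster_morphism_def by blast
  have "\<exists>le. search_order W (fiber S W) le \<and> order_tree W (fiber S W) le = U W" if W: "W \<in> Q" for W
  proof -
    obtain F where "binary_forest (fiber S W) F" "generated_tree (fiber S W) F (U W)"
      using U[OF W] by blast
    then have "forest_tree W (fiber S W) F (U W)"
      using nc_fiber[OF W] Q_nonempty[OF W]
      by (simp add: forest_tree_def nc_partition_def forest_tree_axioms_def)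
    then show ?thesis by (rule forest_tree.search_order_exists)
  qed
  then obtain L where L: "\<And>W. W \<in> Q \<Longrightarrow> search_order W S (L W)"
    "\<And>W. W \<in> Q \<Longrightarrow> order_tree W S (L W) = U W"
    using search_order_fiber order_tree_fiber by metis
  obtain le where le: "\<And>W x y. W \<in> Q \<Longrightarrow> x \<in> W \<Longrightarrow> le x y \<longleftrightarrow> L W x y" using glue[of L] by blast
  have "search_order W S le" "order_tree W S le = U W" if "W \<in> Q" for W
    using L[OF that] search_order_cong[of W le "L W" S S] order_tree_cong[of W le "L W" S] le[OF that]
    by auto
  then show "\<exists>le. orders le \<and> T = cluster le" unfolding orders_def cluster_def T by blast
next
  assume "\<exists>le. orders le \<and> T = cluster le"
  then obtain le where le: "orders le" "T = cluster le" by blast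
  have "\<exists>F. binary_forest (fiber S W) F \<and> generated_tree (fiber S W) F (order_tree W S le)"
    if "W \<in> Q" for W
    using nc_search_order.generated_by_search_order[OF nc_search_order_fiber[OF that]]
      order_tree_fiber[OF that] le that unfolding orders_def by metis
  then show "cluster_morphism Q S T"
    unfolding cluster_morphism_def le(2) cluster_def
      by (intro exI[of _ "\<lambda>W. order_tree W S le"]) blast
qed

lemma cluster_rel_edges:
  assumes "orders le"
  shows "cluster le \<subseteq> rel_edges S Q"
proof -
  have "order_tree W S le \<subseteq> edges (fiber S W)" if W: "W \<in> Q" for W
  proof -
    have "nc_search_order W (fiber S W) le"
      using nc_search_order_fiber[OF W] assms W by (simp add: orders_def)
    from nc_search_order.generated_by_search_order[OF this]
    show ?thesis by (auto simp: generated_tree_def order_tree_fiber[OF W])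
  qed
  then show ?thesis unfolding cluster_def rel_edges_def by blast
qed

lemma clusterE:
  assumes "e \<in> cluster le"
  obtains W Y X x y where "W \<in> Q" "e = arrow Y X" "X \<in> S" "Y \<in> S" "x \<in> X" "y \<in> Y" "imm W le x y"
  using assms unfolding cluster_def order_tree_def by blast

lemma clusterI:
  "\<lbrakk>W \<in> Q; X \<in> S; Y \<in> S; x \<in> X; y \<in> Y; imm W le x y\<rbrakk> \<Longrightarrow> arrow Y X \<in> cluster le"
  unfolding cluster_def order_tree_def by blast

lemma finite_search_order_Q: "orders le \<Longrightarrow> W \<in> Q \<Longrightarrow> finite_search_order W S le"
  using finite_subset[OF Q_subset finite] by (simp add: orders_def finite_search_order_def)

lemma imm_not_same:
  assumes "orders le" "W \<in> Q" "imm W le x y"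
  shows "\<not> same_part S x y"
  using finite_search_order.same_iff[OF finite_search_order_Q[OF assms(1,2)]] assms(3)
  by (auto simp: imm_def)

lemma imm_parts_cong:
  assumes "orders le" "W \<in> Q" "imm W le x y" "X \<in> S" "Y \<in> S" "x \<in> X" "y \<in> Y" "x' \<in> X" "y' \<in> Y"
  shows "imm W le x' y'"
proof -
  have "same_part S x x'" "same_part S y y'" "x' \<in> W" "y' \<in> W"
    using assms part_sub[of X W x] part_sub[of Y W y] unfolding same_part_def imm_def by blast+
  then show ?thesis
    using finite_search_order.imm_cong[OF finite_search_order_Q[OF assms(1,2)] assms(3)] by blast
qed

lemma cluster_arrowD:
  assumes "arrow Y X \<in> cluster le" "orders le" "X \<in> S" "Y \<in> S" "X \<noteq> Y" "x \<in> X" "y \<in> Y"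
  shows "\<exists>W\<in>Q. imm W le x y"
proof -
  obtain W X' Y' x' y' where W: "W \<in> Q" "arrow Y X = arrow Y' X'" "X' \<in> S" "Y' \<in> S" "x' \<in> X'"
    "y' \<in> Y'" "imm W le x' y'"
    using clusterE[OF assms(1)] by metis
  then have "X' = X" "Y' = Y" using arrow_eq_iff[OF assms(5)] by metis+
  then show ?thesis using imm_parts_cong[OF assms(2) W(1,7)] W assms by blast
qed

text \<open>The flag property. A tree containing two edges shows that they cohere, and coherence is
  all that the construction of a search order uses. Empty \<open>E\<close> provides some cluster; a
  singleton shows that every edge occurs in one.\<close>

lemma pairwise_compatible_cluster:
  assumes E: "E \<subseteq> rel_edges S Q" and compat: "\<And>e e'. \<lbrakk>e \<in> E; e' \<in> E; e \<noteq> e'\<rbrakk> \<Longrightarrow> compatible S Q e e'"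
  obtains le where "orders le" "E \<subseteq> cluster le"
proof -
  define EW where "EW W = {(X, Y). X \<in> fiber S W \<and> Y \<in> fiber S W \<and> arrow Y X \<in> E}" for W
  have edge: "X \<noteq> Y \<and> link (fiber S W) X Y" if W: "W \<in> Q" and XY: "(X, Y) \<in> EW W" for W X Y
  proof -
    have f: "X \<in> fiber S W" "Y \<in> fiber S W" "arrow Y X \<in> E" using XY by (auto simp: EW_def)
    then obtain W' where W': "W' \<in> Q" "arrow Y X \<in> edges (fiber S W')"
      using E unfolding rel_edges_def by blast
    interpret F: nc_partition W' "fiber S W'" using nc_fiber[OF W'(1)] by unfold_locales
    obtain X' Y' where X'Y': "arrow Y X = arrow Y' X'" "X' \<noteq> Y'" "X' \<in> fiber S W'" "Y' \<in> fiber S W'"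
      "par (fiber S W') X' Y' \<or> covers (fiber S W') Y' X'"
      using F.edgesE[OF W'(2)] by metis
    then have eq: "X = X'" "Y = Y'" using arrow_eq_iff[OF X'Y'(2), of Y X] by auto
    obtain x where "x \<in> X" using F.part_nonempty X'Y'(3) eq by blast
    then have "x \<in> W" "x \<in> W'" using f(1) X'Y'(3) eq by (auto simp: fiber_def)
    then have "W' = W" using Q_eq W W' by blast
    then show ?thesis using F.edge_link[OF X'Y'(3,4,2,5)] X'Y'(2) eq by simp
  qed
  have coh: "cohere f g" if W: "W \<in> Q" and fg: "f \<in> EW W" "g \<in> EW W" for W f g
  proof (cases "f = g")
    case True
    obtain X Y where "f = (X, Y)" by force
    then show ?thesis using True edge W fg cohere_self by blast
  next
    case False
    obtain X Y X' Y' where XY: "f = (X, Y)" "g = (X', Y')" by (metis surj_pair)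
    have f: "X \<in> fiber S W" "Y \<in> fiber S W" "arrow Y X \<in> E" "X \<noteq> Y"
      and g: "X' \<in> fiber S W" "Y' \<in> fiber S W" "arrow Y' X' \<in> E" "X' \<noteq> Y'"
      using fg edge[OF W] XY by (auto simp: EW_def)
    have "arrow Y X \<noteq> arrow Y' X'" using arrow_eq_iff[OF f(4)] False XY by auto
    then have "compatible S Q (arrow Y X) (arrow Y' X')" using compat f g by blast
    then obtain le where le: "orders le" "arrow Y X \<in> cluster le" "arrow Y' X' \<in> cluster le"
      unfolding compatible_def cluster_morphism_iff by blast
    interpret F: nc_search_order W "fiber S W" le
      using nc_search_order_fiber[OF W] le W by (simp add: orders_def)
    have "F.part_imm A B" if A: "A \<in> fiber S W" "B \<in> fiber S W" "arrow B A \<in> cluster le" "A \<noteq> B"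
      for A B
    proof -
      obtain a b where ab: "a \<in> A" "b \<in> B" using F.part_nonempty A by (metis ex_in_conv)
      have "A \<in> S" "B \<in> S" using A(1,2) by (simp_all add: fiber_def)
      then obtain W' where "W' \<in> Q" "imm W' le a b"
        using cluster_arrowD[OF A(3) le(1) _ _ A(4) ab] by blast
      moreover from this have "W' = W" using Q_eq[OF _ W] A(1) ab by (auto simp: imm_def fiber_def)
      ultimately show ?thesis using ab F.part_imm_def by blast
    qed
    then have "F.part_imm X Y" "F.part_imm X' Y'" using f g le by blast+
    then show ?thesis using F.cohere_imm f(1,2) g(1,2) XY by simp
  qed
  have "\<exists>le. search_order W S le \<and> (\<forall>X Y x y. (X, Y) \<in> EW W \<longrightarrow> x \<in> X \<longrightarrow> y \<in> Y \<longrightarrow> imm W le x y)"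
    if W: "W \<in> Q" for W
  proof -
    interpret C: coherent_links W "fiber S W" "EW W"
      using nc_fiber[OF W] edge[OF W] coh[OF W]
      by (simp add: coherent_links_def nc_partition_def coherent_links_axioms_def)
    obtain A where "admissible (fiber S W) (EW W) A" using C.admissible_exists Q_nonempty W by blast
    from coherent_links_search_order[OF C.coherent_links_axioms this]
    show ?thesis using search_order_fiber[OF W] by blast
  qed
  then obtain L where L: "\<And>W. W \<in> Q \<Longrightarrow> search_order W S (L W)"
    "\<And>W X Y x y. \<lbrakk>W \<in> Q; (X, Y) \<in> EW W; x \<in> X; y \<in> Y\<rbrakk> \<Longrightarrow> imm W (L W) x y"
    by metis
  obtain le where le: "\<And>W x y. W \<in> Q \<Longrightarrow> x \<in> W \<Longrightarrow> le x y \<longleftrightarrow> L W x y" using glue[of L] by blast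
  have "orders le"
    using L(1) search_order_cong[of _ le _ S S] le unfolding orders_def by blast
  moreover have "E \<subseteq> cluster le"
  proof
    fix e assume e: "e \<in> E"
    then obtain W where W: "W \<in> Q" "e \<in> edges (fiber S W)" using E by (auto simp: rel_edges_def)
    interpret F: nc_partition W "fiber S W" using nc_fiber[OF W(1)] by unfold_locales
    obtain X Y where XY: "e = arrow Y X" "X \<in> fiber S W" "Y \<in> fiber S W" using F.edgesE[OF W(2)]
      by metis
    then obtain x y where xy: "x \<in> X" "y \<in> Y" using F.part_nonempty by (metis ex_in_conv)
    have "imm W (L W) x y" using L(2)[OF W(1) _ xy] XY e by (simp add: EW_def)
    then have "imm W le x y" using imm_cong_order[of W le "L W"] le[OF W(1)] by blast
    then show "e \<in> cluster le" using clusterI[OF W(1)] XY xy by (auto simp: fiber_def)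
  qed
  ultimately show ?thesis by (rule that)
qed

end

section \<open>The bijection for three nested partitions\<close>

locale tower = SQ: refinement V S Q + SR: refinement V S R + RQ: refinement V R Q
  for V :: "'a::linorder set" and Q R S +
  fixes leT :: "'a \<Rightarrow> 'a \<Rightarrow> bool" and T
  assumes leT: "SR.orders leT" and T: "T = SR.cluster leT"
begin

lemma block_sub: "\<lbrakk>W \<in> R; W0 \<in> Q; W \<inter> W0 \<noteq> {}\<rbrakk> \<Longrightarrow> W \<subseteq> W0"
  using RQ.part_sub by blast

lemma blocks: "W0 \<in> Q \<Longrightarrow> blocks W0 S R leT"
  using SQ.Q_subset[of W0] SQ.finite SR.partition_Q SR.disjoint_Q block_sub SR.same_SQ leT
  by unfold_locales (auto simp: partition_on_def SR.orders_def intro: finite_subset)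

lemma block_orders:
  assumes le: "SQ.orders le" "T \<subseteq> SQ.cluster le" and W0: "W0 \<in> Q"
  shows "block_orders W0 S le R leT"
proof -
  interpret blocks W0 S R leT by (rule blocks[OF W0])
  have "imm W0 le x y" if W: "W \<in> R" "W \<subseteq> W0" and i: "imm W leT x y" for W x y
  proof -
    have "x \<in> V" "y \<in> V" "x \<in> W0" using i W SR.Q_subset by (auto simp: imm_def)
    then obtain X Y where XY: "X \<in> S" "x \<in> X" "Y \<in> S" "y \<in> Y" using SQ.partE by metis
    have "X \<noteq> Y" using SR.imm_not_same[OF leT W(1) i] XY by (auto simp: same_part_def)
    moreover have "arrow Y X \<in> SQ.cluster le"
      using SR.clusterI[OF W(1) XY(1,3,2,4) i] le(2) T by blast
    ultimately obtain W' where W': "W' \<in> Q" "imm W' le x y"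
      using SQ.cluster_arrowD[OF _ le(1) XY(1,3) _ XY(2,4)] by blast
    then have "W' = W0" using SQ.Q_eq W0 \<open>x \<in> W0\<close> by (auto simp: imm_def)
    then show ?thesis using W' by blast
  qed
  then show ?thesis
    using SQ.finite_search_order_Q[OF le(1) W0] blocks_axioms
    by (simp add: block_orders_def block_orders_axioms_def)
qed

lemma part_containing:
  assumes "X \<in> S" "x \<in> X" "x \<in> W" "W \<in> R"
  shows "part_containing R X = W"
  using part_containing_eq[OF SR.disjoint_Q assms(4) SR.part_sub[OF assms(1,4,2,3)]] assms(2)
    by blast

lemma pi_star_zero: "f \<in> T \<Longrightarrow> pi_star R f = 0"
proof -
  assume "f \<in> T"
  then obtain W X Y x y where *: "W \<in> R" "f = arrow Y X" "X \<in> S" "Y \<in> S" "x \<in> X" "y \<in> Y"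
    "imm W leT x y"
    unfolding T by (elim SR.clusterE) blast
  then have "part_containing R X = W" "part_containing R Y = W"
    using part_containing by (auto simp: imm_def)
  then show ?thesis using * by (simp add: pi_star_arrow)
qed

text \<open>By \<open>imm_same_block\<close> an edge inside a block already belongs to
  \<open>T\<close>; the remaining edges join different blocks and keep a nonzero image.\<close>

lemma outside_T:
  assumes le: "SQ.orders le" "T \<subseteq> SQ.cluster le" and f: "f \<in> SQ.cluster le" "f \<notin> T"
  obtains W Y X x y A B where "W \<in> Q" "f = arrow Y X" "X \<in> S" "Y \<in> S" "x \<in> X" "y \<in> Y" "imm W le x y"
    "A \<in> R" "x \<in> A" "B \<in> R" "y \<in> B" "\<not> same_part R x y" "pi_star R f = arrow B A"
proof -
  obtain W X Y x y where *: "W \<in> Q" "f = arrow Y X" "X \<in> S" "Y \<in> S" "x \<in> X" "y \<in> Y" "imm W le x y"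
    using f(1) by (elim SQ.clusterE) blast
  interpret block_orders W S le R leT by (rule block_orders[OF le *(1)])
  have "\<not> same_part R x y"
  proof
    assume "same_part R x y"
    then obtain A where "A \<in> R" "imm A leT x y" using imm_same_block *(7) by blast
    then show False using SR.clusterI[of A X Y x y leT] * f(2) T by blast
  qed
  moreover have "x \<in> V" "y \<in> V" using * SQ.part_subset by blast+
  then obtain A B where AB: "A \<in> R" "x \<in> A" "B \<in> R" "y \<in> B" using SR.QE by metis
  moreover have "pi_star R f = arrow B A"
    using part_containing * AB by (simp add: pi_star_arrow)
  ultimately show ?thesis using that * by blast
qed

lemma contraction:
  assumes le: "SQ.orders le" "T \<subseteq> SQ.cluster le"
  obtains le' where "RQ.orders le'" "\<And>f. f \<in> SQ.cluster le \<Longrightarrow> f \<notin> T \<Longrightarrow> pi_star R f \<in> RQ.cluster le'"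
proof
  let ?le' = "block_orders.contract le R"
  show "RQ.orders ?le'"
    using block_orders.search_order_contract[OF block_orders[OF le]] by (simp add: RQ.orders_def)
  fix f assume "f \<in> SQ.cluster le" "f \<notin> T"
  then obtain W Y X x y A B where *: "W \<in> Q" "f = arrow Y X" "X \<in> S" "Y \<in> S" "x \<in> X" "y \<in> Y"
    "imm W le x y" "A \<in> R" "x \<in> A" "B \<in> R" "y \<in> B" "\<not> same_part R x y" "pi_star R f = arrow B A"
    by (rule outside_T[OF le])
  have "imm W ?le' x y" using block_orders.imm_contract[OF block_orders[OF le *(1)] *(7,12)] .
  then show "pi_star R f \<in> RQ.cluster ?le'" using RQ.clusterI * by metis
qed

lemma expansion:
  assumes le': "RQ.orders le'"
  obtains le where "SQ.orders le" "T \<subseteq> SQ.cluster le"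
    "\<And>e. e \<in> RQ.cluster le' \<Longrightarrow> \<exists>f\<in>SQ.cluster le. f \<notin> T \<and> pi_star R f = e"
proof
  let ?le = "expansion.expand R le' leT"
  have exp: "expansion W S R le' leT" if "W \<in> Q" for W
    using RQ.finite_search_order_Q[OF le' that] blocks[OF that] by (simp add: expansion_def)
  show orders: "SQ.orders ?le"
    using expansion.search_order_expand[OF exp] by (simp add: SQ.orders_def)
  show "T \<subseteq> SQ.cluster ?le"
  proof
    fix f assume "f \<in> T"
    then obtain W X Y x y where *: "W \<in> R" "f = arrow Y X" "X \<in> S" "Y \<in> S" "x \<in> X" "y \<in> Y"
      "imm W leT x y"
      unfolding T by (elim SR.clusterE) blast
    obtain W0 where "W0 \<in> Q" "W \<subseteq> W0" using RQ.part_in_Q *(1) by blast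
    then show "f \<in> SQ.cluster ?le"
      using expansion.imm_expand_block[OF exp *(1) _ *(7)] SQ.clusterI * by blast
  qed
  fix e assume "e \<in> RQ.cluster le'"
  then obtain W A B a b where *: "W \<in> Q" "e = arrow B A" "A \<in> R" "B \<in> R" "a \<in> A" "b \<in> B"
    "imm W le' a b"
    by (elim RQ.clusterE) blast
  obtain x y where xy: "same_part R a x" "same_part R b y" "imm W ?le x y"
    using expansion.imm_expand_lift[OF exp[OF *(1)] *(7)] by blast
  have AB: "x \<in> A" "y \<in> B" using xy * SR.Q_eq unfolding same_part_def by blast+
  then obtain X Y where XY: "X \<in> S" "x \<in> X" "Y \<in> S" "y \<in> Y"
    using SQ.partE SR.Q_subset * by (metis subsetD)
  have f: "arrow Y X \<in> SQ.cluster ?le" using SQ.clusterI[OF *(1)] XY xy by blast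
  have e: "pi_star R (arrow Y X) = e"
    using part_containing XY AB * by (simp add: pi_star_arrow)
  \<comment> \<open>A nonzero image keeps the lift out of \<open>T\<close>, whose elements
    \<open>pi_star R\<close> sends to zero.\<close>
  have "A \<noteq> B" using RQ.imm_not_same[OF le' *(1,7)] * by (auto simp: same_part_def)
  then have "e \<noteq> 0" using *(2) arrow_eq_zero_iff[of B A] by simp
  then have "arrow Y X \<notin> T" using pi_star_zero e by metis
  then show "\<exists>f\<in>SQ.cluster ?le. f \<notin> T \<and> pi_star R f = e" using f e by blast
qed

text \<open>The edges may come from different trees, so neither order alone compares them.
  Everything is transported through \<open>leT\<close>, with which both orders agree on
  blocks.\<close>

lemma pi_star_injective:
  assumes le1: "SQ.orders le1" "T \<subseteq> SQ.cluster le1" and f1: "f1 \<in> SQ.cluster le1" "f1 \<notin> T"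
    and le2: "SQ.orders le2" "T \<subseteq> SQ.cluster le2" and f2: "f2 \<in> SQ.cluster le2" "f2 \<notin> T"
    and eq: "pi_star R f1 = pi_star R f2"
  shows "f1 = f2"
proof -
  obtain W X Y x y A B where 1: "W \<in> Q" "f1 = arrow Y X" "X \<in> S" "Y \<in> S" "x \<in> X" "y \<in> Y"
    "imm W le1 x y"
    "A \<in> R" "x \<in> A" "B \<in> R" "y \<in> B" "\<not> same_part R x y" "pi_star R f1 = arrow B A"
    using f1 by (rule outside_T[OF le1])
  obtain W' X' Y' x' y' A' B' where 2: "W' \<in> Q" "f2 = arrow Y' X'" "X' \<in> S" "Y' \<in> S" "x' \<in> X'"
    "y' \<in> Y'" "imm W' le2 x' y'"
    "A' \<in> R" "x' \<in> A'" "B' \<in> R" "y' \<in> B'" "\<not> same_part R x' y'" "pi_star R f2 = arrow B' A'"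
    using f2 by (rule outside_T[OF le2])
  have "A \<noteq> B" using 1 by (auto simp: same_part_def)
  then have AB: "A' = A" "B' = B" using arrow_eq_iff[of A B B' A'] eq 1(13) 2(13) by auto
  then have same: "same_part R x x'" "same_part R y y'" using 1 2 by (auto simp: same_part_def)
  interpret O1: block_orders W S le1 R leT by (rule block_orders[OF le1 1(1)])
  have "x \<in> W" "y \<in> W" using 1 by (auto simp: imm_def)
  then have W2: "x' \<in> W" "y' \<in> W" using O1.same_R_V same by blast+
  then have "W' = W" using SQ.Q_eq[OF 2(1) 1(1)] 2(7) by (auto simp: imm_def)
  then interpret O2: block_orders W S le2 R leT using block_orders[OF le2 2(1)] by simp
  have LT: "same_part S u v" if uv: "u \<in> W" "same_part R u v" "leT u v" "leT v u" for u v
  proof -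
    have "v \<in> W" using O1.same_R_V uv by blast
    then show ?thesis
      using O1.leT_iff[of u v] O1.leT_iff[of v u] O1.same_R_sym O1.same_iff[of u v] uv by blast
  qed
  have i1: "imm W le1 x y" and i2: "imm W le2 x' y'" using 1 2 \<open>W' = W\<close> by simp_all
  \<comment> \<open>Both sources are tops of the same block for \<open>leT\<close>, hence lie in the
    same part.\<close>
  have "leT x' x" by (rule O1.imm_block_top[OF i1 1(12) same(1)])
  moreover have "leT x x'" by (rule O2.imm_block_top[OF i2 2(12) O1.same_R_sym[OF same(1)]])
  ultimately have xx: "same_part S x x'" using LT[OF \<open>x \<in> W\<close> same(1)] by blast
  then have X: "X' = X" using 1 2 SQ.part_eq unfolding same_part_def by metis
  then have i2: "imm W le2 x y'"
    using SQ.imm_parts_cong[OF le2(1) 1(1) i2 2(3,4,5,6) _ 2(6)] 1(5) by blast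
  have n2: "\<not> same_part R x y'" using 1(12) O1.same_R_trans[OF _ O1.same_R_sym[OF same(2)]] by blast
  have le: "le1 x y" "le2 x y'" using i1 i2 by (auto simp: imm_def)
  \<comment> \<open>By \<open>le_block_iff\<close> the comparison of \<open>x\<close> with members
    of the target block depends on \<open>leT\<close> only. So each order puts both targets above
    \<open>x\<close>, and immediacy puts its own target below the other one.\<close>
  have "le2 x y"
    using O1.le_block_iff[OF \<open>x \<in> W\<close> \<open>y \<in> W\<close> O1.same_R_refl[OF \<open>y \<in> W\<close>] le(1)]
      O2.le_block_iff[OF \<open>x \<in> W\<close> \<open>y \<in> W\<close> same(2) le(2)] le(1) by blast
  moreover have "le1 x y'"
    using O2.le_block_iff[OF \<open>x \<in> W\<close> \<open>y' \<in> W\<close> O1.same_R_refl[OF \<open>y' \<in> W\<close>] le(2)]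
      O1.le_block_iff[OF \<open>x \<in> W\<close> \<open>y' \<in> W\<close> O1.same_R_sym[OF same(2)] le(1)] le(2) by blast
  moreover have "\<not> le2 y x" "\<not> le1 y' x"
    using calculation O1.same_iff[of x y'] O2.same_iff[of x y] O1.same_SR 1(12) n2 \<open>x \<in> W\<close> \<open>y \<in> W\<close> \<open>y' \<in> W\<close> by blast+
  ultimately have "le2 y' y" "le1 y y'" using i1 i2 \<open>y \<in> W\<close> \<open>y' \<in> W\<close> by (auto simp: imm_def)
  then have "leT y' y" "leT y y'"
    using O1.leT_iff[OF \<open>y \<in> W\<close> same(2)] O2.leT_iff[OF \<open>y' \<in> W\<close> O1.same_R_sym[OF same(2)]] by blast+
  then have "same_part S y y'" using LT[OF \<open>y \<in> W\<close> same(2)] by blast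
  then have "Y' = Y" using 1 2 SQ.part_eq unfolding same_part_def by metis
  then show ?thesis using X 1 2 by simp
qed

lemma compatible_iff:
  "compatible S Q e e' \<longleftrightarrow> (\<exists>le. SQ.orders le \<and> e \<in> SQ.cluster le \<and> e' \<in> SQ.cluster le)"
  unfolding compatible_def SQ.cluster_morphism_iff using SQ.cluster_rel_edges by blast

lemma compatible_iff_R:
  "compatible R Q e e' \<longleftrightarrow> (\<exists>le. RQ.orders le \<and> e \<in> RQ.cluster le \<and> e' \<in> RQ.cluster le)"
  unfolding compatible_def RQ.cluster_morphism_iff using RQ.cluster_rel_edges by blast

lemma extend_T:
  assumes E: "E \<subseteq> compatible_edges S Q T"
    and compat: "\<And>e e'. \<lbrakk>e \<in> E; e' \<in> E; e \<noteq> e'\<rbrakk> \<Longrightarrow> compatible S Q e e'"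
  obtains le where "SQ.orders le" "T \<subseteq> SQ.cluster le" "E \<subseteq> SQ.cluster le"
proof -
  \<comment> \<open>Elements of \<open>T\<close> are compatible with each other in
    \<open>rel_edges S Q\<close> because the refinement of an arbitrary tree of \<open>R\<close>
    contains \<open>T\<close>.\<close>
  obtain le' where "RQ.orders le'" using RQ.pairwise_compatible_cluster[of "{}"] by blast
  then obtain le0 where le0: "SQ.orders le0" "T \<subseteq> SQ.cluster le0" using expansion by metis
  have TT: "compatible S Q t t'" if "t \<in> T" "t' \<in> T" for t t' using le0 that compatible_iff by blast
  have sym: "compatible S Q e e' \<Longrightarrow> compatible S Q e' e" for e e' unfolding compatible_iff by blast
  have ET: "compatible S Q e t" if "e \<in> E" "t \<in> T" for e t using E that
    by (auto simp: compatible_edges_def)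
  have "T \<subseteq> rel_edges S Q" using le0 SQ.cluster_rel_edges by blast
  moreover have "E \<subseteq> rel_edges S Q" using E by (auto simp: compatible_edges_def)
  ultimately obtain le where "SQ.orders le" "T \<union> E \<subseteq> SQ.cluster le"
    using SQ.pairwise_compatible_cluster[of "T \<union> E"] TT ET sym compat by (metis Un_iff Un_least)
  then show ?thesis using that by blast
qed

lemma not_in_T: "e \<in> compatible_edges S Q T \<Longrightarrow> e \<notin> T"
  by (simp add: compatible_edges_def)

lemma compatible_edgesI:
  "\<lbrakk>SQ.orders le; T \<subseteq> SQ.cluster le; f \<in> SQ.cluster le; f \<notin> T\<rbrakk> \<Longrightarrow> f \<in> compatible_edges S Q T"
  unfolding compatible_edges_def using compatible_iff SQ.cluster_rel_edges by blast

lemma extend_single: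
  assumes "e \<in> compatible_edges S Q T"
  obtains le where "SQ.orders le" "T \<subseteq> SQ.cluster le" "e \<in> SQ.cluster le"
  using extend_T[of "{e}"] assms by auto

lemma pi_star_inj_on: "inj_on (pi_star R) (compatible_edges S Q T)"
proof (rule inj_onI)
  fix e e' assume e: "e \<in> compatible_edges S Q T" "e' \<in> compatible_edges S Q T"
    "pi_star R e = pi_star R e'"
  obtain le where le: "SQ.orders le" "T \<subseteq> SQ.cluster le" "e \<in> SQ.cluster le"
    using extend_single e(1) by blast
  obtain le' where le': "SQ.orders le'" "T \<subseteq> SQ.cluster le'" "e' \<in> SQ.cluster le'"
    using extend_single e(2) by blast
  show "e = e'"
    using pi_star_injective[OF le not_in_T[OF e(1)] le' not_in_T[OF e(2)] e(3)] .
qed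

lemma pi_star_image: "pi_star R ` compatible_edges S Q T = rel_edges R Q"
proof
  show "pi_star R ` compatible_edges S Q T \<subseteq> rel_edges R Q"
  proof
    fix g assume "g \<in> pi_star R ` compatible_edges S Q T"
    then obtain e where e: "e \<in> compatible_edges S Q T" "g = pi_star R e" by blast
    obtain le where le: "SQ.orders le" "T \<subseteq> SQ.cluster le" "e \<in> SQ.cluster le"
      using extend_single e(1) by blast
    obtain le' where "RQ.orders le'" "g \<in> RQ.cluster le'"
      using contraction[OF le(1,2)] le(3) not_in_T[OF e(1)] e(2) by metis
    then show "g \<in> rel_edges R Q" using RQ.cluster_rel_edges by blast
  qed
  show "rel_edges R Q \<subseteq> pi_star R ` compatible_edges S Q T"
  proof
    fix g assume g: "g \<in> rel_edges R Q"
    obtain le' where le': "RQ.orders le'" "{g} \<subseteq> RQ.cluster le'"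
      using RQ.pairwise_compatible_cluster[of "{g}"] g by auto
    obtain le where le: "SQ.orders le" "T \<subseteq> SQ.cluster le"
      "\<And>e. e \<in> RQ.cluster le' \<Longrightarrow> \<exists>f\<in>SQ.cluster le. f \<notin> T \<and> pi_star R f = e"
      using expansion[OF le'(1)] by metis
    then obtain f where "f \<in> SQ.cluster le" "f \<notin> T" "pi_star R f = g" using le'(2) by blast
    then show "g \<in> pi_star R ` compatible_edges S Q T" using compatible_edgesI[OF le(1,2)] by blast
  qed
qed

lemma compatible_pi_star_iff:
  assumes e: "e \<in> compatible_edges S Q T" and e': "e' \<in> compatible_edges S Q T"
  shows "compatible S Q e e' \<longleftrightarrow> compatible R Q (pi_star R e) (pi_star R e')"
proof
  assume "compatible S Q e e'"
  moreover have "compatible S Q a b \<Longrightarrow> compatible S Q b a" for a b unfolding compatible_iff by blast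
  ultimately obtain le where le: "SQ.orders le" "T \<subseteq> SQ.cluster le" "{e, e'} \<subseteq> SQ.cluster le"
    using extend_T[of "{e, e'}"] e e' by blast
  obtain le' where "RQ.orders le'" "\<And>f. f \<in> SQ.cluster le \<Longrightarrow> f \<notin> T \<Longrightarrow> pi_star R f \<in> RQ.cluster le'"
    using contraction[OF le(1,2)] by metis
  then show "compatible R Q (pi_star R e) (pi_star R e')"
    using le(3) not_in_T e e' unfolding compatible_iff_R by blast
next
  assume "compatible R Q (pi_star R e) (pi_star R e')"
  then obtain le' where le': "RQ.orders le'" "pi_star R e \<in> RQ.cluster le'"
    "pi_star R e' \<in> RQ.cluster le'"
    unfolding compatible_iff_R by blast
  obtain le where le: "SQ.orders le" "T \<subseteq> SQ.cluster le"
    "\<And>e. e \<in> RQ.cluster le' \<Longrightarrow> \<exists>f\<in>SQ.cluster le. f \<notin> T \<and> pi_star R f = e"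
    using expansion[OF le'(1)] by metis
  \<comment> \<open>The refined tree contains some lift of the image of \<open>a\<close>; by
    injectivity this lift is \<open>a\<close> itself.\<close>
  have "a \<in> SQ.cluster le" if a: "a \<in> compatible_edges S Q T" "pi_star R a \<in> RQ.cluster le'" for a
  proof -
    obtain f where f: "f \<in> SQ.cluster le" "f \<notin> T" "pi_star R f = pi_star R a" using le(3) a(2)
      by blast
    then have "f \<in> compatible_edges S Q T" using compatible_edgesI[OF le(1,2)] by blast
    then have "f = a" using pi_star_inj_on f(3) a(1) by (auto dest: inj_onD)
    then show ?thesis using f by blast
  qed
  then show "compatible S Q e e'" using le(1) le'(2,3) e e' unfolding compatible_iff by blast
qed

end

theorem theorem1p22:
  fixes n :: nat
    and Q R S :: "nat set set"
    and T :: "(nat set \<Rightarrow>\<^sub>0 int) set"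
  assumes "noncrossing_partition {1..n} Q"
    and "noncrossing_partition {1..n} R"
    and "noncrossing_partition {1..n} S"
    and "refines {1..n} S R"
    and "refines {1..n} R Q"
    and "cluster_morphism R S T"
  shows "bij_betw (pi_star R) (compatible_edges S Q T) (rel_edges R Q) \<and>
    (\<forall>e\<in>compatible_edges S Q T. \<forall>e'\<in>compatible_edges S Q T.
       compatible S Q e e' \<longleftrightarrow> compatible R Q (pi_star R e) (pi_star R e'))"
proof -
  have "refines {1..n} S Q"
    using assms(4,5) unfolding refines_def by (meson order_trans)
  then have SQ: "refinement {1..n} S Q" and SR: "refinement {1..n} S R"
    and RQ: "refinement {1..n} R Q"
    using assms by (simp_all add: refinement_def)
  obtain le where "refinement.orders S R le" "T = refinement.cluster S R le"
    using refinement.cluster_morphism_iff[OF SR] assms(6) by blast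
  then interpret tower "{1..n}" Q R S le T
    using SQ SR RQ by (simp add: tower_def tower_axioms_def)
  show ?thesis
    using pi_star_inj_on pi_star_image compatible_pi_star_iff by (simp add: bij_betw_def)
qed

end
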